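(* Let $s_0>\frac12$ and $\chi\in C_0^\infty(\mathbb{R})$. There exists $C>0$ such that for all dyadic integers $N_1,N_2,N_3$ and any zonal functions $f_1,f_2,f_3\in L^2(\mathbb{S}^4)$ (relative to a fixed pole) satisfying $$\mathbf{1}_{\sqrt{1-\Delta}\in[N_j,2N_j]}(f_j)=f_j,\qquad j=1,2,3,$$ one has, with $u_j(t)=S(t)f_j$, $$\sup_{\tau\in\mathbb{R}}\left|\int_{\mathbb{R}}\int_{\mathbb{S}^4}\chi(t)\,e^{it\tau}\,u_1u_2\overline{u}_3\,dx\,dt\right|\le C\,\big(\min(N_1,N_2,N_3)\big)^{s_0}\|f_1\|_{L^2(\mathbb{S}^4)}\|f_2\|_{L^2(\mathbb{S}^4)}\|f_3\|_{L^2(\mathbb{S}^4)} .$$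
   Context: $\mathbb{S}^4$ is the standard four-dimensional sphere with a fixed pole; a function is zonal if it depends only on the geodesic distance to the pole. $\Delta$ is the Laplace–Beltrami operator and $S(t)=e^{it\Delta}$. $\mathbf{1}_{\sqrt{1-\Delta}\in[N,2N]}$ is the spectral projector of $\sqrt{1-\Delta}$ on the interval $[N,2N]$; dyadic integers are $1,2,4,8,\dots$. *)

theory Defs
  imports "HOL-Analysis.Analysis"
begin

subsection \<open>Smooth functions\<close>

text \<open>For open \<open>S\<close>, \<open>Ck_on k S\<close> is the class \<open>C\<^sup>k(S)\<close>.\<close>

primrec Ck_on :: "nat \<Rightarrow> 'a::euclidean_space set \<Rightarrow> ('a \<Rightarrow> 'b::real_normed_vector) \<Rightarrow> bool" where
  "Ck_on 0 S f \<longleftrightarrow> continuous_on S f"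
| "Ck_on (Suc k) S f \<longleftrightarrow>
     f differentiable_on S \<and> (\<forall>b\<in>Basis. Ck_on k S (\<lambda>x. frechet_derivative f (at x) b))"

definition smooth_on :: "'a::euclidean_space set \<Rightarrow> ('a \<Rightarrow> 'b::real_normed_vector) \<Rightarrow> bool" where
  "smooth_on S f \<longleftrightarrow> (\<forall>k. Ck_on k S f)"

definition test_function :: "('a::euclidean_space \<Rightarrow> 'b::real_normed_vector) \<Rightarrow> bool" where
  "test_function f \<longleftrightarrow> smooth_on UNIV f \<and> compact (closure {x. f x \<noteq> 0})"

subsection \<open>Analysis on the unit sphere\<close>

text \<open>
  Functions on the unit sphere are functions on the ambient space of which only the values
  on \<open>sphere 0 1\<close> matter.

  The surface measure is the cone measure: the area of \<open>A\<close> is \<open>n\<close> times the volume of the cone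
  \<open>{r x | x \<in> A, 0 < r < 1}\<close>, where \<open>n\<close> is the dimension of the ambient space.
\<close>

definition sphere_measure :: "'a::euclidean_space measure" where
  "sphere_measure =
     scale_measure (of_nat DIM('a))
       (distr (restrict_space lborel (ball 0 1 - {0})) (restrict_space borel (sphere 0 1))
          (\<lambda>x. x /\<^sub>R norm x))"

definition sphere_L2 :: "('a::euclidean_space \<Rightarrow> complex) set" where
  "sphere_L2 = {f. f \<in> borel_measurable sphere_measure \<and>
                   integrable sphere_measure (\<lambda>x. (cmod (f x))\<^sup>2)}"

definition L2norm :: "('a::euclidean_space \<Rightarrow> complex) \<Rightarrow> real" where
  "L2norm f = sqrt (LINT x|sphere_measure. (cmod (f x))\<^sup>2)"

definition sphere_smooth :: "('a::euclidean_space \<Rightarrow> complex) \<Rightarrow> bool" where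
  "sphere_smooth f \<longleftrightarrow> smooth_on (- {0}) (\<lambda>y. f (y /\<^sub>R norm y))"

text \<open>
  The extension \<open>y \<mapsto> f (y / |y|)\<close> is constant in the normal direction, so its gradient at a
  point of the sphere is the Riemannian gradient of \<open>f\<close>; \<open>tangential_deriv b f\<close> is the component
  of this gradient in the direction \<open>b\<close>.  Likewise \<open>\<Sum>b\<in>Basis. tangential_deriv b (V b)\<close> is the
  Riemannian divergence of the tangent field with components \<open>V b\<close>, so that the operator
  below is \<open>div grad\<close> on the sphere.
\<close>

definition tangential_deriv ::
    "'a::euclidean_space \<Rightarrow> ('a \<Rightarrow> complex) \<Rightarrow> 'a \<Rightarrow> complex" where
  "tangential_deriv b f x = frechet_derivative (\<lambda>y. f (y /\<^sub>R norm y)) (at x) b"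

definition laplace_beltrami :: "('a::euclidean_space \<Rightarrow> complex) \<Rightarrow> 'a \<Rightarrow> complex" where
  "laplace_beltrami f x = (\<Sum>b\<in>Basis. tangential_deriv b (tangential_deriv b f) x)"

subsection \<open>Functional calculus of the Laplacian\<close>

text \<open>The eigenspace of \<open>-\<Delta>\<close>; it is trivial unless \<open>\<mu>\<close> is an eigenvalue.\<close>

definition eigenspace :: "real \<Rightarrow> ('a::euclidean_space \<Rightarrow> complex) set" where
  "eigenspace \<mu> = {\<phi>. sphere_smooth \<phi> \<and>
                      (\<forall>x\<in>sphere 0 1. - laplace_beltrami \<phi> x = of_real \<mu> * \<phi> x)}"

definition is_eigenprojection ::
    "real \<Rightarrow> ('a::euclidean_space \<Rightarrow> complex) \<Rightarrow> ('a \<Rightarrow> complex) \<Rightarrow> bool" where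
  "is_eigenprojection \<mu> f w \<longleftrightarrow>
     w \<in> eigenspace \<mu> \<and>
     (\<forall>\<phi>\<in>eigenspace \<mu>. (LINT x|sphere_measure. (f x - w x) * cnj (\<phi> x)) = 0)"

text \<open>
  \<open>spectral_multiplier g f h\<close> states that \<open>f\<close> is in the domain of \<open>g(-\<Delta>)\<close> and
  \<open>g(-\<Delta>) f = h\<close> in \<open>L\<^sup>2\<close>, that is, \<open>h = \<Sum>\<^sub>\<mu> g(\<mu>) w\<^sub>\<mu>\<close> with convergence in \<open>L\<^sup>2\<close>, where \<open>w\<^sub>\<mu>\<close>
  is the orthogonal projection of \<open>f\<close> onto the eigenspace of \<open>\<mu>\<close>.  It is a relation because
  \<open>f\<close> and \<open>h\<close> are representatives of classes modulo null sets.  Summing over all real \<open>\<mu>\<close>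
  is harmless, since \<open>w\<^sub>\<mu>\<close> vanishes on the sphere unless \<open>\<mu>\<close> is an eigenvalue.
\<close>

definition spectral_multiplier ::
    "(real \<Rightarrow> complex) \<Rightarrow> ('a::euclidean_space \<Rightarrow> complex) \<Rightarrow> ('a \<Rightarrow> complex) \<Rightarrow> bool" where
  "spectral_multiplier g f h \<longleftrightarrow>
     f \<in> sphere_L2 \<and> h \<in> sphere_L2 \<and>
     (\<exists>w. (\<forall>\<mu>. is_eigenprojection \<mu> f (w \<mu>)) \<and>
          ((\<lambda>\<Lambda>. L2norm (\<lambda>x. h x - (\<Sum>\<mu>\<in>\<Lambda>. g \<mu> * w \<mu> x))) \<longlongrightarrow> 0)
            (finite_subsets_at_top UNIV))"

text \<open>\<open>\<one>\<^bsub>\<surd>(1-\<Delta>) \<in> I\<^esub> f = h\<close>\<close>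

definition spectral_projector ::
    "real set \<Rightarrow> ('a::euclidean_space \<Rightarrow> complex) \<Rightarrow> ('a \<Rightarrow> complex) \<Rightarrow> bool" where
  "spectral_projector I = spectral_multiplier (\<lambda>\<mu>. if sqrt (1 + \<mu>) \<in> I then 1 else 0)"

text \<open>\<open>e\<^sup>i\<^sup>t\<^sup>\<Delta> f = h\<close>\<close>

definition schroedinger_flow ::
    "real \<Rightarrow> ('a::euclidean_space \<Rightarrow> complex) \<Rightarrow> ('a \<Rightarrow> complex) \<Rightarrow> bool" where
  "schroedinger_flow t = spectral_multiplier (\<lambda>\<mu>. exp (- \<i> * of_real (t * \<mu>)))"

subsection \<open>Zonal functions\<close>

definition geodesic_dist :: "'a::euclidean_space \<Rightarrow> 'a \<Rightarrow> real" where
  "geodesic_dist x y = arccos (x \<bullet> y)"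

definition zonal :: "'a::euclidean_space \<Rightarrow> ('a \<Rightarrow> complex) \<Rightarrow> bool" where
  "zonal p f \<longleftrightarrow> (\<exists>F. AE x in sphere_measure. f x = F (geodesic_dist x p))"

definition dyadic :: "nat \<Rightarrow> bool" where
  "dyadic N \<longleftrightarrow> (\<exists>k. N = 2 ^ k)"

end

theory Submission
  imports Defs "HOL-Computational_Algebra.Primes"
begin

text \<open>
  A zonal eigenfunction with eigenvalue \<open>n (n + 3)\<close> is a multiple of the Gegenbauer polynomial
  \<open>Z\<^sub>n\<close> of degree \<open>n\<close> in \<open>x \<bullet> p\<close>.  Expanding \<open>u\<^sub>1\<close>, \<open>u\<^sub>2\<close>, \<open>u\<^sub>3\<close> accordingly, the space-time integral
  becomes a sum over triples of frequencies of \<open>c\<^sub>1 c\<^sub>2 cnj c\<^sub>3\<close> times \<open>\<integral> Z\<^sub>a Z\<^sub>b Z\<^sub>c\<close> times the Fourier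
  transform of the cutoff at \<open>\<tau> - a (a + 3) - b (b + 3) + c (c + 3)\<close>.

  An energy argument for the Gegenbauer equation gives the concentration bound
  \<open>Z\<^sub>n \<lesssim> min (n\<^bsup>3/2\<^esup>, \<theta>\<^bsup>-3/2\<^esup>)\<close>, whence \<open>\<integral> Z\<^sub>a Z\<^sub>b Z\<^sub>c = O(N\<^bsup>1/2\<^esup>)\<close> for the smallest dyadic scale \<open>N\<close>, and
  the integral vanishes unless \<open>|a - b| \<le> c\<close>.  As the Fourier transform decays, only a fixed value
  of \<open>a (a + 3) + b (b + 3) - c (c + 3)\<close> matters; by Cauchy-Schwarz it then suffices to count, for
  each \<open>c\<close>, the lattice points \<open>(a, b)\<close> on an arc of length \<open>O(N)\<close> of a circle.  There are at most two
  if the radius exceeds a constant times \<open>N\<^sup>3\<close>, and otherwise \<open>O(N\<^sup>\<epsilon>)\<close> by the divisor bound.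
\<close>

section \<open>The surface measure of the sphere\<close>

text \<open>The exponent splits as 1/2 + (s_0 - 1/2): the interaction integrals consume the first
  part exactly, and the divisor bound, the only lossy step, consumes the surplus. Only the size of
  the profiles Z_n matters for the former, so monotone energies for their equation can replace
  asymptotic formulas. The levels of a(a+3) + b(b+3) - c(c+3) are integers, hence 1-separated, and a
  quadratically decaying kernel has a sum over them that is bounded uniformly in \<tau>; this is why
  one level suffices. Freezing the conjugated frequency c leaves a definite quadratic form in (a,
  b), so the fibres lie on circles and not on hyperbolas. The threshold N^3 for the radius comes
  from areas: a lattice triangle has area at least 1/2, while three points on an arc of length N of
  a circle of radius r span an area O(N^3 / r). On the sphere no polar coordinates are set up:
  Green's formula comes from the rotation invariance of the cone measure, and the density sin^3 is
  identified by testing it on the Z_n.\<close>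

lemma space_sphere_measure [simp]: "space (sphere_measure :: 'a::euclidean_space measure) = sphere 0 1"
  by (simp add: sphere_measure_def space_scale_measure space_restrict_space)

lemma sets_sphere_measure [simp]:
  "sets (sphere_measure :: 'a::euclidean_space measure) = sets (restrict_space borel (sphere 0 1))"
  by (simp add: sphere_measure_def)

lemma measurable_normalize:
  "(\<lambda>x::'a::euclidean_space. x /\<^sub>R norm x) \<in>
     restrict_space lborel (ball 0 1 - {0}) \<rightarrow>\<^sub>M restrict_space borel (sphere 0 1)"
  by (rule measurable_restrict_space3) (auto simp: measurable_lborel1)

lemma emeasure_sphere_measure:
  fixes A :: "'a::euclidean_space set"
  assumes "A \<in> sets sphere_measure"
  shows "emeasure sphere_measure A =
           of_nat DIM('a) * emeasure lborel {x \<in> ball 0 1 - {0}. x /\<^sub>R norm x \<in> A}"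
proof -
  have "emeasure sphere_measure A = of_nat DIM('a) *
     emeasure (restrict_space lborel (ball 0 1 - {0}))
       ((\<lambda>x. x /\<^sub>R norm x) -` A \<inter> space (restrict_space lborel (ball 0 1 - {0})))"
    unfolding sphere_measure_def
    using assms emeasure_distr[OF measurable_normalize, of A] by simp
  also have "((\<lambda>x. x /\<^sub>R norm x) -` A \<inter> space (restrict_space lborel (ball 0 1 - {0})))
      = {x \<in> ball 0 1 - {0}. x /\<^sub>R norm x \<in> A}"
    by (auto simp: space_restrict_space)
  also have "emeasure (restrict_space lborel (ball 0 1 - {0})) \<dots> = emeasure lborel \<dots>"
    by (rule emeasure_restrict_space) auto
  finally show ?thesis .
qed

lemma sets_cone:
  fixes A :: "'a::euclidean_space set"
  assumes "A \<in> sets sphere_measure"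
  shows "{x \<in> ball 0 1 - {0}. x /\<^sub>R norm x \<in> A} \<in> sets borel"
proof -
  have "(\<lambda>x. x /\<^sub>R norm x) -` A \<inter> space (restrict_space lborel (ball 0 1 - {0}))
      \<in> sets (restrict_space lborel (ball 0 1 - {0}))"
    using measurable_sets[OF measurable_normalize] assms by simp
  also have "(\<lambda>x. x /\<^sub>R norm x) -` A \<inter> space (restrict_space lborel (ball 0 1 - {0}))
      = {x \<in> ball 0 1 - {0}. x /\<^sub>R norm x \<in> A}"
    by (auto simp: space_restrict_space)
  finally show ?thesis
    by (subst (asm) sets_restrict_space_iff) auto
qed

lemma finite_sphere_measure: "finite_measure (sphere_measure :: 'a::euclidean_space measure)"
proof
  have "emeasure lborel {x \<in> ball 0 1 - {0}. x /\<^sub>R norm x \<in> sphere (0::'a) 1}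
     \<le> emeasure lborel (ball (0::'a) 1)"
    by (rule emeasure_mono) auto
  also have "\<dots> < \<infinity>" by (rule emeasure_bounded_finite) simp
  finally have "emeasure lborel {x \<in> ball (0::'a) 1 - {0}. x /\<^sub>R norm x \<in> sphere 0 1} < top"
    by simp
  moreover have "sphere 0 1 \<in> sets (sphere_measure :: 'a measure)"
    using sets.top[of "sphere_measure :: 'a measure"] by simp
  ultimately have "emeasure (sphere_measure :: 'a measure) (sphere 0 1) < top"
    by (simp only: emeasure_sphere_measure) (simp add: ennreal_mult_less_top of_nat_less_top)
  then show "emeasure (sphere_measure :: 'a measure) (space sphere_measure) \<noteq> \<infinity>" by simp
qed

lemma borel_measurable_sphere:
  fixes f :: "'a::euclidean_space \<Rightarrow> 'b::topological_space"
  assumes "continuous_on (sphere 0 1) f"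
  shows "f \<in> borel_measurable sphere_measure"
  using borel_measurable_continuous_on_restrict[OF assms]
  by (simp cong: measurable_cong_sets)

lemma bounded_sphere:
  fixes f :: "'a::euclidean_space \<Rightarrow> 'b::real_normed_vector"
  assumes "continuous_on (sphere 0 1) f"
  obtains B where "\<And>x. x \<in> sphere 0 1 \<Longrightarrow> norm (f x) \<le> B"
proof -
  have "bounded (f ` sphere 0 1)"
    using assms by (intro compact_imp_bounded compact_continuous_image) auto
  then show thesis using that unfolding bounded_iff by fast
qed

lemma integrable_sphere:
  fixes f :: "'a::euclidean_space \<Rightarrow> 'b::{banach,second_countable_topology}"
  assumes "continuous_on (sphere 0 1) f"
  shows "integrable sphere_measure f"
proof -
  obtain B where "\<And>x. x \<in> sphere 0 1 \<Longrightarrow> norm (f x) \<le> B"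
    using bounded_sphere[OF assms] by blast
  then show ?thesis
    using assms finite_sphere_measure
    by (intro finite_measure.integrable_const_bound[where B=B] borel_measurable_sphere)
       (auto simp: AE_I2)
qed

text \<open>Orthogonal maps commute with \<open>x /\<^sub>R norm x\<close> and preserve Lebesgue
  measure, so they carry a cone to a cone of the same volume. All integration by parts on the sphere
  rests on this invariance.\<close>

lemma distr_sphere_measure:
  fixes T :: "real ^ 'n::{finite,wellorder} \<Rightarrow> real ^ 'n::_"
  assumes T: "orthogonal_transformation T"
  shows "distr sphere_measure sphere_measure T = sphere_measure"
    and "T \<in> sphere_measure \<rightarrow>\<^sub>M sphere_measure"
proof -
  have nT: "norm (T x) = norm x" for x
    using orthogonal_transformation_norm[OF T] .
  have lT: "linear T" using T orthogonal_transformation_linear by blast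
  have cT: "continuous_on UNIV T" using lT linear_continuous_on linear_conv_bounded_linear by blast
  show meas: "T \<in> sphere_measure \<rightarrow>\<^sub>M sphere_measure"
  proof -
    have "T \<in> restrict_space borel (sphere 0 1) \<rightarrow>\<^sub>M restrict_space borel (sphere 0 1)"
      by (rule measurable_restrict_space3)
         (use cT nT in \<open>auto intro: borel_measurable_continuous_onI\<close>)
    then show ?thesis by (simp cong: measurable_cong_sets)
  qed
  show "distr sphere_measure sphere_measure T = sphere_measure"
  proof (rule measure_eqI)
    fix A assume "A \<in> sets (distr sphere_measure sphere_measure T)"
    then have A: "A \<in> sets sphere_measure" by simp
    define B where "B = T -` A \<inter> sphere 0 1"
    have B: "B \<in> sets sphere_measure"
      using measurable_sets[OF meas A] by (simp add: B_def)
    have As: "A \<subseteq> sphere 0 1" using A sets.sets_into_space by fastforce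
    let ?c = "\<lambda>A. {x \<in> ball 0 1 - {0}. x /\<^sub>R norm x \<in> A}"
    have im: "?c A = T ` ?c B"
    proof -
      have "T ` ?c B = {y \<in> ball 0 1 - {0}. y /\<^sub>R norm y \<in> A}"
      proof (intro subset_antisym subsetI)
        fix y assume "y \<in> T ` ?c B"
        then obtain x where x: "y = T x" "x \<in> ball 0 1" "x /\<^sub>R norm x \<in> B" "x \<noteq> 0" by auto
        have "T x \<noteq> 0" using x(4) nT[of x] by auto
        then show "y \<in> ?c A"
          using x by (simp add: B_def nT linear_cmul[OF lT])
      next
        fix y assume "y \<in> ?c A"
        then have y: "y \<in> ball 0 1" "y /\<^sub>R norm y \<in> A" "y \<noteq> 0" by auto
        obtain x where x: "y = T x"
          using orthogonal_transformation_surj[OF T] by (metis surjD)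
        have "x \<noteq> 0" using x y linear_0[OF lT] by auto
        then have "x \<in> ?c B" using x y by (auto simp: B_def nT linear_cmul[OF lT])
        then show "y \<in> T ` ?c B" using x by blast
      qed
      then show ?thesis by simp
    qed
    have cB: "?c B \<in> sets borel" and cA: "?c A \<in> sets borel" using sets_cone A B by auto
    have lmB: "?c B \<in> lmeasurable"
    proof (rule bounded_set_imp_lmeasurable)
      show "bounded (?c B)" by (rule bounded_subset[OF bounded_ball[of 0 1]]) auto
      show "?c B \<in> sets lebesgue" using cB by simp
    qed
    have lmA: "?c A \<in> lmeasurable"
    proof (rule bounded_set_imp_lmeasurable)
      show "bounded (?c A)" by (rule bounded_subset[OF bounded_ball[of 0 1]]) auto
      show "?c A \<in> sets lebesgue" using cA by simp
    qed
    have "emeasure lborel (?c A) = emeasure lebesgue (?c A)"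
      using cA by simp
    also have "\<dots> = ennreal (measure lebesgue (?c A))"
      using lmA by (simp add: emeasure_eq_measure2)
    also have "\<dots> = ennreal (measure lebesgue (?c B))"
      unfolding im using measure_orthogonal_image[OF T lmB] by simp
    also have "\<dots> = emeasure lebesgue (?c B)"
      using lmB by (simp add: emeasure_eq_measure2)
    also have "\<dots> = emeasure lborel (?c B)" using cB by simp
    finally have "emeasure sphere_measure A = emeasure sphere_measure B"
      using A B by (simp only: emeasure_sphere_measure)
    then show "emeasure (distr sphere_measure sphere_measure T) A = emeasure sphere_measure A"
      using meas A by (simp add: emeasure_distr B_def)
  qed simp
qed

lemma integral_sphere_orthogonal:
  fixes T :: "real ^ 'n::{finite,wellorder} \<Rightarrow> real ^ 'n::_" and f :: "real ^ 'n::_ \<Rightarrow> 'b::{banach,second_countable_topology}"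
  assumes T: "orthogonal_transformation T" and f: "f \<in> borel_measurable sphere_measure"
  shows "(LINT x|sphere_measure. f (T x)) = (LINT x|sphere_measure. f x)"
  using integral_distr[OF distr_sphere_measure(2)[OF T] f] distr_sphere_measure(1)[OF T] by simp

lemma AE_sphere_orthogonal:
  fixes T :: "real ^ 'n::{finite,wellorder} \<Rightarrow> real ^ 'n::_"
  assumes T: "orthogonal_transformation T" and P: "AE x in sphere_measure. P x"
  shows "AE x in sphere_measure. P (T x)"
proof -
  obtain N where N: "N \<in> null_sets sphere_measure" "{x \<in> space sphere_measure. \<not> P x} \<subseteq> N"
    using P by (auto simp: eventually_ae_filter)
  have m: "T \<in> sphere_measure \<rightarrow>\<^sub>M sphere_measure" by (rule distr_sphere_measure(2)[OF T])
  have "emeasure sphere_measure (T -` N \<inter> space sphere_measure) = emeasure (distr sphere_measure sphere_measure T) N"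
    using N emeasure_distr[OF m, of N] by (simp add: null_sets_def)
  also have "\<dots> = 0" using N distr_sphere_measure(1)[OF T] by auto
  finally have "T -` N \<inter> space sphere_measure \<in> null_sets sphere_measure"
    using N measurable_sets[OF m, of N] by (auto intro!: null_setsI)
  moreover have "{x \<in> space sphere_measure. \<not> P (T x)} \<subseteq> T -` N \<inter> space sphere_measure"
    using N measurable_space[OF m] by auto
  ultimately show ?thesis unfolding eventually_ae_filter by blast
qed

text \<open>The cone over a nonempty relatively open set is open and nonempty, hence of positive
  volume. This later upgrades almost-everywhere identities between continuous functions to pointwise
  ones.\<close>

lemma sphere_measure_open_pos:
  fixes U :: "'a::euclidean_space set"
  assumes "open U" "U \<inter> sphere 0 1 \<noteq> {}"
  shows "emeasure sphere_measure (U \<inter> sphere 0 1) \<noteq> 0"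
proof -
  have A: "U \<inter> sphere 0 1 \<in> sets (sphere_measure :: 'a measure)"
    using assms by (auto simp: sets_restrict_space)
  let ?V = "{x \<in> ball 0 1 - {0}. x /\<^sub>R norm x \<in> U \<inter> sphere 0 1}"
  have eq: "?V = (ball 0 1 - {0}) \<inter> (\<lambda>x. x /\<^sub>R norm x) -` U" by auto
  have "open ?V" unfolding eq
    by (rule continuous_open_preimage) (use assms in \<open>auto intro!: continuous_intros\<close>)
  \<comment> \<open>A unit vector is not in the open unit ball, but half of it is, and it projects
    to the same direction.\<close>
  moreover obtain x where "x \<in> U" "norm x = 1" using assms by auto
  then have "(1/2) *\<^sub>R x \<in> ?V" by auto
  ultimately have "\<not> negligible ?V" using open_not_negligible by blast
  then have "emeasure lborel ?V \<noteq> 0"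
    using sets_cone[OF A] by (auto simp: negligible_iff_null_sets null_sets_def)
  then show ?thesis unfolding emeasure_sphere_measure[OF A] by simp
qed

section \<open>Tangential calculus\<close>

definition radial_ext :: "('a::real_normed_vector \<Rightarrow> 'b) \<Rightarrow> 'a \<Rightarrow> 'b" where
  "radial_ext f = (\<lambda>y. f (y /\<^sub>R norm y))"

text \<open>Only values on the sphere enter, through the radial extension and its derivatives at
  unit vectors. Second derivatives need this: \<open>tangential_deriv b f\<close> is not constant
  along rays, and only its restriction to the sphere is differentiated again.\<close>

definition sphere_C1 :: "('a::euclidean_space \<Rightarrow> complex) \<Rightarrow> bool" where
  "sphere_C1 f \<longleftrightarrow> (\<forall>x\<in>sphere 0 1. radial_ext f differentiable at x) \<and>
     (\<forall>b\<in>Basis. continuous_on (sphere 0 1) (tangential_deriv b f))"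

lemma radial_ext_on_sphere [simp]: "norm x = 1 \<Longrightarrow> radial_ext f x = f x"
  by (simp add: radial_ext_def)

lemma tangential_deriv_eq: "tangential_deriv b f x = frechet_derivative (radial_ext f) (at x) b"
  by (simp add: tangential_deriv_def radial_ext_def)

lemma has_derivative_normalize:
  fixes x :: "'a::euclidean_space"
  assumes "norm x = 1"
  shows "((\<lambda>y. y /\<^sub>R norm y) has_derivative (\<lambda>h. h - (x \<bullet> h) *\<^sub>R x)) (at x)"
proof -
  have "x \<noteq> 0" using assms by auto
  then show ?thesis
    using assms
    by (auto intro!: derivative_eq_intros has_derivative_norm[THEN has_derivative_eq_rhs]
        simp: sgn_div_norm inner_commute)
qed

lemma has_derivative_radial_ext:
  fixes f :: "'a::euclidean_space \<Rightarrow> 'b::real_normed_vector"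
  assumes "norm x = 1" "(f has_derivative f') (at x)"
  shows "(radial_ext f has_derivative (\<lambda>h. f' (h - (x \<bullet> h) *\<^sub>R x))) (at x)"
proof -
  have "(f has_derivative f') (at (x /\<^sub>R norm x))" using assms by simp
  then show ?thesis
    using has_derivative_compose[OF has_derivative_normalize[OF assms(1)], of f f']
    by (simp add: radial_ext_def)
qed

lemma tangential_deriv_has_derivative:
  assumes "norm x = 1" "(f has_derivative f') (at x)"
  shows "tangential_deriv b f x = f' (b - (x \<bullet> b) *\<^sub>R x)"
  unfolding tangential_deriv_eq
  by (rule fun_cong[OF frechet_derivative_at[OF has_derivative_radial_ext[OF assms]], symmetric])

lemma radial_ext_cong_near:
  fixes f :: "'a::euclidean_space \<Rightarrow> 'b"
  assumes "\<And>y. norm y = 1 \<Longrightarrow> f y = g y" "y \<noteq> 0"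
  shows "radial_ext f y = radial_ext g y"
  using assms by (simp add: radial_ext_def)

lemma has_derivative_radial_ext_cong:
  fixes f :: "'a::euclidean_space \<Rightarrow> 'b::real_normed_vector"
  assumes "\<And>y. norm y = 1 \<Longrightarrow> f y = g y" "norm x = 1"
  shows "(radial_ext f has_derivative f') (at x) \<longleftrightarrow> (radial_ext g has_derivative f') (at x)"
proof
  have x: "x \<in> - {0}" "open (- {0::'a})" using assms(2) by auto
  show "(radial_ext g has_derivative f') (at x)" if "(radial_ext f has_derivative f') (at x)"
    by (rule has_derivative_transform_within_open[OF that x(2) x(1)])
       (rule radial_ext_cong_near[OF assms(1)], auto)
  show "(radial_ext f has_derivative f') (at x)" if "(radial_ext g has_derivative f') (at x)"
    by (rule has_derivative_transform_within_open[OF that x(2) x(1)])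
       (rule radial_ext_cong_near[OF assms(1)[symmetric]], auto)
qed

lemma tangential_deriv_cong:
  fixes f :: "'a::euclidean_space \<Rightarrow> complex"
  assumes "\<And>y. norm y = 1 \<Longrightarrow> f y = g y" "norm x = 1"
  shows "tangential_deriv b f x = tangential_deriv b g x"
  \<comment> \<open>\<open>frechet_derivative\<close> is a choice among all derivatives at the
    point, so two functions with the same derivatives get the same value, also where there is
    none.\<close>
  unfolding tangential_deriv_eq frechet_derivative_def
  using has_derivative_radial_ext_cong[of f g x, OF assms(1) assms(2)] by simp

lemma radial_ext_has_derivative_works:
  fixes f :: "'a::euclidean_space \<Rightarrow> complex"
  assumes "radial_ext f differentiable at x"
  shows "(radial_ext f has_derivative (\<lambda>h. \<Sum>b\<in>Basis. (h \<bullet> b) *\<^sub>R tangential_deriv b f x)) (at x)"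
proof -
  let ?D = "frechet_derivative (radial_ext f) (at x)"
  have D: "(radial_ext f has_derivative ?D) (at x)" using assms frechet_derivative_works by blast
  have "linear ?D" using assms linear_frechet_derivative by blast
  then have "?D (\<Sum>b\<in>Basis. (h \<bullet> b) *\<^sub>R b) = (\<Sum>b\<in>Basis. (h \<bullet> b) *\<^sub>R ?D b)" for h
    by (simp add: linear_sum linear_scale)
  then have eq: "?D = (\<lambda>h. \<Sum>b\<in>Basis. (h \<bullet> b) *\<^sub>R ?D b)"
    unfolding euclidean_representation by (rule ext)
  show ?thesis unfolding tangential_deriv_eq
    by (rule back_subst[of "\<lambda>F. (radial_ext f has_derivative F) (at x)", OF D eq])
qed

text \<open>Extending twice is the same as extending once near the sphere, so the chain rule gives D
  h = D (h - (x . h) x) for the derivative D; at h = x the right side is D 0. This is Euler's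
  relation for degree 0.\<close>

lemma tangential_deriv_euler:
  fixes f :: "'a::euclidean_space \<Rightarrow> complex"
  assumes "radial_ext f differentiable at x" "norm x = 1"
  shows "(\<Sum>b\<in>Basis. (x \<bullet> b) *\<^sub>R tangential_deriv b f x) = 0"
proof -
  let ?D = "\<lambda>h. \<Sum>b\<in>Basis. (h \<bullet> b) *\<^sub>R tangential_deriv b f x"
  have D: "(radial_ext f has_derivative ?D) (at x)"
    by (rule radial_ext_has_derivative_works[OF assms(1)])
  have "(radial_ext (radial_ext f) has_derivative (\<lambda>h. ?D (h - (x \<bullet> h) *\<^sub>R x))) (at x)"
    by (rule has_derivative_radial_ext[OF assms(2) D])
  then have "(radial_ext f has_derivative (\<lambda>h. ?D (h - (x \<bullet> h) *\<^sub>R x))) (at x)"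
    using has_derivative_radial_ext_cong[of "radial_ext f" f x, OF _ assms(2)] by simp
  then have "?D = (\<lambda>h. ?D (h - (x \<bullet> h) *\<^sub>R x))" using D has_derivative_unique by blast
  from fun_cong[OF this, of x] show ?thesis
    using assms(2) by (simp add: dot_square_norm)
qed

section \<open>Product, sum and coordinate rules for tangential derivatives\<close>

lemma tangential_deriv_mult:
  fixes f g :: "'a::euclidean_space \<Rightarrow> complex"
  assumes "radial_ext f differentiable at x" "radial_ext g differentiable at x" "norm x = 1"
  shows "tangential_deriv b (\<lambda>y. f y * g y) x = f x * tangential_deriv b g x + tangential_deriv b f x * g x"
    and "radial_ext (\<lambda>y. f y * g y) differentiable at x"
proof -
  have "((\<lambda>y. radial_ext f y * radial_ext g y) has_derivative
      (\<lambda>h. radial_ext f x * frechet_derivative (radial_ext g) (at x) h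
         + frechet_derivative (radial_ext f) (at x) h * radial_ext g x)) (at x)"
    by (rule has_derivative_mult) (rule iffD1[OF frechet_derivative_works], rule assms)+
  then have D: "(radial_ext (\<lambda>y. f y * g y) has_derivative
      (\<lambda>h. f x * frechet_derivative (radial_ext g) (at x) h
         + frechet_derivative (radial_ext f) (at x) h * g x)) (at x)"
    using assms(3) by (simp add: radial_ext_def)
  show "radial_ext (\<lambda>y. f y * g y) differentiable at x" using D by (auto simp: differentiable_def)
  show "tangential_deriv b (\<lambda>y. f y * g y) x = f x * tangential_deriv b g x + tangential_deriv b f x * g x"
    unfolding tangential_deriv_eq by (rule fun_cong[OF frechet_derivative_at[OF D], symmetric])
qed

lemma tangential_deriv_add:
  fixes f g :: "'a::euclidean_space \<Rightarrow> complex"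
  assumes "radial_ext f differentiable at x" "radial_ext g differentiable at x"
  shows "tangential_deriv b (\<lambda>y. f y + g y) x = tangential_deriv b f x + tangential_deriv b g x"
    and "radial_ext (\<lambda>y. f y + g y) differentiable at x"
proof -
  have "((\<lambda>y. radial_ext f y + radial_ext g y) has_derivative
      (\<lambda>h. frechet_derivative (radial_ext f) (at x) h
         + frechet_derivative (radial_ext g) (at x) h)) (at x)"
    by (rule has_derivative_add) (rule iffD1[OF frechet_derivative_works], rule assms)+
  then have D: "(radial_ext (\<lambda>y. f y + g y) has_derivative
      (\<lambda>h. frechet_derivative (radial_ext f) (at x) h
         + frechet_derivative (radial_ext g) (at x) h)) (at x)"
    by (simp add: radial_ext_def)
  show "radial_ext (\<lambda>y. f y + g y) differentiable at x" using D by (auto simp: differentiable_def)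
  show "tangential_deriv b (\<lambda>y. f y + g y) x = tangential_deriv b f x + tangential_deriv b g x"
    unfolding tangential_deriv_eq by (rule fun_cong[OF frechet_derivative_at[OF D], symmetric])
qed

lemma tangential_deriv_const [simp]: "tangential_deriv b (\<lambda>y. c) x = 0"
  by (simp add: tangential_deriv_def frechet_derivative_const)

lemma radial_ext_const_differentiable [simp]: "radial_ext (\<lambda>y. c::complex) differentiable at x"
  by (simp add: radial_ext_def)

lemma tangential_deriv_cmult:
  fixes f :: "'a::euclidean_space \<Rightarrow> complex"
  assumes "radial_ext f differentiable at x" "norm x = 1"
  shows "tangential_deriv b (\<lambda>y. c * f y) x = c * tangential_deriv b f x"
    and "radial_ext (\<lambda>y. c * f y) differentiable at x"
  using tangential_deriv_mult[OF _ assms, where f = "\<lambda>_. c"] by simp_all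

lemma tangential_deriv_sum:
  fixes f :: "'i \<Rightarrow> 'a::euclidean_space \<Rightarrow> complex"
  assumes "finite I" "\<And>i. i \<in> I \<Longrightarrow> radial_ext (f i) differentiable at x"
  shows "tangential_deriv b (\<lambda>y. \<Sum>i\<in>I. f i y) x = (\<Sum>i\<in>I. tangential_deriv b (f i) x)
     \<and> radial_ext (\<lambda>y. \<Sum>i\<in>I. f i y) differentiable at x"
  using assms
proof (induction I rule: finite_induct)
  case empty then show ?case by simp
next
  case (insert i I)
  then show ?case
    using tangential_deriv_add[of "f i" x "\<lambda>y. \<Sum>i\<in>I. f i y"] by simp
qed

lemma sphere_C1_differentiable: "sphere_C1 f \<Longrightarrow> norm x = 1 \<Longrightarrow> radial_ext f differentiable at x"
  by (simp add: sphere_C1_def)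

lemma sphere_C1_continuous:
  assumes "sphere_C1 f"
  shows "continuous_on (sphere 0 1) f"
proof -
  have "continuous_on (sphere 0 1) (radial_ext f)"
    using assms by (auto simp: sphere_C1_def intro!: continuous_at_imp_continuous_on differentiable_imp_continuous_within)
  then show ?thesis by (rule continuous_on_eq) simp
qed

lemma sphere_C1_deriv_continuous:
  "sphere_C1 f \<Longrightarrow> b \<in> Basis \<Longrightarrow> continuous_on (sphere 0 1) (tangential_deriv b f)"
  by (simp add: sphere_C1_def)

lemma sphere_C1_cong:
  assumes "\<And>y. norm y = 1 \<Longrightarrow> f y = g y" "sphere_C1 f"
  shows "sphere_C1 g"
proof -
  have "radial_ext g differentiable at x" if x: "norm x = 1" for x
  proof -
    obtain D where "(radial_ext f has_derivative D) (at x)"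
      using sphere_C1_differentiable[OF assms(2) x] by (auto simp: differentiable_def)
    then have "(radial_ext g has_derivative D) (at x)"
      using has_derivative_radial_ext_cong[of f g x, OF assms(1) x] by blast
    then show ?thesis by (auto simp: differentiable_def)
  qed
  moreover have "continuous_on (sphere 0 1) (tangential_deriv b g)" if "b \<in> Basis" for b
    by (rule continuous_on_eq[OF sphere_C1_deriv_continuous[OF assms(2) that]])
       (use tangential_deriv_cong[of f g, OF assms(1)] in auto)
  ultimately show ?thesis by (simp add: sphere_C1_def)
qed

lemma sphere_C1_mult:
  assumes "sphere_C1 f" "sphere_C1 g"
  shows "sphere_C1 (\<lambda>x. f x * g x)"
proof -
  have "continuous_on (sphere 0 1) (tangential_deriv b (\<lambda>x. f x * g x))" if b: "b \<in> Basis" for b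
  proof (rule continuous_on_eq)
    show "continuous_on (sphere 0 1) (\<lambda>x. f x * tangential_deriv b g x + tangential_deriv b f x * g x)"
      using assms b by (intro continuous_intros sphere_C1_continuous sphere_C1_deriv_continuous)
  qed (use assms in \<open>simp add: tangential_deriv_mult sphere_C1_def\<close>)
  moreover have "radial_ext (\<lambda>x. f x * g x) differentiable at x" if "norm x = 1" for x
    by (rule tangential_deriv_mult(2)) (use assms that in \<open>simp_all add: sphere_C1_differentiable\<close>)
  ultimately show ?thesis by (simp add: sphere_C1_def)
qed

lemma sphere_C1_add:
  assumes "sphere_C1 f" "sphere_C1 g"
  shows "sphere_C1 (\<lambda>x. f x + g x)"
proof -
  have "continuous_on (sphere 0 1) (tangential_deriv b (\<lambda>x. f x + g x))" if b: "b \<in> Basis" for b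
  proof (rule continuous_on_eq)
    show "continuous_on (sphere 0 1) (\<lambda>x. tangential_deriv b f x + tangential_deriv b g x)"
      using assms b by (intro continuous_intros sphere_C1_continuous sphere_C1_deriv_continuous)
  qed (use assms in \<open>simp add: tangential_deriv_add sphere_C1_def\<close>)
  moreover have "radial_ext (\<lambda>x. f x + g x) differentiable at x" if "norm x = 1" for x
    by (rule tangential_deriv_add(2)) (use assms that in \<open>simp_all add: sphere_C1_differentiable\<close>)
  ultimately show ?thesis by (simp add: sphere_C1_def)
qed

lemma sphere_C1_const: "sphere_C1 (\<lambda>x. c)"
  unfolding sphere_C1_def by (auto intro: continuous_on_eq[of _ "\<lambda>_. 0"])

lemma tangential_deriv_inner:
  fixes v :: "'a::euclidean_space"
  assumes "norm x = 1"
  shows "tangential_deriv b (\<lambda>y. complex_of_real (y \<bullet> v)) x = of_real (b \<bullet> v - (x \<bullet> b) * (x \<bullet> v))"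
    and "radial_ext (\<lambda>y. complex_of_real (y \<bullet> v)) differentiable at x"
proof -
  have D: "((\<lambda>y. complex_of_real (y \<bullet> v)) has_derivative (\<lambda>h. of_real (h \<bullet> v))) (at x)"
    by (auto intro!: derivative_eq_intros)
  show "tangential_deriv b (\<lambda>y. complex_of_real (y \<bullet> v)) x = of_real (b \<bullet> v - (x \<bullet> b) * (x \<bullet> v))"
    using tangential_deriv_has_derivative[OF assms D] by (simp add: inner_diff_left)
  show "radial_ext (\<lambda>y. complex_of_real (y \<bullet> v)) differentiable at x"
    using has_derivative_radial_ext[OF assms D] by (auto simp: differentiable_def)
qed

lemma sphere_C1_inner: "sphere_C1 (\<lambda>y. complex_of_real (y \<bullet> v))"
proof -
  have "continuous_on (sphere 0 1) (tangential_deriv b (\<lambda>y. complex_of_real (y \<bullet> v)))" for b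
  proof (rule continuous_on_eq)
    show "continuous_on (sphere 0 1) (\<lambda>x. complex_of_real (b \<bullet> v - (x \<bullet> b) * (x \<bullet> v)))"
      by (intro continuous_intros)
  qed (simp add: tangential_deriv_inner)
  then show ?thesis by (simp add: sphere_C1_def tangential_deriv_inner)
qed

section \<open>Rotation fields\<close>

definition plane_rotation :: "'a::euclidean_space \<Rightarrow> 'a \<Rightarrow> real \<Rightarrow> 'a \<Rightarrow> 'a" where
  "plane_rotation b c t x = x + ((cos t - 1) * (x \<bullet> b) + sin t * (x \<bullet> c)) *\<^sub>R b
                              + ((cos t - 1) * (x \<bullet> c) - sin t * (x \<bullet> b)) *\<^sub>R c"

lemma plane_rotation_0 [simp]: "plane_rotation b c 0 x = x"
  by (simp add: plane_rotation_def)

lemma plane_rotation_inner: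
  assumes "b \<in> Basis" "c \<in> Basis" "b \<noteq> c"
  shows "plane_rotation b c t x \<bullet> b = cos t * (x \<bullet> b) + sin t * (x \<bullet> c)"
    and "plane_rotation b c t x \<bullet> c = cos t * (x \<bullet> c) - sin t * (x \<bullet> b)"
  using assms by (simp_all add: plane_rotation_def inner_simps inner_Basis algebra_simps)

lemma orthogonal_plane_rotation:
  assumes "b \<in> Basis" "c \<in> Basis" "b \<noteq> c"
  shows "orthogonal_transformation (plane_rotation b c t)"
  unfolding orthogonal_transformation_def
proof (intro conjI allI)
  show "linear (plane_rotation b c t)"
    by (rule linearI) (simp_all add: plane_rotation_def inner_simps algebra_simps)
  fix v w
  have sc: "sin t * sin t = 1 - cos t * cos t"
    using sin_cos_squared_add[of t] by (simp add: power2_eq_square)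
  have 1: "b \<bullet> b = 1" "c \<bullet> c = 1" "b \<bullet> c = 0" "c \<bullet> b = 0"
    using assms by (simp_all add: inner_Basis)
  have gen: "(v + \<alpha> *\<^sub>R b + \<beta> *\<^sub>R c) \<bullet> (w + \<alpha>' *\<^sub>R b + \<beta>' *\<^sub>R c) =
     v \<bullet> w + \<alpha>' * (v \<bullet> b) + \<beta>' * (v \<bullet> c) + \<alpha> * (w \<bullet> b) + \<beta> * (w \<bullet> c) + \<alpha> * \<alpha>' + \<beta> * \<beta>'"
    for \<alpha> \<beta> \<alpha>' \<beta>'
    by (simp add: inner_simps 1 inner_commute algebra_simps)
  show "plane_rotation b c t v \<bullet> plane_rotation b c t w = v \<bullet> w"
    unfolding plane_rotation_def gen using sc by algebra
qed

lemma plane_rotation_has_vector_derivative: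
  assumes "b \<in> Basis" "c \<in> Basis" "b \<noteq> c"
  shows "((\<lambda>t. plane_rotation b c t x) has_vector_derivative
     (plane_rotation b c t x \<bullet> c) *\<^sub>R b - (plane_rotation b c t x \<bullet> b) *\<^sub>R c) (at t within S)"
  unfolding plane_rotation_inner[OF assms]
  unfolding plane_rotation_def
  by (rule has_vector_derivative_eq_rhs, (rule derivative_intros | simp)+) (simp add: algebra_simps)

text \<open>The derivative of f along the vector field x_c b - x_b c, which generates
  \<open>plane_rotation b c\<close> and is tangent to the sphere.\<close>

definition sphere_field :: "'a::euclidean_space \<Rightarrow> 'a \<Rightarrow> ('a \<Rightarrow> complex) \<Rightarrow> 'a \<Rightarrow> complex" where
  "sphere_field b c f x = of_real (x \<bullet> c) * tangential_deriv b f x - of_real (x \<bullet> b) * tangential_deriv c f x"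

lemma continuous_sphere_field:
  assumes "sphere_C1 f" "b \<in> Basis" "c \<in> Basis"
  shows "continuous_on (sphere 0 1) (sphere_field b c f)"
  unfolding sphere_field_def using assms
  by (intro continuous_intros sphere_C1_deriv_continuous)

lemma plane_rotation_compose_derivative:
  fixes f :: "'a::euclidean_space \<Rightarrow> complex"
  assumes "sphere_C1 f" "b \<in> Basis" "c \<in> Basis" "b \<noteq> c" "norm x = 1"
  shows "((\<lambda>t. f (plane_rotation b c t x)) has_vector_derivative
           sphere_field b c f (plane_rotation b c t x)) (at t within S)"
proof -
  let ?R = "\<lambda>t. plane_rotation b c t x"
  have n: "norm (?R t) = 1" for t
    using orthogonal_transformation_norm[OF orthogonal_plane_rotation[OF assms(2-4)]] assms(5) by simp
  let ?D = "frechet_derivative (radial_ext f) (at (?R t))"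
  have diff: "radial_ext f differentiable at (?R t)" by (rule sphere_C1_differentiable[OF assms(1) n])
  then have D: "(radial_ext f has_derivative ?D) (at (?R t))" using frechet_derivative_works by blast
  have lin: "linear ?D" using diff linear_frechet_derivative by blast
  have "((\<lambda>t. radial_ext f (?R t)) has_vector_derivative ?D ((?R t \<bullet> c) *\<^sub>R b - (?R t \<bullet> b) *\<^sub>R c)) (at t within S)"
    using vector_derivative_diff_chain_within[OF plane_rotation_has_vector_derivative[OF assms(2-4)]
        has_derivative_at_withinI[OF D]]
    by (simp add: o_def)
  moreover have "?D ((?R t \<bullet> c) *\<^sub>R b - (?R t \<bullet> b) *\<^sub>R c) = sphere_field b c f (?R t)"
    by (simp add: linear_diff[OF lin] linear_cmul[OF lin] sphere_field_def tangential_deriv_eq scaleR_conv_of_real)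
  moreover have "radial_ext f (?R t) = f (?R t)" for t using n by simp
  ultimately show ?thesis by simp
qed

text \<open>The integral of f composed with the rotation by t does not depend on t. Difference
  quotients at t = 1/(k+1) therefore have integral 0; they converge pointwise to the field and are
  dominated by its supremum \<open>M\<close> through the mean value inequality.\<close>

lemma integral_sphere_field_eq_0:
  fixes f :: "real ^ 'n::{finite,wellorder} \<Rightarrow> complex"
  assumes f: "sphere_C1 f" and bc: "b \<in> Basis" "c \<in> Basis" "b \<noteq> c"
  shows "(LINT x|sphere_measure. sphere_field b c f x) = 0"
proof -
  let ?R = "plane_rotation b c"
  have n: "norm (?R t x) = norm x" for t x
    using orthogonal_transformation_norm[OF orthogonal_plane_rotation[OF bc]] by simp
  obtain M where M: "\<And>x. x \<in> sphere 0 1 \<Longrightarrow> norm (sphere_field b c f x) \<le> M"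
    using bounded_sphere[OF continuous_sphere_field[OF f bc(1,2)]] by blast
  define h where "h k x = of_real (real (Suc k)) * (f (?R (1 / real (Suc k)) x) - f x)" for k x
  have cR: "continuous_on UNIV (?R t)" for t
    unfolding plane_rotation_def by (intro continuous_intros)
  have cf: "continuous_on (sphere 0 1) f" by (rule sphere_C1_continuous[OF f])
  have cfR: "continuous_on (sphere 0 1) (\<lambda>x. f (?R t x))" for t
    by (rule continuous_on_compose2[OF cf continuous_on_subset[OF cR]]) (auto simp: n)
  have ch: "continuous_on (sphere 0 1) (h k)" for k
    unfolding h_def by (intro continuous_intros cf cfR)
  have "(\<lambda>k. LINT x|sphere_measure. h k x) \<longlonglongrightarrow> (LINT x|sphere_measure. sphere_field b c f x)"
  proof (rule integral_dominated_convergence)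
    show "sphere_field b c f \<in> borel_measurable sphere_measure"
      by (rule borel_measurable_sphere[OF continuous_sphere_field[OF f bc(1,2)]])
    show "h k \<in> borel_measurable sphere_measure" for k by (rule borel_measurable_sphere[OF ch])
    show "integrable (sphere_measure :: (real^'n::_) measure) (\<lambda>_. M)" by (intro integrable_sphere continuous_intros)
    show "AE x in sphere_measure. (\<lambda>k. h k x) \<longlonglongrightarrow> sphere_field b c f x"
    proof (rule AE_I2)
      fix x :: "real^'n::_" assume "x \<in> space sphere_measure"
      then have x: "norm x = 1" by simp
      have "((\<lambda>t. f (?R t x)) has_vector_derivative sphere_field b c f x) (at 0)"
        using plane_rotation_compose_derivative[OF f bc x, of 0 UNIV] by simp
      then have lim: "((\<lambda>t. norm (f (?R t x) - f x - t *\<^sub>R sphere_field b c f x) / \<bar>t\<bar>) \<longlongrightarrow> 0) (at 0)"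
        by (simp add: has_vector_derivative_def has_derivative_iff_norm)
      have ev: "\<forall>\<^sub>F t in at 0. norm (f (?R t x) - f x - t *\<^sub>R sphere_field b c f x) / \<bar>t\<bar>
          = norm ((f (?R t x) - f x) /\<^sub>R t - sphere_field b c f x)"
      proof -
        have "norm (f (?R t x) - f x - t *\<^sub>R sphere_field b c f x) / \<bar>t\<bar>
          = norm ((f (?R t x) - f x) /\<^sub>R t - sphere_field b c f x)" if "t \<noteq> 0" for t
        proof -
          have "(f (?R t x) - f x) /\<^sub>R t - sphere_field b c f x
              = (f (?R t x) - f x - t *\<^sub>R sphere_field b c f x) /\<^sub>R t"
            using that by (simp add: scaleR_diff_right)
          then show ?thesis by (simp add: divide_inverse_commute)
        qed
        then show ?thesis by (auto simp: eventually_at intro!: exI[of _ 1])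
      qed
      have "((\<lambda>t. (f (?R t x) - f x) /\<^sub>R t) \<longlongrightarrow> sphere_field b c f x) (at 0)"
        by (rule LIM_zero_cancel, rule tendsto_norm_zero_cancel, rule Lim_transform_eventually[OF lim ev])
      moreover have "filterlim (\<lambda>k. 1 / real (Suc k)) (at 0) sequentially"
        unfolding filterlim_at using LIMSEQ_inverse_real_of_nat by (auto simp: inverse_eq_divide)
      ultimately have "(\<lambda>k. (f (?R (1 / real (Suc k)) x) - f x) /\<^sub>R (1 / real (Suc k))) \<longlonglongrightarrow> sphere_field b c f x"
        by (rule filterlim_compose)
      then show "(\<lambda>k. h k x) \<longlonglongrightarrow> sphere_field b c f x"
        by (simp add: h_def scaleR_conv_of_real)
    qed
    show "AE x in sphere_measure. norm (h k x) \<le> M" for k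
    proof (rule AE_I2)
      fix x :: "real^'n::_" assume "x \<in> space sphere_measure"
      then have x: "norm x = 1" by simp
      have "norm (f (?R (1 / real (Suc k)) x) - f (?R 0 x)) \<le> M * norm (1 / real (Suc k) - 0)"
      proof (rule differentiable_bound[of "{0..1 / real (Suc k)}"])
        fix t assume "t \<in> {0..1 / real (Suc k)}"
        show "((\<lambda>t. f (?R t x)) has_derivative (\<lambda>h. h *\<^sub>R sphere_field b c f (?R t x))) (at t within {0..1 / real (Suc k)})"
          using plane_rotation_compose_derivative[OF f bc x] by (simp add: has_vector_derivative_def)
        show "onorm (\<lambda>h. h *\<^sub>R sphere_field b c f (?R t x)) \<le> M"
          using onorm_scaleR_left[OF bounded_linear_ident, of "sphere_field b c f (?R t x)"] M[of "?R t x"] n x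
          by (simp add: onorm_id[unfolded id_def])
      qed auto
      then have "norm (f (?R (1 / real (Suc k)) x) - f x) \<le> M / real (Suc k)" by simp
      then show "norm (h k x) \<le> M"
        unfolding h_def norm_mult by (simp add: field_simps del: of_nat_Suc)
    qed
  qed
  moreover have "(LINT x|sphere_measure. h k x) = 0" for k
  proof -
    have "(LINT x|sphere_measure. f (?R t x)) = (LINT x|sphere_measure. f x)" for t
      by (rule integral_sphere_orthogonal[OF orthogonal_plane_rotation[OF bc] borel_measurable_sphere[OF cf]])
    then show ?thesis unfolding h_def
      using integrable_sphere[OF cf] integrable_sphere[OF cfR] by simp
  qed
  ultimately show ?thesis using LIMSEQ_const_iff[of "0::complex"] by (simp add: LIMSEQ_const_iff)
qed

section \<open>Green's formula on the sphere\<close>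

lemma sum_Basis_inner_square:
  fixes x :: "'a::euclidean_space"
  shows "(\<Sum>b\<in>Basis. (x \<bullet> b)\<^sup>2) = (norm x)\<^sup>2"
  unfolding power2_norm_eq_inner by (subst euclidean_inner) (simp add: power2_eq_square)

text \<open>Obtained by integrating the rotation fields of \<open>x\<^sub>c f\<close> in the planes \<open>(b, c)\<close> and summing
  over \<open>c\<close>, using \<open>\<Sum>\<^sub>c x\<^sub>c\<^sup>2 = 1\<close> and \<open>\<Sum>\<^sub>c x\<^sub>c \<partial>\<^sub>c f = 0\<close>.\<close>

lemma integral_tangential_deriv:
  fixes f :: "real ^ 'n::{finite,wellorder} \<Rightarrow> complex"
  assumes f: "sphere_C1 f" and b: "b \<in> Basis"
  shows "(LINT x|sphere_measure. tangential_deriv b f x) =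
           of_real (real CARD('n) - 1) * (LINT x|sphere_measure. of_real (x \<bullet> b) * f x)"
proof -
  let ?g = "\<lambda>c x. of_real (x \<bullet> c) * f x"
  \<comment> \<open>The product rule for \<open>sphere_field b c (?g c)\<close> on the sphere; the
    terms x_b x_c^2 f cancel, which leaves the last coefficient.\<close>
  let ?i = "\<lambda>c x. of_real ((x \<bullet> c)\<^sup>2) * tangential_deriv b f x
       - of_real (x \<bullet> b) * (of_real (x \<bullet> c) * tangential_deriv c f x)
       + of_real ((x \<bullet> c) * (b \<bullet> c) - x \<bullet> b) * f x"
  have C1: "sphere_C1 (?g c)" for c by (rule sphere_C1_mult[OF sphere_C1_inner f])
  have cf: "continuous_on (sphere 0 1) f" by (rule sphere_C1_continuous[OF f])
  have ci: "continuous_on (sphere 0 1) (?i c)" if "c \<in> Basis" for c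
    by (intro continuous_intros cf sphere_C1_deriv_continuous[OF f] b that)
  have "(LINT x|sphere_measure. ?i c x) = 0" if c: "c \<in> Basis" for c
  proof -
    have "(LINT x|sphere_measure. ?i c x) = (LINT x|sphere_measure. sphere_field b c (?g c) x)"
    proof (rule Bochner_Integration.integral_cong[OF refl])
      fix x :: "real^'n::_" assume "x \<in> space sphere_measure"
      then have x: "norm x = 1" by simp
      note d = sphere_C1_differentiable[OF f x]
      have e: "tangential_deriv e (?g c) x = of_real (x \<bullet> c) * tangential_deriv e f x
          + of_real (e \<bullet> c - (x \<bullet> e) * (x \<bullet> c)) * f x" for e
        using tangential_deriv_mult(1)[OF tangential_deriv_inner(2)[OF x] d x]
        by (simp add: tangential_deriv_inner(1)[OF x])
      have "c \<bullet> c = 1" using c by simp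
      then show "?i c x = sphere_field b c (?g c) x"
        unfolding sphere_field_def e by (simp add: algebra_simps power2_eq_square)
    qed
    also have "\<dots> = 0"
    proof (cases "b = c")
      case True then show ?thesis by (simp add: sphere_field_def)
    next
      case False then show ?thesis using integral_sphere_field_eq_0[OF C1 b c] by blast
    qed
    finally show ?thesis .
  qed
  then have "0 = (\<Sum>c\<in>Basis. LINT x|sphere_measure. ?i c x)" by simp
  also have "\<dots> = (LINT x|sphere_measure. (\<Sum>c\<in>Basis. ?i c x))"
    by (rule Bochner_Integration.integral_sum[symmetric]) (use ci in \<open>rule integrable_sphere\<close>)
  also have "\<dots> = (LINT x|sphere_measure. tangential_deriv b f x
        - of_real (real CARD('n) - 1) * (of_real (x \<bullet> b) * f x))"
  proof (rule Bochner_Integration.integral_cong[OF refl])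
    fix x :: "real^'n::_" assume "x \<in> space sphere_measure"
    then have x: "norm x = 1" by simp
    have "(\<Sum>c\<in>Basis. of_real ((x \<bullet> c)\<^sup>2) * tangential_deriv b f x)
        = of_real (\<Sum>c\<in>Basis. (x \<bullet> c)\<^sup>2) * tangential_deriv b f x"
      by (simp only: sum_distrib_right of_real_sum)
    then have 1: "(\<Sum>c\<in>Basis. of_real ((x \<bullet> c)\<^sup>2) * tangential_deriv b f x) = tangential_deriv b f x"
      unfolding sum_Basis_inner_square x by simp
    have 2: "(\<Sum>c\<in>Basis. of_real (x \<bullet> b) * (of_real (x \<bullet> c) * tangential_deriv c f x)) = 0"
      using tangential_deriv_euler[OF sphere_C1_differentiable[OF f x] x]
      by (simp add: scaleR_conv_of_real flip: sum_distrib_left)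
    have 3: "(\<Sum>c\<in>Basis. of_real ((x \<bullet> c) * (b \<bullet> c) - x \<bullet> b) * f x)
        = - (of_real (real CARD('n) - 1) * (of_real (x \<bullet> b) * f x))"
    proof -
      \<comment> \<open>Summed over c, the first part contributes x_b once and the second CARD('n)
        times: this is the curvature factor CARD('n) - 1.\<close>
      have e1: "(\<Sum>c\<in>Basis. (x \<bullet> c) * (b \<bullet> c) - x \<bullet> b) = x \<bullet> b - real CARD('n) * (x \<bullet> b)"
        using euclidean_inner[of x b] by (simp add: sum_subtractf)
      have e2: "(\<Sum>c\<in>Basis. of_real ((x \<bullet> c) * (b \<bullet> c) - x \<bullet> b) * f x)
          = of_real (\<Sum>c\<in>Basis. (x \<bullet> c) * (b \<bullet> c) - x \<bullet> b) * f x"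
        by (simp only: sum_distrib_right of_real_sum)
      show ?thesis unfolding e2 e1 by (simp add: algebra_simps)
    qed
    show "(\<Sum>c\<in>Basis. ?i c x) = tangential_deriv b f x
        - of_real (real CARD('n) - 1) * (of_real (x \<bullet> b) * f x)"
      unfolding sum.distrib sum_subtractf 1 2 3 by simp
  qed
  also have "\<dots> = (LINT x|sphere_measure. tangential_deriv b f x)
       - of_real (real CARD('n) - 1) * (LINT x|sphere_measure. of_real (x \<bullet> b) * f x)"
    using integrable_sphere[OF sphere_C1_deriv_continuous[OF f b]]
      integrable_sphere[OF sphere_C1_continuous[OF C1[of b]]] by simp
  finally show ?thesis by simp
qed

definition sphere_C2 :: "('a::euclidean_space \<Rightarrow> complex) \<Rightarrow> bool" where
  "sphere_C2 f \<longleftrightarrow> sphere_C1 f \<and> (\<forall>b\<in>Basis. sphere_C1 (tangential_deriv b f))"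

text \<open>Integrate the b-derivative of f times \<open>tangential_deriv b g\<close> and sum over
  b. The curvature terms add up to f times the sum of the x_b \<open>tangential_deriv b g\<close>,
  which is 0 by Euler's relation.\<close>

lemma sphere_green_first:
  fixes f g :: "real ^ 'n::{finite,wellorder} \<Rightarrow> complex"
  assumes f: "sphere_C1 f" and g: "sphere_C2 g"
  shows "(LINT x|sphere_measure. f x * laplace_beltrami g x) =
         - (LINT x|sphere_measure. (\<Sum>b\<in>Basis. tangential_deriv b f x * tangential_deriv b g x))"
proof -
  have g1: "sphere_C1 g" and g2: "\<And>b. b \<in> Basis \<Longrightarrow> sphere_C1 (tangential_deriv b g)"
    using g by (auto simp: sphere_C2_def)
  let ?t = tangential_deriv
  have C1: "sphere_C1 (\<lambda>x. f x * ?t b g x)" if "b \<in> Basis" for b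
    using sphere_C1_mult[OF f g2[OF that]] .
  have i1: "integrable sphere_measure (\<lambda>x. ?t b (\<lambda>y. f y * ?t b g y) x)" if "b \<in> Basis" for b
    using sphere_C1_deriv_continuous[OF C1[OF that] that] by (rule integrable_sphere)
  have i2: "integrable sphere_measure (\<lambda>x. ?t b f x * ?t b g x)" if "b \<in> Basis" for b
    by (intro integrable_sphere continuous_intros sphere_C1_deriv_continuous f g1 that)
  have i3: "integrable sphere_measure (\<lambda>x. of_real (x \<bullet> b) * (f x * ?t b g x))" if "b \<in> Basis" for b
    by (intro integrable_sphere continuous_intros sphere_C1_deriv_continuous sphere_C1_continuous f g1 that)
  have "(LINT x|sphere_measure. f x * laplace_beltrami g x)
     = (LINT x|sphere_measure. (\<Sum>b\<in>Basis. ?t b (\<lambda>y. f y * ?t b g y) x - ?t b f x * ?t b g x))"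
  proof (rule Bochner_Integration.integral_cong[OF refl])
    fix x :: "real^'n::_" assume "x \<in> space sphere_measure"
    then have x: "norm x = 1" by simp
    have "f x * laplace_beltrami g x = (\<Sum>b\<in>Basis. f x * ?t b (?t b g) x)"
      by (simp add: laplace_beltrami_def sum_distrib_left)
    also have "\<dots> = (\<Sum>b\<in>Basis. ?t b (\<lambda>y. f y * ?t b g y) x - ?t b f x * ?t b g x)"
    proof (rule sum.cong[OF refl])
      fix b :: "real^'n::_" assume b: "b \<in> Basis"
      show "f x * ?t b (?t b g) x = ?t b (\<lambda>y. f y * ?t b g y) x - ?t b f x * ?t b g x"
        using tangential_deriv_mult(1)[OF sphere_C1_differentiable[OF f x] sphere_C1_differentiable[OF g2[OF b] x] x]
        by simp
    qed
    finally show "f x * laplace_beltrami g x = (\<Sum>b\<in>Basis. ?t b (\<lambda>y. f y * ?t b g y) x - ?t b f x * ?t b g x)" .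
  qed
  also have "\<dots> = (\<Sum>b\<in>Basis. (LINT x|sphere_measure. ?t b (\<lambda>y. f y * ?t b g y) x) - (LINT x|sphere_measure. ?t b f x * ?t b g x))"
    using i1 i2 by (simp add: Bochner_Integration.integral_sum)
  also have "\<dots> = (\<Sum>b\<in>Basis. (LINT x|sphere_measure. ?t b (\<lambda>y. f y * ?t b g y) x))
     - (LINT x|sphere_measure. (\<Sum>b\<in>Basis. ?t b f x * ?t b g x))"
    using i2 by (simp add: Bochner_Integration.integral_sum sum_subtractf)
  also have "(\<Sum>b\<in>Basis. (LINT x|sphere_measure. ?t b (\<lambda>y. f y * ?t b g y) x))
     = of_real (real CARD('n) - 1) * (LINT x|sphere_measure. (\<Sum>b\<in>Basis. of_real (x \<bullet> b) * (f x * ?t b g x)))"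
    using i3 by (simp add: integral_tangential_deriv[OF C1] Bochner_Integration.integral_sum sum_distrib_left)
  also have "(LINT x|sphere_measure. (\<Sum>b\<in>Basis. of_real (x \<bullet> b) * (f x * ?t b g x))) = (LINT x|(sphere_measure :: (real^'n::_) measure). 0)"
  proof (rule Bochner_Integration.integral_cong[OF refl])
    fix x :: "real^'n::_" assume "x \<in> space sphere_measure"
    then have x: "norm x = 1" by simp
    have "(\<Sum>b\<in>Basis. of_real (x \<bullet> b) * (f x * ?t b g x)) = f x * (\<Sum>b\<in>Basis. (x \<bullet> b) *\<^sub>R ?t b g x)"
      by (simp add: sum_distrib_left scaleR_conv_of_real algebra_simps)
    then show "(\<Sum>b\<in>Basis. of_real (x \<bullet> b) * (f x * ?t b g x)) = 0"
      using tangential_deriv_euler[OF sphere_C1_differentiable[OF g1 x] x] by simp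
  qed
  finally show ?thesis by simp
qed

lemma sphere_green:
  fixes f g :: "real ^ 'n::{finite,wellorder} \<Rightarrow> complex"
  assumes "sphere_C2 f" "sphere_C2 g"
  shows "(LINT x|sphere_measure. f x * laplace_beltrami g x) = (LINT x|sphere_measure. g x * laplace_beltrami f x)"
  using sphere_green_first[of f g] sphere_green_first[of g f] assms
  by (simp add: sphere_C2_def mult.commute)

text \<open>Meant for f = \<open>tangential_deriv b g\<close>, which off the sphere scales like
  1/|x| and so differs from its own radial extension. Its tangential derivative is the ambient one
  minus the normal component.\<close>

lemma sphere_C1_from_ambient:
  fixes f :: "'a::euclidean_space \<Rightarrow> complex"
  assumes "f differentiable_on (- {0})"
    and "\<And>b. b \<in> Basis \<Longrightarrow> continuous_on (- {0}) (\<lambda>x. frechet_derivative f (at x) b)"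
  shows "sphere_C1 f"
proof -
  have D: "(f has_derivative frechet_derivative f (at x)) (at x)" if "norm x = 1" for x
  proof -
    have "x \<in> - {0}" using that by auto
    then have "f differentiable at x"
      using assms(1) by (metis differentiable_on_eq_differentiable_at open_Compl closed_singleton)
    then show ?thesis using frechet_derivative_works by blast
  qed
  have "continuous_on (sphere 0 1) (tangential_deriv b f)" if b: "b \<in> Basis" for b
  proof (rule continuous_on_eq)
    show "continuous_on (sphere 0 1) (\<lambda>x. frechet_derivative f (at x) b -
        (x \<bullet> b) *\<^sub>R (\<Sum>e\<in>Basis. (x \<bullet> e) *\<^sub>R frechet_derivative f (at x) e))"
      by (intro continuous_intros continuous_on_subset[OF assms(2)] b) auto
    fix x :: 'a assume "x \<in> sphere 0 1"
    then have x: "norm x = 1" by simp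
    have lin: "linear (frechet_derivative f (at x))"
      using D[OF x] has_derivative_linear by blast
    have "frechet_derivative f (at x) (\<Sum>e\<in>Basis. (x \<bullet> e) *\<^sub>R e)
       = (\<Sum>e\<in>Basis. (x \<bullet> e) *\<^sub>R frechet_derivative f (at x) e)"
      by (simp add: linear_sum[OF lin] linear_cmul[OF lin])
    then have "(\<Sum>e\<in>Basis. (x \<bullet> e) *\<^sub>R frechet_derivative f (at x) e) = frechet_derivative f (at x) x"
      by (simp add: euclidean_representation)
    then show "frechet_derivative f (at x) b -
        (x \<bullet> b) *\<^sub>R (\<Sum>e\<in>Basis. (x \<bullet> e) *\<^sub>R frechet_derivative f (at x) e) = tangential_deriv b f x"
      by (simp add: tangential_deriv_has_derivative[OF x D[OF x]] linear_diff[OF lin] linear_cmul[OF lin])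
  qed
  moreover have "radial_ext f differentiable at x" if "norm x = 1" for x
    using has_derivative_radial_ext[OF that D[OF that]] by (auto simp: differentiable_def)
  ultimately show ?thesis by (simp add: sphere_C1_def)
qed

lemma sphere_smooth_C2:
  assumes "sphere_smooth f"
  shows "sphere_C2 f"
proof -
  have "Ck_on 2 (- {0}) (radial_ext f)"
    using assms by (simp add: sphere_smooth_def smooth_on_def radial_ext_def)
  then have *: "radial_ext f differentiable_on (- {0})"
     "\<And>b. b \<in> Basis \<Longrightarrow> tangential_deriv b f differentiable_on (- {0})"
     "\<And>b c. b \<in> Basis \<Longrightarrow> c \<in> Basis \<Longrightarrow> continuous_on (- {0}) (\<lambda>x. frechet_derivative (tangential_deriv b f) (at x) c)"
    by (simp_all add: numeral_2_eq_2 tangential_deriv_eq[abs_def])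
  have "sphere_C1 (tangential_deriv b f)" if "b \<in> Basis" for b
    by (rule sphere_C1_from_ambient) (use * that in auto)
  moreover have "radial_ext f differentiable at x" if "norm x = 1" for x
  proof -
    have "x \<in> - {0}" using that by auto
    then show ?thesis
      using *(1) by (metis differentiable_on_eq_differentiable_at open_Compl closed_singleton)
  qed
  moreover have "continuous_on (sphere 0 1) (tangential_deriv b f)" if "b \<in> Basis" for b
    by (rule continuous_on_subset[OF differentiable_imp_continuous_on[OF *(2)[OF that]]]) auto
  ultimately show ?thesis by (simp add: sphere_C2_def sphere_C1_def)
qed

section \<open>The Laplacian of zonal polynomials and of rotated functions\<close>

definition zonal_poly :: "'a::euclidean_space \<Rightarrow> real poly \<Rightarrow> 'a \<Rightarrow> complex" where
  "zonal_poly p q x = of_real (poly q (x \<bullet> p))"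

text \<open>The Laplace-Beltrami operator of the d-dimensional sphere in the variable s = x . p, for
  functions of s alone: (1 - s^2) q'' - d s q'.\<close>

definition gegenbauer_op :: "real \<Rightarrow> real poly \<Rightarrow> real poly" where
  "gegenbauer_op d q = [:1, 0, -1:] * pderiv (pderiv q) - smult d ([:0, 1:] * pderiv q)"

lemma tangential_deriv_zonal_poly:
  assumes "norm x = 1"
  shows "tangential_deriv b (zonal_poly p q) x =
           of_real (poly (pderiv q) (x \<bullet> p) * (b \<bullet> p - (x \<bullet> b) * (x \<bullet> p)))"
    and "radial_ext (zonal_poly p q) differentiable at x"
proof -
  have P: "((\<lambda>y. poly q (y \<bullet> p)) has_derivative (\<lambda>h. poly (pderiv q) (x \<bullet> p) * (h \<bullet> p))) (at x)"
    by (rule has_derivative_compose[of "\<lambda>y. y \<bullet> p", OF _ poly_DERIV[unfolded has_field_derivative_def]])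
       (auto intro!: derivative_eq_intros)
  have D: "(zonal_poly p q has_derivative (\<lambda>h. of_real (poly (pderiv q) (x \<bullet> p) * (h \<bullet> p)))) (at x)"
    unfolding zonal_poly_def[abs_def] by (rule has_derivative_of_real[OF P])
  show "tangential_deriv b (zonal_poly p q) x =
           of_real (poly (pderiv q) (x \<bullet> p) * (b \<bullet> p - (x \<bullet> b) * (x \<bullet> p)))"
    using tangential_deriv_has_derivative[OF assms D] by (simp add: inner_diff_left)
  show "radial_ext (zonal_poly p q) differentiable at x"
    using has_derivative_radial_ext[OF assms D] by (auto simp: differentiable_def)
qed

lemma sphere_C1_zonal_poly: "sphere_C1 (zonal_poly p q)"
proof -
  have "continuous_on (sphere 0 1) (tangential_deriv b (zonal_poly p q))" for b
  proof (rule continuous_on_eq)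
    show "continuous_on (sphere 0 1) (\<lambda>x. complex_of_real (poly (pderiv q) (x \<bullet> p) * (b \<bullet> p - (x \<bullet> b) * (x \<bullet> p))))"
      by (intro continuous_intros)
  qed (simp add: tangential_deriv_zonal_poly)
  then show ?thesis by (simp add: sphere_C1_def tangential_deriv_zonal_poly)
qed

lemma sphere_C2_zonal_poly: "sphere_C2 (zonal_poly p q)"
proof -
  have "sphere_C1 (tangential_deriv b (zonal_poly p q))" for b
  proof (rule sphere_C1_cong)
    show "sphere_C1 (\<lambda>x. zonal_poly p (pderiv q) x * (of_real (b \<bullet> p) + (-1) * (of_real (x \<bullet> b) * of_real (x \<bullet> p))))"
      by (intro sphere_C1_mult sphere_C1_add sphere_C1_const sphere_C1_inner sphere_C1_zonal_poly)
  qed (simp add: tangential_deriv_zonal_poly zonal_poly_def)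
  then show ?thesis by (simp add: sphere_C2_def sphere_C1_zonal_poly)
qed

text \<open>The tangential gradient of s = x . p is p - s x, with components \<open>?A b\<close>.
  Its squared length 1 - s^2 multiplies q'', and its divergence -(DIM - 1) s multiplies q'.\<close>

lemma laplace_beltrami_zonal_poly:
  fixes p x :: "'a::euclidean_space"
  assumes x: "norm x = 1" and p: "norm p = 1"
  shows "laplace_beltrami (zonal_poly p q) x = zonal_poly p (gegenbauer_op (real DIM('a) - 1) q) x"
proof -
  let ?\<xi> = "x \<bullet> p" let ?A = "\<lambda>b. b \<bullet> p - (x \<bullet> b) * ?\<xi>"
  have td: "tangential_deriv b (tangential_deriv b (zonal_poly p q)) x
      = of_real (poly (pderiv (pderiv q)) ?\<xi> * (?A b)\<^sup>2
        + poly (pderiv q) ?\<xi> * (- (1 - (x \<bullet> b)\<^sup>2) * ?\<xi> - (x \<bullet> b) * ?A b))" if b: "b \<in> Basis" for b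
  proof -
    have P: "((\<lambda>y. poly (pderiv q) (y \<bullet> p)) has_derivative (\<lambda>h. poly (pderiv (pderiv q)) ?\<xi> * (h \<bullet> p))) (at x)"
      by (rule has_derivative_compose[of "\<lambda>y. y \<bullet> p", OF _ poly_DERIV[unfolded has_field_derivative_def]])
         (auto intro!: derivative_eq_intros)
    have "((\<lambda>y. poly (pderiv q) (y \<bullet> p) * (b \<bullet> p - (y \<bullet> b) * (y \<bullet> p))) has_derivative
        (\<lambda>h. poly (pderiv q) ?\<xi> * (- ((x \<bullet> b) * (h \<bullet> p) + (h \<bullet> b) * ?\<xi>))
           + poly (pderiv (pderiv q)) ?\<xi> * (h \<bullet> p) * ?A b)) (at x)"
      by (rule has_derivative_mult[OF P]) (auto intro!: derivative_eq_intros)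
    from has_derivative_of_real[OF this, where 'a = complex]
    have D: "((\<lambda>y. complex_of_real (poly (pderiv q) (y \<bullet> p) * (b \<bullet> p - (y \<bullet> b) * (y \<bullet> p)))) has_derivative
        (\<lambda>h. of_real (poly (pderiv q) ?\<xi> * (- ((x \<bullet> b) * (h \<bullet> p) + (h \<bullet> b) * ?\<xi>))
           + poly (pderiv (pderiv q)) ?\<xi> * (h \<bullet> p) * ?A b))) (at x)" .
    have "tangential_deriv b (tangential_deriv b (zonal_poly p q)) x =
       tangential_deriv b (\<lambda>y. complex_of_real (poly (pderiv q) (y \<bullet> p) * (b \<bullet> p - (y \<bullet> b) * (y \<bullet> p)))) x"
      by (rule tangential_deriv_cong[OF _ x]) (simp add: tangential_deriv_zonal_poly)
    also have "\<dots> = of_real (poly (pderiv (pderiv q)) ?\<xi> * (?A b)\<^sup>2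
        + poly (pderiv q) ?\<xi> * (- (1 - (x \<bullet> b)\<^sup>2) * ?\<xi> - (x \<bullet> b) * ?A b))"
      unfolding tangential_deriv_has_derivative[OF x D] of_real_eq_iff using b
      by (simp add: inner_diff_left power2_eq_square) (simp add: algebra_simps)
    finally show ?thesis .
  qed
  have gen: "(\<Sum>b\<in>Basis. u * A b + v * (- S b * \<zeta> - R b)) = u * (\<Sum>b\<in>Basis. A b)
      + v * (- (\<Sum>b\<in>Basis. S b) * \<zeta> - (\<Sum>b\<in>Basis. R b))"
    for u v \<zeta> and A S R :: "'a \<Rightarrow> real"
    by (simp add: sum.distrib sum_subtractf sum_negf sum_distrib_left sum_distrib_right algebra_simps)
  from td have "laplace_beltrami (zonal_poly p q) x =
     of_real (\<Sum>b\<in>Basis. poly (pderiv (pderiv q)) ?\<xi> * (?A b)\<^sup>2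
        + poly (pderiv q) ?\<xi> * (- (1 - (x \<bullet> b)\<^sup>2) * ?\<xi> - (x \<bullet> b) * ?A b))"
    by (simp add: laplace_beltrami_def)
  also have "(\<Sum>b\<in>Basis. poly (pderiv (pderiv q)) ?\<xi> * (?A b)\<^sup>2
        + poly (pderiv q) ?\<xi> * (- (1 - (x \<bullet> b)\<^sup>2) * ?\<xi> - (x \<bullet> b) * ?A b))
     = poly (pderiv (pderiv q)) ?\<xi> * (\<Sum>b\<in>Basis. (?A b)\<^sup>2)
        + poly (pderiv q) ?\<xi> * (- (\<Sum>b\<in>Basis. 1 - (x \<bullet> b)\<^sup>2) * ?\<xi> - (\<Sum>b\<in>Basis. (x \<bullet> b) * ?A b))"
    by (rule gen)
  also have "(\<Sum>b\<in>Basis. 1 - (x \<bullet> b)\<^sup>2) = real DIM('a) - 1"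
    by (simp add: sum_subtractf sum_Basis_inner_square x)
  also have xp: "(\<Sum>b\<in>Basis. (x \<bullet> b) * (b \<bullet> p)) = ?\<xi>"
    using euclidean_inner[of x p] by (simp add: inner_commute)
  then have "(\<Sum>b\<in>Basis. (x \<bullet> b) * ?A b) = ?\<xi> - (\<Sum>b\<in>Basis. (x \<bullet> b)\<^sup>2) * ?\<xi>"
    by (simp add: algebra_simps power2_eq_square sum_subtractf sum_distrib_left)
  then have "(\<Sum>b\<in>Basis. (x \<bullet> b) * ?A b) = 0"
    by (simp add: sum_Basis_inner_square x)
  also have "(\<Sum>b\<in>Basis. (?A b)\<^sup>2) = (\<Sum>b\<in>Basis. (p \<bullet> b)\<^sup>2) - 2 * ?\<xi> * (\<Sum>b\<in>Basis. (x \<bullet> b) * (b \<bullet> p))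
      + ?\<xi>\<^sup>2 * (\<Sum>b\<in>Basis. (x \<bullet> b)\<^sup>2)"
    by (simp add: sum_distrib_left sum.distrib sum_subtractf[symmetric] sum.distrib[symmetric]
        power2_eq_square algebra_simps inner_commute)
  also have "\<dots> = 1 - ?\<xi>\<^sup>2"
    unfolding xp sum_Basis_inner_square x p by (simp add: power2_eq_square)
  finally show ?thesis
    unfolding zonal_poly_def[of p "gegenbauer_op _ q"]
    by (simp add: gegenbauer_op_def algebra_simps power2_eq_square)
qed

lemma tangential_deriv_orthogonal:
  fixes T :: "'a::euclidean_space \<Rightarrow> 'a"
  assumes T: "orthogonal_transformation T" and x: "norm x = 1"
    and f: "radial_ext f differentiable at (T x)"
  shows "tangential_deriv b (\<lambda>y. f (T y)) x = (\<Sum>c\<in>Basis. of_real (T b \<bullet> c) * tangential_deriv c f (T x))"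
    and "radial_ext (\<lambda>y. f (T y)) differentiable at x"
proof -
  have lT: "linear T" using T orthogonal_transformation_linear by blast
  have DT: "(T has_derivative T) (at x)"
    using lT by (simp add: linear_imp_has_derivative)
  have eq: "radial_ext (\<lambda>y. f (T y)) = (\<lambda>y. radial_ext f (T y))"
    using orthogonal_transformation_norm[OF T]
    by (simp add: radial_ext_def linear_cmul[OF lT] fun_eq_iff)
  have D: "(radial_ext (\<lambda>y. f (T y)) has_derivative (\<lambda>h. \<Sum>c\<in>Basis. (T h \<bullet> c) *\<^sub>R tangential_deriv c f (T x))) (at x)"
    unfolding eq by (rule has_derivative_compose[OF DT radial_ext_has_derivative_works[OF f]])
  show "tangential_deriv b (\<lambda>y. f (T y)) x = (\<Sum>c\<in>Basis. of_real (T b \<bullet> c) * tangential_deriv c f (T x))"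
    unfolding tangential_deriv_eq fun_cong[OF frechet_derivative_at[OF D], symmetric]
    by (simp add: scaleR_conv_of_real)
  show "radial_ext (\<lambda>y. f (T y)) differentiable at x"
    using D by (auto simp: differentiable_def)
qed

text \<open>The second tangential derivatives \<open>?H\<close> transform with the matrix of T on
  both sides, and the trace survives because the images T b of the basis are again orthonormal.
  Writing c = T c', d = T d' turns this orthonormality into the expansion of c' . d' in the standard
  basis.\<close>

lemma laplace_beltrami_orthogonal:
  fixes T :: "'a::euclidean_space \<Rightarrow> 'a"
  assumes T: "orthogonal_transformation T" and f: "sphere_C2 f" and x: "norm x = 1"
  shows "laplace_beltrami (\<lambda>y. f (T y)) x = laplace_beltrami f (T x)"
proof -
  have n: "norm (T y) = norm y" for y using orthogonal_transformation_norm[OF T] .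
  have f1: "sphere_C1 f" and f2: "c \<in> Basis \<Longrightarrow> sphere_C1 (tangential_deriv c f)" for c
    using f by (auto simp: sphere_C2_def)
  note d1 = sphere_C1_differentiable[OF f1]
  have d2: "radial_ext (tangential_deriv c f) differentiable at (T y)" if "c \<in> Basis" "norm y = 1" for c y
    using sphere_C1_differentiable[OF f2] that n by simp
  let ?H = "\<lambda>c d. tangential_deriv d (tangential_deriv c f) (T x)"
  have "tangential_deriv b (tangential_deriv b (\<lambda>y. f (T y))) x
      = (\<Sum>c\<in>Basis. \<Sum>d\<in>Basis. of_real ((T b \<bullet> c) * (T b \<bullet> d)) * ?H c d)" for b
  proof -
    have "tangential_deriv b (tangential_deriv b (\<lambda>y. f (T y))) x
       = tangential_deriv b (\<lambda>y. \<Sum>c\<in>Basis. of_real (T b \<bullet> c) * tangential_deriv c f (T y)) x"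
      by (rule tangential_deriv_cong[OF _ x], rule tangential_deriv_orthogonal(1)[OF T])
         (auto intro!: d1 simp: n)
    also have "\<dots> = (\<Sum>c\<in>Basis. tangential_deriv b (\<lambda>y. of_real (T b \<bullet> c) * tangential_deriv c f (T y)) x)"
      by (rule tangential_deriv_sum[THEN conjunct1])
         (auto intro!: tangential_deriv_cmult(2) tangential_deriv_orthogonal(2) T d2 x)
    also have "\<dots> = (\<Sum>c\<in>Basis. of_real (T b \<bullet> c) * (\<Sum>d\<in>Basis. of_real (T b \<bullet> d) * ?H c d))"
    proof (rule sum.cong[OF refl])
      fix c :: 'a assume c: "c \<in> Basis"
      show "tangential_deriv b (\<lambda>y. of_real (T b \<bullet> c) * tangential_deriv c f (T y)) x
        = of_real (T b \<bullet> c) * (\<Sum>d\<in>Basis. of_real (T b \<bullet> d) * ?H c d)"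
        using tangential_deriv_cmult(1)[OF tangential_deriv_orthogonal(2)[OF T x d2[OF c x]] x]
          tangential_deriv_orthogonal(1)[OF T x d2[OF c x]] by simp
    qed
    finally show ?thesis by (simp add: sum_distrib_left mult.assoc)
  qed
  then have "laplace_beltrami (\<lambda>y. f (T y)) x
     = (\<Sum>b\<in>Basis. \<Sum>c\<in>Basis. \<Sum>d\<in>Basis. of_real ((T b \<bullet> c) * (T b \<bullet> d)) * ?H c d)"
    by (simp add: laplace_beltrami_def)
  also have "\<dots> = (\<Sum>c\<in>Basis. \<Sum>d\<in>Basis. \<Sum>b\<in>Basis. of_real ((T b \<bullet> c) * (T b \<bullet> d)) * ?H c d)"
    by (subst sum.swap, rule sum.cong[OF refl], rule sum.swap)
  also have "\<dots> = (\<Sum>c\<in>Basis. \<Sum>d\<in>Basis. of_real (c \<bullet> d) * ?H c d)"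
  proof (intro sum.cong refl)
    fix c d :: 'a
    obtain c' d' where cd: "c = T c'" "d = T d'"
      using orthogonal_transformation_surj[OF T] by (metis surjD)
    have T': "T v \<bullet> T w = v \<bullet> w" for v w using T by (simp add: orthogonal_transformation_def)
    have "(\<Sum>b\<in>Basis. (T b \<bullet> c) * (T b \<bullet> d)) = c \<bullet> d"
      using euclidean_inner[of c' d'] by (simp add: cd T' inner_commute)
    then show "(\<Sum>b\<in>Basis. of_real ((T b \<bullet> c) * (T b \<bullet> d)) * ?H c d) = of_real (c \<bullet> d) * ?H c d"
      by (metis of_real_sum sum_distrib_right)
  qed
  also have "\<dots> = (\<Sum>c\<in>Basis. ?H c c)"
  proof (rule sum.cong[OF refl])
    fix c :: 'a assume c: "c \<in> Basis"
    have "(\<Sum>d\<in>Basis. of_real (c \<bullet> d) * ?H c d) = (\<Sum>d\<in>Basis. if d = c then ?H c d else 0)"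
      using c by (intro sum.cong) (auto simp: inner_Basis)
    then show "(\<Sum>d\<in>Basis. of_real (c \<bullet> d) * ?H c d) = ?H c c" using c by simp
  qed
  finally show ?thesis by (simp add: laplace_beltrami_def)
qed

section \<open>Eigenspaces\<close>

lemma Ck_on_cong:
  assumes "open S" "\<And>x. x \<in> S \<Longrightarrow> f x = g x" "Ck_on k S f"
  shows "Ck_on k S g"
  using assms(2,3)
proof (induction k arbitrary: f g)
  case 0
  then show ?case using continuous_on_eq[of S f g] by simp
next
  case (Suc k)
  have d: "f differentiable at x" if "x \<in> S" for x
    using Suc.prems(2) that assms(1) by (auto simp: differentiable_on_eq_differentiable_at)
  have "g differentiable at x" if x: "x \<in> S" for x
  proof -
    obtain D where "(f has_derivative D) (at x)" using d[OF x] by (auto simp: differentiable_def)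
    from has_derivative_transform_within_open[OF this assms(1) x, of g] Suc.prems(1)
    show ?thesis by (auto simp: differentiable_def)
  qed
  then have "g differentiable_on S"
    by (simp add: differentiable_at_imp_differentiable_on)
  moreover have "Ck_on k S (\<lambda>x. frechet_derivative g (at x) b)" if "b \<in> Basis" for b
  proof (rule Suc.IH)
    show "Ck_on k S (\<lambda>x. frechet_derivative f (at x) b)" using Suc.prems(2) that by simp
    show "frechet_derivative f (at x) b = frechet_derivative g (at x) b" if "x \<in> S" for x
      using frechet_derivative_transform_within_open[OF d[OF that] assms(1) that, of g] Suc.prems(1) by simp
  qed
  ultimately show ?case by simp
qed

lemma Ck_on_add:
  assumes "open S" "Ck_on k S f" "Ck_on k S g"
  shows "Ck_on k S (\<lambda>x. f x + g x)"
  using assms(2,3)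
proof (induction k arbitrary: f g)
  case 0
  then show ?case by (simp add: continuous_on_add)
next
  case (Suc k)
  have d: "f differentiable at x" "g differentiable at x" if "x \<in> S" for x
    using Suc.prems that assms(1) by (auto simp: differentiable_on_eq_differentiable_at)
  have "Ck_on k S (\<lambda>x. frechet_derivative (\<lambda>x. f x + g x) (at x) b)" if b: "b \<in> Basis" for b
  proof (rule Ck_on_cong[OF assms(1)])
    show "Ck_on k S (\<lambda>x. frechet_derivative f (at x) b + frechet_derivative g (at x) b)"
      by (rule Suc.IH) (use Suc.prems b in auto)
    show "frechet_derivative f (at x) b + frechet_derivative g (at x) b =
        frechet_derivative (\<lambda>x. f x + g x) (at x) b" if "x \<in> S" for x
    proof -
      have "((\<lambda>x. f x + g x) has_derivative
         (\<lambda>h. frechet_derivative f (at x) h + frechet_derivative g (at x) h)) (at x)"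
        by (rule has_derivative_add) (rule iffD1[OF frechet_derivative_works], rule d[OF that])+
      from fun_cong[OF frechet_derivative_at[OF this], of b] show ?thesis .
    qed
  qed
  then show ?case using Suc.prems by (simp add: differentiable_on_add)
qed

lemma Ck_on_scaleR:
  assumes "open S" "Ck_on k S f"
  shows "Ck_on k S (\<lambda>x. c *\<^sub>R f x)"
  using assms(2)
proof (induction k arbitrary: f)
  case 0
  then show ?case by (simp add: continuous_on_scaleR)
next
  case (Suc k)
  have d: "f differentiable at x" if "x \<in> S" for x
    using Suc.prems that assms(1) by (auto simp: differentiable_on_eq_differentiable_at)
  have D: "((\<lambda>x. c *\<^sub>R f x) has_derivative (\<lambda>h. c *\<^sub>R frechet_derivative f (at x) h)) (at x)" if "x \<in> S" for x
    by (rule has_derivative_scaleR_right) (rule iffD1[OF frechet_derivative_works], rule d[OF that])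
  have "Ck_on k S (\<lambda>x. frechet_derivative (\<lambda>x. c *\<^sub>R f x) (at x) b)" if b: "b \<in> Basis" for b
  proof (rule Ck_on_cong[OF assms(1)])
    show "Ck_on k S (\<lambda>x. c *\<^sub>R frechet_derivative f (at x) b)"
      by (rule Suc.IH) (use Suc.prems b in auto)
    show "c *\<^sub>R frechet_derivative f (at x) b = frechet_derivative (\<lambda>x. c *\<^sub>R f x) (at x) b" if "x \<in> S" for x
      using fun_cong[OF frechet_derivative_at[OF D[OF that]], of b] .
  qed
  moreover have "(\<lambda>x. c *\<^sub>R f x) differentiable_on S"
    using D assms(1) by (auto simp: differentiable_on_eq_differentiable_at differentiable_def)
  ultimately show ?case by simp
qed

lemma Ck_on_0: "Ck_on k S (\<lambda>x. 0)"
  by (induction k) (simp_all add: frechet_derivative_const)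

lemma Ck_on_sum:
  assumes "open S" "finite I" "\<And>i. i \<in> I \<Longrightarrow> Ck_on k S (f i)"
  shows "Ck_on k S (\<lambda>x. \<Sum>i\<in>I. f i x)"
  using assms(2,3)
proof (induction I rule: finite_induct)
  case empty then show ?case by (simp add: Ck_on_0)
next
  case (insert i I)
  then show ?case using Ck_on_add[OF assms(1), of k "f i" "\<lambda>x. \<Sum>i\<in>I. f i x"] by simp
qed

text \<open>A partial derivative of f composed with T is a combination, with constant coefficients,
  of partial derivatives of f composed with T, so the induction on k closes when f is kept
  general.\<close>

lemma Ck_on_linear_compose:
  fixes T :: "'a::euclidean_space \<Rightarrow> 'a"
  assumes "open S" "linear T" "\<And>x. x \<in> S \<Longrightarrow> T x \<in> S" "Ck_on k S f"
  shows "Ck_on k S (\<lambda>x. f (T x))"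
  using assms(4)
proof (induction k arbitrary: f)
  case 0
  have "continuous_on S T" using assms(2) linear_continuous_on linear_conv_bounded_linear by blast
  then show ?case using 0 continuous_on_compose2[of S f S T] assms(3) by auto
next
  case (Suc k)
  have d: "f differentiable at x" if "x \<in> S" for x
    using Suc.prems that assms(1) by (auto simp: differentiable_on_eq_differentiable_at)
  have DT: "(T has_derivative T) (at x)" for x
    using assms(2) by (simp add: linear_imp_has_derivative)
  have D: "((\<lambda>x. f (T x)) has_derivative (\<lambda>h. frechet_derivative f (at (T x)) (T h))) (at x)" if "x \<in> S" for x
    by (rule has_derivative_compose[OF DT iffD1[OF frechet_derivative_works]], rule d[OF assms(3)[OF that]])
  have "Ck_on k S (\<lambda>x. frechet_derivative (\<lambda>x. f (T x)) (at x) b)" if b: "b \<in> Basis" for b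
  proof (rule Ck_on_cong[OF assms(1)])
    show "Ck_on k S (\<lambda>x. \<Sum>c\<in>Basis. (T b \<bullet> c) *\<^sub>R frechet_derivative f (at (T x)) c)"
    proof (intro Ck_on_sum Ck_on_scaleR assms(1) finite_Basis)
      fix c :: 'a assume "c \<in> Basis"
      then have "Ck_on k S (\<lambda>x. frechet_derivative f (at x) c)" using Suc.prems by simp
      from Suc.IH[OF this] show "Ck_on k S (\<lambda>x. frechet_derivative f (at (T x)) c)" .
    qed
    show "(\<Sum>c\<in>Basis. (T b \<bullet> c) *\<^sub>R frechet_derivative f (at (T x)) c) =
        frechet_derivative (\<lambda>x. f (T x)) (at x) b" if "x \<in> S" for x
    proof -
      have lin: "linear (frechet_derivative f (at (T x)))"
        using d[OF assms(3)[OF that]] linear_frechet_derivative by blast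
      have "frechet_derivative f (at (T x)) (\<Sum>c\<in>Basis. (T b \<bullet> c) *\<^sub>R c)
         = (\<Sum>c\<in>Basis. (T b \<bullet> c) *\<^sub>R frechet_derivative f (at (T x)) c)"
        by (simp add: linear_sum[OF lin] linear_cmul[OF lin])
      then have "frechet_derivative f (at (T x)) (T b)
         = (\<Sum>c\<in>Basis. (T b \<bullet> c) *\<^sub>R frechet_derivative f (at (T x)) c)"
        unfolding euclidean_representation .
      then show ?thesis using fun_cong[OF frechet_derivative_at[OF D[OF that]], of b] by simp
    qed
  qed
  moreover have "(\<lambda>x. f (T x)) differentiable_on S"
    using D assms(1) by (auto simp: differentiable_on_eq_differentiable_at differentiable_def)
  ultimately show ?case by simp
qed

lemma sphere_smooth_orthogonal:
  fixes T :: "'a::euclidean_space \<Rightarrow> 'a"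
  assumes T: "orthogonal_transformation T" and f: "sphere_smooth f"
  shows "sphere_smooth (\<lambda>x. f (T x))"
proof -
  have lT: "linear T" using T orthogonal_transformation_linear by blast
  have n: "norm (T y) = norm y" for y using orthogonal_transformation_norm[OF T] .
  have T0: "T y = 0 \<longleftrightarrow> y = 0" for y using n[of y] by (metis norm_eq_zero)
  have "Ck_on k (- {0}) (\<lambda>y. (\<lambda>z. f (z /\<^sub>R norm z)) (T y))" for k
    by (rule Ck_on_linear_compose[OF _ lT])
       (use f T0 in \<open>auto simp: sphere_smooth_def smooth_on_def\<close>)
  then show ?thesis by (simp add: sphere_smooth_def smooth_on_def n linear_cmul[OF lT])
qed

lemma sphere_smooth_diff:
  assumes "sphere_smooth f" "sphere_smooth g"
  shows "sphere_smooth (\<lambda>x. f x - g x)"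
proof -
  have "Ck_on k (- {0}) (\<lambda>y. f (y /\<^sub>R norm y) + (-1) *\<^sub>R g (y /\<^sub>R norm y))" for k
    using assms by (intro Ck_on_add Ck_on_scaleR) (auto simp: sphere_smooth_def smooth_on_def)
  then show ?thesis by (simp add: sphere_smooth_def smooth_on_def)
qed

lemma laplace_beltrami_diff:
  fixes f g :: "'a::euclidean_space \<Rightarrow> complex"
  assumes "sphere_C2 f" "sphere_C2 g" "norm x = 1"
  shows "laplace_beltrami (\<lambda>y. f y - g y) x = laplace_beltrami f x - laplace_beltrami g x"
proof -
  have d: "tangential_deriv b (\<lambda>y. f y - g y) z = tangential_deriv b f z - tangential_deriv b g z"
    if "radial_ext f differentiable at z" "radial_ext g differentiable at z" "norm z = 1"
    for f g :: "'a \<Rightarrow> complex" and b z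
    using tangential_deriv_add(1)[OF that(1) tangential_deriv_cmult(2)[OF that(2,3), where c = "-1"]]
      tangential_deriv_cmult(1)[OF that(2,3), where c = "-1"] by simp
  have "tangential_deriv b (tangential_deriv b (\<lambda>y. f y - g y)) x
     = tangential_deriv b (tangential_deriv b f) x - tangential_deriv b (tangential_deriv b g) x" if b: "b \<in> Basis" for b
  proof -
    have "tangential_deriv b (tangential_deriv b (\<lambda>y. f y - g y)) x
      = tangential_deriv b (\<lambda>y. tangential_deriv b f y - tangential_deriv b g y) x"
      by (rule tangential_deriv_cong[OF d assms(3)]) (use assms in \<open>auto simp: sphere_C2_def sphere_C1_differentiable\<close>)
    also have "\<dots> = tangential_deriv b (tangential_deriv b f) x - tangential_deriv b (tangential_deriv b g) x"
      by (rule d) (use assms b in \<open>auto simp: sphere_C2_def sphere_C1_differentiable\<close>)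
    finally show ?thesis .
  qed
  then show ?thesis by (simp add: laplace_beltrami_def sum_subtractf)
qed

lemma eigenspace_iff:
  "\<phi> \<in> eigenspace \<mu> \<longleftrightarrow> sphere_smooth \<phi> \<and> (\<forall>x. norm x = 1 \<longrightarrow> laplace_beltrami \<phi> x = - (of_real \<mu> * \<phi> x))"
proof -
  have "(\<forall>x\<in>sphere 0 1. - laplace_beltrami \<phi> x = of_real \<mu> * \<phi> x) \<longleftrightarrow>
        (\<forall>x. norm x = 1 \<longrightarrow> laplace_beltrami \<phi> x = - (of_real \<mu> * \<phi> x))"
    unfolding Ball_def mem_sphere_0 by (metis minus_equation_iff)
  then show ?thesis by (simp add: eigenspace_def)
qed

lemma eigenspace_C2: "\<phi> \<in> eigenspace \<mu> \<Longrightarrow> sphere_C2 \<phi>"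
  by (auto simp: eigenspace_iff sphere_smooth_C2)

lemma eigenspace_continuous: "\<phi> \<in> eigenspace \<mu> \<Longrightarrow> continuous_on (sphere 0 1) \<phi>"
  using eigenspace_C2 sphere_C1_continuous sphere_C2_def by blast

lemma eigenspace_laplace: "\<phi> \<in> eigenspace \<mu> \<Longrightarrow> norm x = 1 \<Longrightarrow> laplace_beltrami \<phi> x = - (of_real \<mu> * \<phi> x)"
  by (simp add: eigenspace_iff)

lemma eigenspace_diff:
  assumes "\<phi> \<in> eigenspace \<mu>" "\<psi> \<in> eigenspace \<mu>"
  shows "(\<lambda>x. \<phi> x - \<psi> x) \<in> eigenspace \<mu>"
  using assms laplace_beltrami_diff[OF eigenspace_C2[OF assms(1)] eigenspace_C2[OF assms(2)]]
    sphere_smooth_diff[of \<phi> \<psi>]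
  by (simp add: eigenspace_iff algebra_simps)

lemma eigenspace_orthogonal:
  fixes T :: "'a::euclidean_space \<Rightarrow> 'a"
  assumes T: "orthogonal_transformation T" and "\<phi> \<in> eigenspace \<mu>"
  shows "(\<lambda>x. \<phi> (T x)) \<in> eigenspace \<mu>"
  using assms laplace_beltrami_orthogonal[OF T eigenspace_C2[OF assms(2)]]
    orthogonal_transformation_norm[OF T]
  by (simp add: eigenspace_iff sphere_smooth_orthogonal)

section \<open>Spectral projections of zonal functions\<close>

lemma sphere_AE_eq_0:
  fixes f :: "'a::euclidean_space \<Rightarrow> 'b::real_normed_vector"
  assumes c: "continuous_on (sphere 0 1) f" and ae: "AE x in sphere_measure. f x = 0" and x: "norm x = 1"
  shows "f x = 0"
proof (rule ccontr)
  assume nz: "f x \<noteq> 0"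
  obtain U where U: "open U" "U \<inter> sphere 0 1 = f -` (- {0}) \<inter> sphere 0 1"
    using c unfolding continuous_on_open_invariant by (metis open_Compl closed_singleton)
  have "U \<inter> sphere 0 1 \<noteq> {}" using U(2) nz x by auto
  then have pos: "emeasure sphere_measure (U \<inter> sphere 0 1) \<noteq> 0"
    by (rule sphere_measure_open_pos[OF U(1)])
  obtain N where N: "N \<in> null_sets sphere_measure" "{x \<in> space sphere_measure. f x \<noteq> 0} \<subseteq> N"
    using ae by (auto simp: eventually_ae_filter)
  have "U \<inter> sphere 0 1 \<subseteq> N" using N(2) U(2) by auto
  then have "emeasure sphere_measure (U \<inter> sphere 0 1) \<le> emeasure sphere_measure N"
    using N(1) by (intro emeasure_mono) auto
  then show False using N(1) pos by auto
qed

lemma sphere_integral_norm2_eq_0: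
  fixes f :: "'a::euclidean_space \<Rightarrow> complex"
  assumes c: "continuous_on (sphere 0 1) f" and i: "(LINT x|sphere_measure. f x * cnj (f x)) = 0"
    and x: "norm x = 1"
  shows "f x = 0"
proof -
  have int: "integrable sphere_measure (\<lambda>x. (cmod (f x))\<^sup>2)"
    by (intro integrable_sphere continuous_intros c)
  have "of_real (LINT x|sphere_measure. (cmod (f x))\<^sup>2) = (LINT x|sphere_measure. f x * cnj (f x))"
    by (simp only: integral_complex_of_real[symmetric] complex_norm_square)
  then have "(LINT x|sphere_measure. (cmod (f x))\<^sup>2) = 0" using i by simp
  then have "AE x in sphere_measure. (cmod (f x))\<^sup>2 = 0"
    using integral_nonneg_eq_0_iff_AE[OF int] by simp
  then have "AE x in sphere_measure. f x = 0" by simp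
  then show ?thesis using sphere_AE_eq_0[OF c _ x] by blast
qed

lemma sphere_L2_mult_integrable:
  assumes f: "f \<in> sphere_L2" and g: "continuous_on (sphere 0 1) g"
  shows "integrable sphere_measure (\<lambda>x. f x * g x)"
proof -
  obtain B where B: "\<And>x. x \<in> sphere 0 1 \<Longrightarrow> norm (g x) \<le> B" using bounded_sphere[OF g] by blast
  have i: "integrable sphere_measure (\<lambda>x. B * (1 + (cmod (f x))\<^sup>2))"
    using f integrable_sphere[OF continuous_on_const[of _ "1::real"]]
    by (intro integrable_mult_right integrable_add) (auto simp: sphere_L2_def)
  have "AE x in sphere_measure. norm (f x * g x) \<le> norm (B * (1 + (cmod (f x))\<^sup>2))"
  proof (rule AE_I2)
    fix x :: 'a assume "x \<in> space sphere_measure"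
    then have b: "norm (g x) \<le> B" using B by simp
    \<comment> \<open>From (|f x| - 1)^2 >= 0; the constant 1 is integrable because the sphere has
      finite measure.\<close>
    have "cmod (f x) \<le> 1 + (cmod (f x))\<^sup>2"
      using zero_le_power2[of "cmod (f x) - 1"] norm_ge_zero[of "f x"]
      unfolding power2_diff power_one mult_1_right by linarith
    then have "cmod (f x) * norm (g x) \<le> (1 + (cmod (f x))\<^sup>2) * B"
      using b by (intro mult_mono) auto
    then show "norm (f x * g x) \<le> norm (B * (1 + (cmod (f x))\<^sup>2))"
      by (simp add: norm_mult mult.commute)
  qed
  moreover have "(\<lambda>x. f x * g x) \<in> borel_measurable sphere_measure"
    using f borel_measurable_sphere[OF g] by (auto simp: sphere_L2_def)
  ultimately show ?thesis using Bochner_Integration.integrable_bound[OF i] by blast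
qed

lemma continuous_sphere_L2:
  assumes "continuous_on (sphere 0 1) f"
  shows "f \<in> sphere_L2"
  unfolding sphere_L2_def
  using assms by (auto intro!: borel_measurable_sphere integrable_sphere continuous_intros)

lemma eigenprojection_inner:
  assumes f: "f \<in> sphere_L2" and w: "is_eigenprojection \<mu> f w" and \<phi>: "\<phi> \<in> eigenspace \<mu>"
  shows "(LINT x|sphere_measure. f x * cnj (\<phi> x)) = (LINT x|sphere_measure. w x * cnj (\<phi> x))"
proof -
  have cw: "continuous_on (sphere 0 1) w" using w eigenspace_continuous by (auto simp: is_eigenprojection_def)
  have cp: "continuous_on (sphere 0 1) (\<lambda>x. cnj (\<phi> x))" by (intro continuous_intros eigenspace_continuous[OF \<phi>])
  have "0 = (LINT x|sphere_measure. (f x - w x) * cnj (\<phi> x))"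
    using w \<phi> by (simp add: is_eigenprojection_def)
  also have "\<dots> = (LINT x|sphere_measure. f x * cnj (\<phi> x)) - (LINT x|sphere_measure. w x * cnj (\<phi> x))"
    using sphere_L2_mult_integrable[OF f cp] sphere_L2_mult_integrable[OF continuous_sphere_L2[OF cw] cp]
    by (simp add: left_diff_distrib)
  finally show ?thesis by simp
qed

text \<open>The difference of two projections lies in the eigenspace and is orthogonal to the whole
  eigenspace, in particular to itself. Being continuous, it vanishes at every point of the sphere
  and not just almost everywhere.\<close>

lemma eigenprojection_unique:
  assumes f: "f \<in> sphere_L2" and w: "is_eigenprojection \<mu> f w" and v: "is_eigenprojection \<mu> f v"
    and x: "norm x = 1"
  shows "v x = w x"
proof -
  let ?d = "\<lambda>x. v x - w x"
  have vw: "v \<in> eigenspace \<mu>" "w \<in> eigenspace \<mu>" using v w by (auto simp: is_eigenprojection_def)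
  have d: "?d \<in> eigenspace \<mu>" by (rule eigenspace_diff[OF vw])
  note c = eigenspace_continuous
  have cd: "continuous_on (sphere 0 1) (\<lambda>x. cnj (?d x))" by (intro continuous_intros c[OF vw(1)] c[OF vw(2)])
  have "(LINT x|sphere_measure. ?d x * cnj (?d x))
     = (LINT x|sphere_measure. v x * cnj (?d x)) - (LINT x|sphere_measure. w x * cnj (?d x))"
    using sphere_L2_mult_integrable[OF continuous_sphere_L2[OF c[OF vw(1)]] cd]
      sphere_L2_mult_integrable[OF continuous_sphere_L2[OF c[OF vw(2)]] cd]
    by (simp only: left_diff_distrib Bochner_Integration.integral_diff)
  then have "(LINT x|sphere_measure. ?d x * cnj (?d x)) = 0"
    using eigenprojection_inner[OF f w d] eigenprojection_inner[OF f v d] by simp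
  from sphere_integral_norm2_eq_0[OF c[OF d] this x] show ?thesis by simp
qed

text \<open>Substituting T moves it from w to the test function \<phi>, and \<phi> composed with T
  is again an eigenfunction. That T is its own inverse makes \<open>\<phi> (T (T x))\<close> return
  to \<open>\<phi> x\<close>.\<close>

lemma eigenprojection_involution:
  fixes T :: "real ^ 'n::{finite,wellorder} \<Rightarrow> real ^ 'n::_"
  assumes T: "orthogonal_transformation T" and TT: "\<And>x. T (T x) = x"
    and f: "f \<in> sphere_L2" and inv: "AE x in sphere_measure. f (T x) = f x"
    and w: "is_eigenprojection \<mu> f w"
  shows "is_eigenprojection \<mu> f (\<lambda>x. w (T x))"
proof -
  have we: "w \<in> eigenspace \<mu>" using w by (auto simp: is_eigenprojection_def)
  have "(LINT x|sphere_measure. (f x - w (T x)) * cnj (\<phi> x)) = 0" if \<phi>: "\<phi> \<in> eigenspace \<mu>" for \<phi>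
  proof -
    let ?g = "\<lambda>x. (f x - w x) * cnj (\<phi> (T x))"
    have \<phi>T: "(\<lambda>x. \<phi> (T x)) \<in> eigenspace \<mu>" by (rule eigenspace_orthogonal[OF T \<phi>])
    have m: "f \<in> borel_measurable sphere_measure" using f by (simp add: sphere_L2_def)
    have m1: "T \<in> sphere_measure \<rightarrow>\<^sub>M sphere_measure" by (rule distr_sphere_measure(2)[OF T])
    have m2: "\<psi> \<in> borel_measurable sphere_measure" if "\<psi> \<in> eigenspace \<mu>" for \<psi> :: "real^'n::_ \<Rightarrow> complex"
      by (rule borel_measurable_sphere[OF eigenspace_continuous[OF that]])
    have cm: "(\<lambda>x. cnj (\<psi> x)) \<in> borel_measurable sphere_measure" if "\<psi> \<in> eigenspace \<mu>" for \<psi> :: "real^'n::_ \<Rightarrow> complex"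
      by (rule borel_measurable_sphere) (intro continuous_intros eigenspace_continuous[OF that])
    note wT = eigenspace_orthogonal[OF T we]
    have meas: "?g \<in> borel_measurable sphere_measure"
      by (intro borel_measurable_times borel_measurable_diff m m2[OF we] cm[OF \<phi>T])
    have "(LINT x|sphere_measure. (f x - w (T x)) * cnj (\<phi> x)) = (LINT x|sphere_measure. ?g (T x))"
    proof (rule integral_cong_AE)
      show "AE x in sphere_measure. (f x - w (T x)) * cnj (\<phi> x) = ?g (T x)"
        using inv by eventually_elim (simp add: TT)
      show "(\<lambda>x. ?g (T x)) \<in> borel_measurable sphere_measure" by (rule measurable_compose[OF m1 meas])
      show "(\<lambda>x. (f x - w (T x)) * cnj (\<phi> x)) \<in> borel_measurable sphere_measure"
        by (intro borel_measurable_times borel_measurable_diff m m2[OF wT] cm[OF \<phi>])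
    qed
    also have "\<dots> = (LINT x|sphere_measure. ?g x)" by (rule integral_sphere_orthogonal[OF T meas])
    also have "\<dots> = 0" using w \<phi>T by (simp add: is_eigenprojection_def)
    finally show ?thesis .
  qed
  then show ?thesis using eigenspace_orthogonal[OF T we] by (simp add: is_eigenprojection_def)
qed

section \<open>Reflections and the symmetry of zonal functions\<close>

definition reflection :: "'a::euclidean_space \<Rightarrow> 'a \<Rightarrow> 'a" where
  "reflection v z = z - (2 * (z \<bullet> v) / (v \<bullet> v)) *\<^sub>R v"

lemma orthogonal_reflection: "orthogonal_transformation (reflection v)"
proof (cases "v = 0")
  case True then show ?thesis by (simp add: reflection_def[abs_def])
next
  case False
  then have "v \<bullet> v \<noteq> 0" by simp
  then show ?thesis
    unfolding orthogonal_transformation_def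
  proof (intro conjI linearI allI)
    show "reflection v (a + b) = reflection v a + reflection v b" for a b
      by (simp add: reflection_def inner_simps add_divide_distrib algebra_simps)
    show "reflection v (r *\<^sub>R a) = r *\<^sub>R reflection v a" for r a
      by (simp add: reflection_def inner_simps algebra_simps)
    show "reflection v a \<bullet> reflection v b = a \<bullet> b" for a b
      using \<open>v \<bullet> v \<noteq> 0\<close> by (simp add: reflection_def inner_simps inner_commute field_simps)
  qed
qed

lemma reflection_involution: "reflection v (reflection v z) = z"
proof (cases "v = 0")
  case True then show ?thesis by (simp add: reflection_def)
next
  case False
  then have "v \<bullet> v \<noteq> 0" by simp
  then show ?thesis by (simp add: reflection_def inner_simps field_simps)
qed

text \<open>Points x, y of equal height are exchanged by the reflection in the hyperplane orthogonal
  to x - y, which contains p and so preserves f almost everywhere. Uniqueness of the projection then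
  makes w invariant. It is applied as a pointwise statement, without a profile function.\<close>

lemma eigenprojection_zonal:
  fixes p :: "real ^ 'n::{finite,wellorder}"
  assumes f: "f \<in> sphere_L2" and z: "zonal p f" and w: "is_eigenprojection \<mu> f w"
    and xy: "norm x = 1" "norm y = 1" "x \<bullet> p = y \<bullet> p"
  shows "w x = w y"
proof (cases "x = y")
  case False
  define v where "v = x - y"
  let ?T = "reflection v"
  have T: "orthogonal_transformation ?T" by (rule orthogonal_reflection)
  have xx: "x \<bullet> x = 1" "y \<bullet> y = 1" using xy by (simp_all add: dot_square_norm)
  have vv: "v \<bullet> v = 2 * (x \<bullet> v)"
    using xx by (simp add: v_def inner_simps inner_commute)
  have vv0: "v \<bullet> v \<noteq> 0" using False by (simp add: v_def)
  have Tx: "?T x = y" using vv vv0 by (simp add: reflection_def) (simp add: v_def)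
  have pv: "p \<bullet> v = 0" using xy by (simp add: v_def inner_simps inner_commute)
  have Tp: "?T z \<bullet> p = z \<bullet> p" for z
    using pv by (simp add: reflection_def inner_simps inner_commute)
  obtain F where F: "AE x in sphere_measure. f x = F (geodesic_dist x p)"
    using z by (auto simp: zonal_def)
  have "AE x in sphere_measure. f (?T x) = f x"
    using F AE_sphere_orthogonal[OF T F] by eventually_elim (simp add: geodesic_dist_def Tp)
  from eigenprojection_involution[OF T reflection_involution f this w]
  have "is_eigenprojection \<mu> f (\<lambda>x. w (?T x))" .
  from eigenprojection_unique[OF f w this xy(1)] show ?thesis by (simp add: Tx)
qed simp

section \<open>Gegenbauer polynomials\<close>

lemma gegenbauer_op_add: "gegenbauer_op d (p + q) = gegenbauer_op d p + gegenbauer_op d q"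
  by (simp add: gegenbauer_op_def pderiv_add algebra_simps smult_add_right)

lemma gegenbauer_op_smult: "gegenbauer_op d (smult c p) = smult c (gegenbauer_op d p)"
  by (simp add: gegenbauer_op_def pderiv_smult smult_diff_right mult.commute smult_add_right)

text \<open>On monomials the operator is triangular, sending degree j to degrees j and j - 2; for d
  = 4 the diagonal entry is -j(j+3). Existence of the eigenpolynomials is linear algebra on this
  triangle.\<close>

lemma coeff_gegenbauer_op:
  "coeff (gegenbauer_op d q) j = real (j + 2) * real (j + 1) * coeff q (j + 2)
     - real j * (real j - 1 + d) * coeff q j"
proof -
  have X2: "[:1, 0, -1:] * r = r - monom 1 2 * r" for r :: "real poly"
    by (simp add: monom_altdef power2_eq_square algebra_simps)
  have X1: "[:0, 1:] * r = monom 1 1 * r" for r :: "real poly"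
    by (simp add: monom_altdef)
  have c1: "coeff (monom 1 1 * r) j = (if j < 1 then 0 else coeff r (j - 1))"
    and c2: "coeff (monom 1 2 * r) j = (if j < 2 then 0 else coeff r (j - 2))" for r :: "real poly"
    by (simp_all add: coeff_monom_mult)
  consider "j = 0" | "j = 1" | k where "j = Suc (Suc k)" by (metis One_nat_def old.nat.exhaust)
  then show ?thesis
    unfolding gegenbauer_op_def X1 X2 coeff_diff coeff_smult c1 c2 coeff_pderiv
    by cases (simp_all add: algebra_simps)
qed

definition gegenbauer_eigenvalue :: "nat \<Rightarrow> real" where
  "gegenbauer_eigenvalue n = real n * (real n + 3)"

lemma gegenbauer_eigenvalue_strict_mono: "strict_mono gegenbauer_eigenvalue"
  unfolding strict_mono_def gegenbauer_eigenvalue_def by (auto intro!: mult_strict_mono')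

lemma gegenbauer_eigenvalue_inj: "gegenbauer_eigenvalue m = gegenbauer_eigenvalue n \<longleftrightarrow> m = n"
  using strict_mono_eq[OF gegenbauer_eigenvalue_strict_mono] .

text \<open>Below degree n the diagonal entries of the shifted operator are differences of distinct
  eigenvalues, so the triangular system is solved from the top coefficient downwards.\<close>

lemma gegenbauer_op_shift_surj:
  assumes "j \<le> n" "\<And>i. i \<ge> j \<Longrightarrow> coeff q i = 0"
  shows "\<exists>p. (\<forall>i\<ge>j. coeff p i = 0) \<and> gegenbauer_op 4 p + smult (gegenbauer_eigenvalue n) p = q"
  using assms
proof (induction j arbitrary: q)
  case 0
  then have "q = 0" by (intro poly_eqI) simp
  then show ?case by (intro exI[of _ 0]) (simp add: gegenbauer_op_def)
next
  case (Suc j)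
  define e where "e = gegenbauer_eigenvalue n"
  define a where "a = coeff q j / (e - gegenbauer_eigenvalue j)"
  have ne: "e - gegenbauer_eigenvalue j \<noteq> 0"
    unfolding e_def using Suc.prems(1) gegenbauer_eigenvalue_inj[of n j] by simp
  define r where "r = q - (gegenbauer_op 4 (monom a j) + smult e (monom a j))"
  have "coeff r i = 0" if "i \<ge> j" for i
  proof (cases "i = j")
    case True
    have "coeff r j = coeff q j - (e - gegenbauer_eigenvalue j) * a"
      by (simp add: r_def coeff_gegenbauer_op gegenbauer_eigenvalue_def algebra_simps)
    then show ?thesis using ne True by (simp add: a_def)
  next
    case False
    then show ?thesis using that Suc.prems(2)[of i] by (simp add: r_def coeff_gegenbauer_op)
  qed
  then obtain p where p: "\<forall>i\<ge>j. coeff p i = 0" "gegenbauer_op 4 p + smult e p = r"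
    using Suc.IH[of r] Suc.prems(1) unfolding e_def by auto
  have "gegenbauer_op 4 (monom a j + p) + smult e (monom a j + p) = q"
    using p(2) by (simp add: gegenbauer_op_add smult_add_right r_def algebra_simps)
  moreover have "\<forall>i\<ge>Suc j. coeff (monom a j + p) i = 0" using p(1) by simp
  ultimately show ?case unfolding e_def by blast
qed

lemma gegenbauer_ex:
  "\<exists>P. degree P = n \<and> lead_coeff P = 1 \<and> gegenbauer_op 4 P = smult (- gegenbauer_eigenvalue n) P"
proof -
  \<comment> \<open>x^n is an eigenvector up to lower degrees: its coefficient n(n+3) cancels, and
    the remainder \<open>q\<close> of degree below n can be removed by the preceding lemma.\<close>
  define q where "q = gegenbauer_op 4 (monom 1 n) + smult (gegenbauer_eigenvalue n) (monom 1 n)"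
  have "coeff q i = 0" if "i \<ge> n" for i
    using that by (simp add: q_def coeff_gegenbauer_op gegenbauer_eigenvalue_def algebra_simps)
  then obtain p where p: "\<forall>i\<ge>n. coeff p i = 0" "gegenbauer_op 4 p + smult (gegenbauer_eigenvalue n) p = q"
    using gegenbauer_op_shift_surj[of n n q] by auto
  define P where "P = monom 1 n + smult (-1) p"
  have "gegenbauer_op 4 P = gegenbauer_op 4 (monom 1 n) + smult (-1) (gegenbauer_op 4 p)"
    unfolding P_def gegenbauer_op_add gegenbauer_op_smult ..
  also have "\<dots> = smult (- gegenbauer_eigenvalue n) P"
    using p(2) by (simp add: P_def q_def algebra_simps smult_add_right smult_diff_right)
  finally have e: "gegenbauer_op 4 P = smult (- gegenbauer_eigenvalue n) P" .
  have c: "coeff P n = 1" "\<And>i. i > n \<Longrightarrow> coeff P i = 0" using p(1) by (auto simp: P_def)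
  then have "degree P = n" by (metis degree_le le_antisym le_degree zero_neq_one)
  then show ?thesis using e c by (intro exI[of _ P]) simp
qed

text \<open>The monic multiple of the ultraspherical polynomial C_n^(3/2), pinned down by its
  degree, normalization and differential equation.\<close>

definition gegenbauer :: "nat \<Rightarrow> real poly" where
  "gegenbauer n = (SOME P. degree P = n \<and> lead_coeff P = 1 \<and>
                     gegenbauer_op 4 P = smult (- gegenbauer_eigenvalue n) P)"

lemma gegenbauer:
  shows degree_gegenbauer: "degree (gegenbauer n) = n"
    and lead_coeff_gegenbauer: "coeff (gegenbauer n) n = 1"
    and gegenbauer_op_gegenbauer: "gegenbauer_op 4 (gegenbauer n) = smult (- gegenbauer_eigenvalue n) (gegenbauer n)"
  using someI_ex[OF gegenbauer_ex[of n]] unfolding gegenbauer_def[symmetric] by auto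

lemma gegenbauer_0: "gegenbauer 0 = [:1:]"
  using degree_gegenbauer[of 0] lead_coeff_gegenbauer[of 0] by (metis degree_0_id pCons_eq_iff degree_eq_zeroE coeff_pCons_0)

lemma gegenbauer_nz: "gegenbauer n \<noteq> 0"
  using lead_coeff_gegenbauer[of n] by auto

text \<open>The basis property in the form in which it is applied: an identity linear in a
  polynomial has only to be checked on the eigenpolynomials. The leading coefficient is removed by a
  multiple of the monic \<open>gegenbauer k\<close>.\<close>

lemma gegenbauer_span:
  fixes \<Phi> :: "real poly \<Rightarrow> 'b::real_vector"
  assumes add: "\<And>p q. \<Phi> (p + q) = \<Phi> p + \<Phi> q" and smult: "\<And>c p. \<Phi> (smult c p) = c *\<^sub>R \<Phi> p"
    and zero: "\<And>n. n < k \<Longrightarrow> \<Phi> (gegenbauer n) = 0" and q: "\<And>i. i \<ge> k \<Longrightarrow> coeff q i = 0"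
  shows "\<Phi> q = 0"
  using zero q
proof (induction k arbitrary: q)
  case 0
  then have "q = smult 0 0" by (intro poly_eqI) simp
  then show ?case using smult[of 0 0] by simp
next
  case (Suc k)
  define r where "r = q - smult (coeff q k) (gegenbauer k)"
  have "coeff r i = 0" if "i \<ge> k" for i
    using that Suc.prems(2)[of i] coeff_eq_0[of "gegenbauer k" i] lead_coeff_gegenbauer[of k]
    by (cases "i = k") (auto simp: r_def degree_gegenbauer)
  then have "\<Phi> r = 0" using Suc by simp
  then have "\<Phi> (r + smult (coeff q k) (gegenbauer k)) = 0"
    using Suc.prems(1)[of k] by (simp only: add smult) simp
  then show ?case by (simp add: r_def)
qed

lemma gegenbauer_span_all:
  fixes \<Phi> :: "real poly \<Rightarrow> 'b::real_vector"
  assumes "\<And>p q. \<Phi> (p + q) = \<Phi> p + \<Phi> q" "\<And>c p. \<Phi> (smult c p) = c *\<^sub>R \<Phi> p"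
    "\<And>n. \<Phi> (gegenbauer n) = 0"
  shows "\<Phi> q = 0"
  by (rule gegenbauer_span[of \<Phi> "Suc (degree q)"]) (use assms in \<open>auto intro: coeff_eq_0\<close>)

text \<open>The slice of the 4-sphere at polar angle \<theta> is a 3-sphere of radius sin \<theta>,
  which explains the weight. The angle is kept as variable because the differential equation is
  studied in it.\<close>

definition zonal_integral :: "real poly \<Rightarrow> real" where
  "zonal_integral q = integral {0..pi} (\<lambda>\<theta>. poly q (cos \<theta>) * sin \<theta> ^ 3)"

lemma zonal_integrand_integrable:
  fixes q :: "real poly" and a b :: real
  shows "(\<lambda>\<theta>. poly q (cos \<theta>) * sin \<theta> ^ 3) integrable_on {a..b}"
  by (intro integrable_continuous_interval continuous_intros)

lemma zonal_integral_add: "zonal_integral (p + q) = zonal_integral p + zonal_integral q"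
  unfolding zonal_integral_def
  by (simp add: distrib_right integral_add zonal_integrand_integrable)

lemma zonal_integral_smult: "zonal_integral (smult c q) = c * zonal_integral q"
  unfolding zonal_integral_def by (simp add: mult.assoc)

text \<open>In the angle the operator has divergence form: with the weight, it is the derivative of
  - sin^4 q'(cos), which vanishes at both poles.\<close>

lemma zonal_integral_gegenbauer_op: "zonal_integral (gegenbauer_op 4 q) = 0"
proof -
  have "((\<lambda>\<theta>. poly (gegenbauer_op 4 q) (cos \<theta>) * sin \<theta> ^ 3) has_integral
      (- (sin pi ^ 4 * poly (pderiv q) (cos pi)) - - (sin 0 ^ 4 * poly (pderiv q) (cos 0)))) {0..pi}"
  proof (rule fundamental_theorem_of_calculus)
    fix \<theta> :: real
    have "((\<lambda>\<theta>. - (sin \<theta> ^ 4 * poly (pderiv q) (cos \<theta>))) has_real_derivative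
       - (4 * sin \<theta> ^ 3 * cos \<theta> * poly (pderiv q) (cos \<theta>) - sin \<theta> ^ 5 * poly (pderiv (pderiv q)) (cos \<theta>))) (at \<theta> within {0..pi})"
      by (auto intro!: derivative_eq_intros poly_DERIV[THEN DERIV_chain2] simp: numeral_eq_Suc algebra_simps)
    moreover have "- (4 * sin \<theta> ^ 3 * cos \<theta> * poly (pderiv q) (cos \<theta>) - sin \<theta> ^ 5 * poly (pderiv (pderiv q)) (cos \<theta>))
       = poly (gegenbauer_op 4 q) (cos \<theta>) * sin \<theta> ^ 3"
    proof -
      have s5: "sin \<theta> ^ 5 = sin \<theta> ^ 3 * (1 - cos \<theta> ^ 2)"
        unfolding sin_squared_eq[symmetric] by (simp flip: power_add)
      show ?thesis unfolding s5
        by (simp add: gegenbauer_op_def algebra_simps power2_eq_square)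
    qed
    ultimately show "((\<lambda>\<theta>. - (sin \<theta> ^ 4 * poly (pderiv q) (cos \<theta>))) has_vector_derivative
        poly (gegenbauer_op 4 q) (cos \<theta>) * sin \<theta> ^ 3) (at \<theta> within {0..pi})"
      by (simp add: has_real_derivative_iff_has_vector_derivative)
  qed simp
  then show ?thesis by (simp add: zonal_integral_def integral_unique)
qed

lemma zonal_integral_1: "zonal_integral [:1:] > 0"
proof -
  have "((\<lambda>\<theta>. poly [:1:] (cos \<theta>) * sin \<theta> ^ 3) has_integral
      ((cos pi ^ 3 / 3 - cos pi) - (cos 0 ^ 3 / 3 - cos 0))) {0..pi}"
  proof (rule fundamental_theorem_of_calculus)
    fix \<theta> :: real
    have "sin \<theta> ^ 3 = sin \<theta> * (1 - cos \<theta> ^ 2)"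
      using sin_squared_eq[of \<theta>] by (simp add: power3_eq_cube power2_eq_square)
    then show "((\<lambda>\<theta>. cos \<theta> ^ 3 / 3 - cos \<theta>) has_vector_derivative
        poly [:1:] (cos \<theta>) * sin \<theta> ^ 3) (at \<theta> within {0..pi})"
      unfolding has_real_derivative_iff_has_vector_derivative[symmetric]
      by (auto intro!: derivative_eq_intros simp: algebra_simps power2_eq_square)
  qed simp
  then show ?thesis by (simp add: zonal_integral_def integral_unique)
qed

lemma zonal_integral_gegenbauer: "n > 0 \<Longrightarrow> zonal_integral (gegenbauer n) = 0"
  using zonal_integral_gegenbauer_op[of "gegenbauer n"]
  unfolding gegenbauer_op_gegenbauer zonal_integral_smult by (simp add: gegenbauer_eigenvalue_def)

section \<open>Zonal eigenfunctions\<close>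

lemma zonal_poly_add: "zonal_poly p (q + r) x = zonal_poly p q x + zonal_poly p r x"
  by (simp add: zonal_poly_def)

lemma zonal_poly_smult: "zonal_poly p (smult c q) x = of_real c * zonal_poly p q x"
  by (simp add: zonal_poly_def)

lemma zonal_poly_mult: "zonal_poly p (q * r) x = zonal_poly p q x * zonal_poly p r x"
  by (simp add: zonal_poly_def)

lemma cnj_zonal_poly [simp]: "cnj (zonal_poly p q x) = zonal_poly p q x"
  by (simp add: zonal_poly_def)

lemma continuous_zonal_poly: "continuous_on S (zonal_poly p q)"
  unfolding zonal_poly_def[abs_def] by (intro continuous_intros)

lemma integrable_mult_zonal_poly:
  assumes "continuous_on (sphere 0 1) w"
  shows "integrable sphere_measure (\<lambda>x. w x * zonal_poly p q x)"
  by (intro integrable_sphere continuous_intros continuous_zonal_poly assms)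

lemma laplace_beltrami_zonal_poly_5:
  fixes x p :: "real ^ 5"
  assumes "norm x = 1" "norm p = 1"
  shows "laplace_beltrami (zonal_poly p q) x = zonal_poly p (gegenbauer_op 4 q) x"
  using laplace_beltrami_zonal_poly[OF assms, of q] by simp

lemma integral_laplace_beltrami_zonal:
  fixes p :: "real ^ 5"
  assumes w: "sphere_C2 w" and p: "norm p = 1"
  shows "(LINT x|sphere_measure. laplace_beltrami w x * zonal_poly p q x)
       = (LINT x|sphere_measure. w x * zonal_poly p (gegenbauer_op 4 q) x)"
proof -
  have "(LINT x|sphere_measure. laplace_beltrami w x * zonal_poly p q x)
      = (LINT x|sphere_measure. w x * laplace_beltrami (zonal_poly p q) x)"
    using sphere_green[OF w sphere_C2_zonal_poly] by (simp add: mult.commute)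
  also have "\<dots> = (LINT x|sphere_measure. w x * zonal_poly p (gegenbauer_op 4 q) x)"
    by (rule Bochner_Integration.integral_cong[OF refl]) (simp add: laplace_beltrami_zonal_poly_5 p)
  finally show ?thesis .
qed

lemma eigenspace_orthogonal_gegenbauer:
  fixes p :: "real ^ 5"
  assumes w: "w \<in> eigenspace \<mu>" and p: "norm p = 1" and m: "\<mu> \<noteq> gegenbauer_eigenvalue m"
  shows "(LINT x|sphere_measure. w x * zonal_poly p (gegenbauer m) x) = 0"
proof -
  let ?I = "LINT x|sphere_measure. w x * zonal_poly p (gegenbauer m) x"
  have "(LINT x|sphere_measure. laplace_beltrami w x * zonal_poly p (gegenbauer m) x)
      = (LINT x|sphere_measure. - of_real \<mu> * (w x * zonal_poly p (gegenbauer m) x))"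
    by (rule Bochner_Integration.integral_cong[OF refl]) (simp add: eigenspace_laplace[OF w])
  moreover have "(LINT x|sphere_measure. w x * (of_real (- gegenbauer_eigenvalue m) * zonal_poly p (gegenbauer m) x))
      = of_real (- gegenbauer_eigenvalue m) * ?I"
    unfolding mult.left_commute[of "w _"] by simp
  ultimately have "of_real (- gegenbauer_eigenvalue m) * ?I = - of_real \<mu> * ?I"
    using integral_laplace_beltrami_zonal[OF eigenspace_C2[OF w] p, of "gegenbauer m"]
    unfolding gegenbauer_op_gegenbauer zonal_poly_smult by auto
  then show ?thesis using m by auto
qed

lemma integral_zonal_gegenbauer:
  fixes p :: "real ^ 5"
  assumes p: "norm p = 1" and mn: "m \<noteq> n"
  shows "(LINT x|sphere_measure. zonal_poly p (gegenbauer m) x * zonal_poly p (gegenbauer n) x) = 0"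
proof -
  let ?I = "LINT x|sphere_measure. zonal_poly p (gegenbauer m) x * zonal_poly p (gegenbauer n) x"
  have "(LINT x|sphere_measure. laplace_beltrami (zonal_poly p (gegenbauer m)) x * zonal_poly p (gegenbauer n) x)
      = (LINT x|sphere_measure. - of_real (gegenbauer_eigenvalue m) * (zonal_poly p (gegenbauer m) x * zonal_poly p (gegenbauer n) x))"
    by (rule Bochner_Integration.integral_cong[OF refl])
       (simp add: laplace_beltrami_zonal_poly_5 p gegenbauer_op_gegenbauer zonal_poly_smult[of _ "- gegenbauer_eigenvalue m", simplified])
  then have "- of_real (gegenbauer_eigenvalue m) * ?I = - of_real (gegenbauer_eigenvalue n) * ?I"
    using integral_laplace_beltrami_zonal[OF sphere_C2_zonal_poly p, of p "gegenbauer m" "gegenbauer n"]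
    unfolding gegenbauer_op_gegenbauer zonal_poly_smult
    by (auto simp: mult.left_commute)
  then show ?thesis using mn gegenbauer_eigenvalue_inj[of n m] by auto
qed

text \<open>The ratio between integration over the 4-sphere and \<open>zonal_integral\<close>, fixed
  by the constant function 1; it is the area of the unit 3-sphere.\<close>

definition sphere_factor :: real where
  "sphere_factor = measure (sphere_measure :: (real ^ 5) measure) (sphere 0 1) / zonal_integral [:1:]"

text \<open>Stands in for polar coordinates. Both sides are linear in q and agree on the constant by
  the choice of factor; for n > 0 the left side vanishes by orthogonality of Z_n to Z_0, the right
  side by the divergence form.\<close>

lemma integral_zonal_poly:
  fixes p :: "real ^ 5"
  assumes p: "norm p = 1"
  shows "(LINT x|sphere_measure. zonal_poly p q x) = of_real (sphere_factor * zonal_integral q)"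
proof -
  define \<Phi> where "\<Phi> q = (LINT x|sphere_measure. zonal_poly p q x) - of_real (sphere_factor * zonal_integral q)" for q
  have int: "integrable sphere_measure (zonal_poly p q)" for q
    by (intro integrable_sphere continuous_zonal_poly)
  have "\<Phi> q = 0"
  proof (rule gegenbauer_span_all)
    show "\<Phi> (q + r) = \<Phi> q + \<Phi> r" for q r
      using int by (simp add: \<Phi>_def zonal_poly_add[abs_def] zonal_integral_add algebra_simps)
    show "\<Phi> (smult c q) = c *\<^sub>R \<Phi> q" for c q
      using int by (simp add: \<Phi>_def zonal_poly_smult[abs_def] zonal_integral_smult scaleR_conv_of_real algebra_simps)
    show "\<Phi> (gegenbauer n) = 0" for n
    proof (cases "n = 0")
      case True
      have "zonal_poly p [:1:] = (\<lambda>x. 1)" by (simp add: zonal_poly_def fun_eq_iff)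
      then show ?thesis using True zonal_integral_1
        by (simp add: \<Phi>_def gegenbauer_0 sphere_factor_def scaleR_conv_of_real)
    next
      case False
      have "(LINT x|sphere_measure. zonal_poly p (gegenbauer n) x * zonal_poly p (gegenbauer 0) x) = 0"
        by (rule integral_zonal_gegenbauer[OF p False])
      then show ?thesis using False zonal_integral_gegenbauer[of n]
        by (simp add: \<Phi>_def gegenbauer_0 zonal_poly_def)
    qed
  qed
  then show ?thesis by (simp add: \<Phi>_def)
qed

lemma sphere_factor_pos: "sphere_factor > 0"
proof -
  have fm: "finite_measure (sphere_measure :: (real ^ 5) measure)" by (rule finite_sphere_measure)
  have "axis 1 1 \<in> sphere (0 :: real ^ 5) 1" by simp
  then have "UNIV \<inter> sphere (0 :: real ^ 5) 1 \<noteq> {}" by blast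
  then have "emeasure sphere_measure (UNIV \<inter> sphere (0 :: real ^ 5) 1) \<noteq> 0"
    by (rule sphere_measure_open_pos[OF open_UNIV])
  then have "measure sphere_measure (sphere (0 :: real ^ 5) 1) > 0"
    using finite_measure.emeasure_eq_measure[OF fm] by (simp add: zero_less_measure_iff)
  then show ?thesis using zonal_integral_1 by (simp add: sphere_factor_def)
qed

lemma poly_approx_on_interval:
  fixes f :: "real \<Rightarrow> real"
  assumes "continuous_on {a..b} f" "e > 0"
  obtains q :: "real poly" where "\<And>s. s \<in> {a..b} \<Longrightarrow> \<bar>f s - poly q s\<bar> < e"
proof -
  obtain g where g: "real_polynomial_function g" "\<And>x. x \<in> {a..b} \<Longrightarrow> \<bar>f x - g x\<bar> < e"
    using Stone_Weierstrass_real_polynomial_function[OF _ assms] by auto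
  obtain c n where gc: "g = (\<lambda>x. \<Sum>i\<le>n. c i * x ^ i)"
    using g(1) real_polynomial_function_iff_sum by blast
  have "poly (\<Sum>i\<le>n. monom (c i) i) x = g x" for x
    by (simp add: gc poly_sum poly_monom)
  then show thesis using g(2) that[of "\<Sum>i\<le>n. monom (c i) i"] by simp
qed

text \<open>Follow a meridian: the curve \<open>g\<close> meets the level x . p = s in exactly the
  point g s, so composing w with it gives a continuous profile.\<close>

lemma zonal_profile:
  fixes p :: "real ^ 5" and w :: "real ^ 5 \<Rightarrow> complex"
  assumes p: "norm p = 1" and c: "continuous_on (sphere 0 1) w"
    and z: "\<And>x y. norm x = 1 \<Longrightarrow> norm y = 1 \<Longrightarrow> x \<bullet> p = y \<bullet> p \<Longrightarrow> w x = w y"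
  obtains W where "continuous_on {-1..1} W" "\<And>x. norm x = 1 \<Longrightarrow> w x = W (x \<bullet> p)"
proof -
  obtain e' where e': "e' \<noteq> 0" "orthogonal p e'"
    using orthogonal_to_vector_exists[of p] by auto
  define e where "e = e' /\<^sub>R norm e'"
  have e: "norm e = 1" "p \<bullet> e = 0" using e' by (simp_all add: e_def orthogonal_def)
  define g where "g s = s *\<^sub>R p + sqrt (1 - s\<^sup>2) *\<^sub>R e" for s
  have n: "norm (g s) = 1" and i: "g s \<bullet> p = s" if "s \<in> {-1..1}" for s
  proof -
    have s: "s\<^sup>2 \<le> 1" using that by (simp add: abs_square_le_1 abs_le_iff)
    have "p \<bullet> p = 1" "e \<bullet> e = 1" "e \<bullet> p = 0" using p e by (simp_all add: dot_square_norm inner_commute)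
    then have "g s \<bullet> g s = 1" "g s \<bullet> p = s"
      using e(2) s by (simp_all add: g_def inner_simps power2_eq_square[symmetric])
    then show "norm (g s) = 1" "g s \<bullet> p = s" by (simp_all add: norm_eq_1)
  qed
  have "continuous_on {-1..1} g" unfolding g_def by (intro continuous_intros)
  then have "continuous_on {-1..1} (\<lambda>s. w (g s))"
    by (rule continuous_on_compose2[OF c]) (use n in auto)
  moreover have "w x = w (g (x \<bullet> p))" if x: "norm x = 1" for x
  proof -
    have "\<bar>x \<bullet> p\<bar> \<le> 1" using Cauchy_Schwarz_ineq2[of x p] x p by simp
    then have "x \<bullet> p \<in> {-1..1}" by auto
    from z[OF x n[OF this]] i[OF this] show ?thesis by simp
  qed
  ultimately show thesis using that by blast
qed

text \<open>Completeness of the Z_m among continuous zonal functions. By Weierstrass approximation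
  of the profile, cnj w is uniformly close to a polynomial in x . p, to which w is orthogonal; hence
  the integral of |w|^2 is arbitrarily small.\<close>

lemma zonal_orthogonal_imp_0:
  fixes p :: "real ^ 5"
  assumes p: "norm p = 1" and c: "continuous_on (sphere 0 1) w"
    and z: "\<And>x y. norm x = 1 \<Longrightarrow> norm y = 1 \<Longrightarrow> x \<bullet> p = y \<bullet> p \<Longrightarrow> w x = w y"
    and o: "\<And>m. (LINT x|sphere_measure. w x * zonal_poly p (gegenbauer m) x) = 0"
    and x: "norm x = 1"
  shows "w x = 0"
proof -
  obtain W where W: "continuous_on {-1..1} W" "\<And>x. norm x = 1 \<Longrightarrow> w x = W (x \<bullet> p)"
    using zonal_profile[OF p c z] by blast
  have o': "(LINT x|sphere_measure. w x * zonal_poly p q x) = 0" for q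
  proof (rule gegenbauer_span_all[of "\<lambda>q. LINT x|sphere_measure. w x * zonal_poly p q x"])
    show "(LINT x|sphere_measure. w x * zonal_poly p (q + r) x) =
      (LINT x|sphere_measure. w x * zonal_poly p q x) + (LINT x|sphere_measure. w x * zonal_poly p r x)" for q r
      using integrable_mult_zonal_poly[OF c] by (simp add: zonal_poly_add distrib_left)
    show "(LINT x|sphere_measure. w x * zonal_poly p (smult k q) x) =
      k *\<^sub>R (LINT x|sphere_measure. w x * zonal_poly p q x)" for k q
      by (simp add: zonal_poly_smult scaleR_conv_of_real mult.left_commute)
  qed (rule o)
  let ?I = "LINT x|sphere_measure. w x * cnj (w x)"
  have ic: "integrable sphere_measure (\<lambda>x. cmod (w x))" by (intro integrable_sphere continuous_intros c)
  have "norm ?I \<le> e * (2 * (LINT x|sphere_measure. cmod (w x)))" if e: "e > 0" for e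
  proof -
    obtain q1 where q1: "\<And>s. s \<in> {-1..1} \<Longrightarrow> \<bar>Re (W s) - poly q1 s\<bar> < e"
      using poly_approx_on_interval[OF continuous_on_Re[OF W(1)] e] by blast
    obtain q2 where q2: "\<And>s. s \<in> {-1..1} \<Longrightarrow> \<bar>Im (W s) - poly q2 s\<bar> < e"
      using poly_approx_on_interval[OF continuous_on_Im[OF W(1)] e] by blast
    \<comment> \<open>The error in approximating cnj w by q1 - i q2; its real and imaginary parts
      are each below \<open>e\<close>, which is the factor 2 in the bound.\<close>
    let ?r = "\<lambda>x. cnj (w x) - zonal_poly p q1 x + \<i> * zonal_poly p q2 x"
    have cr: "continuous_on (sphere 0 1) ?r" by (intro continuous_intros c continuous_zonal_poly)
    have "?I = (LINT x|sphere_measure. w x * ?r x + w x * zonal_poly p q1 x - \<i> * (w x * zonal_poly p q2 x))"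
      by (rule Bochner_Integration.integral_cong[OF refl]) (simp add: algebra_simps)
    also have "\<dots> = (LINT x|sphere_measure. w x * ?r x)
        + (LINT x|sphere_measure. w x * zonal_poly p q1 x) - \<i> * (LINT x|sphere_measure. w x * zonal_poly p q2 x)"
      using integrable_sphere[OF continuous_on_mult[OF c cr]]
        integrable_mult_zonal_poly[OF c, of p q1] integrable_mult_zonal_poly[OF c, of p q2] by simp
    finally have "?I = (LINT x|sphere_measure. w x * ?r x)" by (simp add: o')
    then have "norm ?I = norm (LINT x|sphere_measure. w x * ?r x)" by simp
    also have "\<dots> \<le> (LINT x|sphere_measure. norm (w x * ?r x))" by (rule integral_norm_bound)
    also have "\<dots> \<le> (LINT x|sphere_measure. e * (2 * cmod (w x)))"
    proof (rule integral_mono)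
      show "integrable sphere_measure (\<lambda>x. norm (w x * ?r x))"
        by (intro integrable_norm integrable_sphere[OF continuous_on_mult[OF c cr]])
      show "integrable sphere_measure (\<lambda>x. e * (2 * cmod (w x)))" using ic by simp
      fix x :: "real ^ 5" assume "x \<in> space sphere_measure"
      then have x: "norm x = 1" by simp
      have "\<bar>x \<bullet> p\<bar> \<le> 1" using Cauchy_Schwarz_ineq2[of x p] x p by simp
      then have s: "x \<bullet> p \<in> {-1..1}" by auto
      have "norm (?r x) \<le> \<bar>Re (?r x)\<bar> + \<bar>Im (?r x)\<bar>" by (rule cmod_le)
      also have "\<dots> \<le> e + e"
        using q1[OF s] q2[OF s] W(2)[OF x] by (intro add_mono) (simp_all add: zonal_poly_def abs_minus_commute)
      finally have "cmod (w x) * norm (?r x) \<le> cmod (w x) * (e + e)" by (intro mult_left_mono) auto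
      then have "norm (w x * ?r x) \<le> cmod (w x) * (e + e)" by (simp only: norm_mult)
      also have "\<dots> = e * (2 * cmod (w x))" by simp
      finally show "norm (w x * ?r x) \<le> e * (2 * cmod (w x))" .
    qed
    also have "\<dots> = e * (2 * (LINT x|sphere_measure. cmod (w x)))" by simp
    finally show ?thesis .
  qed
  then have bound: "norm ?I \<le> e * (2 * (LINT x|sphere_measure. cmod (w x)))" if "e > 0" for e
    using that by blast
  have "norm ?I \<le> 0"
  proof (rule field_le_epsilon)
    fix e :: real assume e: "e > 0"
    define K where "K = 2 * (LINT x|sphere_measure. cmod (w x))"
    have K: "K \<ge> 0" by (simp add: K_def)
    then have K1: "K + 1 > 0" by linarith
    have "norm ?I \<le> e / (K + 1) * K"
      unfolding K_def by (rule bound[OF divide_pos_pos[OF e K1[unfolded K_def]]])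
    also have "\<dots> \<le> e" using e K by (simp add: field_simps)
    finally show "norm ?I \<le> 0 + e" by simp
  qed
  then have "?I = 0" by simp
  from sphere_integral_norm2_eq_0[OF c this x] show ?thesis .
qed


text \<open>Strictness is read off on the sphere: zero mass would force
  \<open>zonal_poly p q\<close> to vanish at every point, and along a meridian q would have all of
  [-1, 1] as roots.\<close>

lemma zonal_integral_square_pos:
  assumes "q \<noteq> 0"
  shows "zonal_integral (q * q) > 0"
proof -
  define p :: "real ^ 5" where "p = axis 1 1"
  have p: "norm p = 1" by (simp add: p_def)
  have nn: "zonal_integral (q * q) \<ge> 0"
    unfolding zonal_integral_def
    by (rule integral_nonneg[OF zonal_integrand_integrable]) (simp add: sin_ge_zero)
  moreover have "zonal_integral (q * q) \<noteq> 0"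
  proof
    assume "zonal_integral (q * q) = 0"
    then have "(LINT x|sphere_measure. zonal_poly p q x * cnj (zonal_poly p q x)) = 0"
      using integral_zonal_poly[OF p, of "q * q"] by (simp add: zonal_poly_mult)
    then have 0: "zonal_poly p q x = 0" if "norm x = 1" for x
      using sphere_integral_norm2_eq_0[OF continuous_zonal_poly _ that] by blast
    obtain e' :: "real ^ 5" where e': "e' \<noteq> 0" "orthogonal p e'"
      using orthogonal_to_vector_exists[of p] by auto
    define e where "e = e' /\<^sub>R norm e'"
    have e: "norm e = 1" "p \<bullet> e = 0" using e' by (simp_all add: e_def orthogonal_def)
    have pe: "p \<bullet> p = 1" "e \<bullet> e = 1" "e \<bullet> p = 0" using p e by (simp_all add: dot_square_norm inner_commute)
    have "poly q s = 0" if "s \<in> {-1..1}" for s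
    proof -
      let ?g = "s *\<^sub>R p + sqrt (1 - s\<^sup>2) *\<^sub>R e"
      have s: "s\<^sup>2 \<le> 1" using that by (simp add: abs_square_le_1 abs_le_iff)
      have "?g \<bullet> ?g = 1" "?g \<bullet> p = s"
        using e(2) pe s by (simp_all add: inner_simps power2_eq_square[symmetric])
      then show ?thesis using 0[of ?g] by (simp add: norm_eq_1 zonal_poly_def)
    qed
    then have "{-1..1} \<subseteq> {s. poly q s = 0}" by auto
    then have "finite {-1..1::real}" using poly_roots_finite[OF assms] finite_subset by blast
    then show False by (simp add: infinite_Icc)
  qed
  ultimately show ?thesis by simp
qed

section \<open>Orthonormal zonal harmonics and zonal eigenfunctions\<close>

definition gegenbauer_norm2 :: "nat \<Rightarrow> real" where
  "gegenbauer_norm2 n = sphere_factor * zonal_integral (gegenbauer n * gegenbauer n)"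

lemma gegenbauer_norm2_pos: "gegenbauer_norm2 n > 0"
  unfolding gegenbauer_norm2_def
  using sphere_factor_pos zonal_integral_square_pos[OF gegenbauer_nz] by simp

lemma integral_zonal_gegenbauer_square:
  fixes p :: "real ^ 5"
  assumes "norm p = 1"
  shows "(LINT x|sphere_measure. zonal_poly p (gegenbauer n) x * zonal_poly p (gegenbauer n) x) = of_real (gegenbauer_norm2 n)"
  using integral_zonal_poly[OF assms, of "gegenbauer n * gegenbauer n"]
  by (simp add: gegenbauer_norm2_def zonal_poly_mult)

definition normalized_gegenbauer :: "nat \<Rightarrow> real poly" where
  "normalized_gegenbauer n = smult (1 / sqrt (gegenbauer_norm2 n)) (gegenbauer n)"

lemma integral_zonal_normalized:
  fixes p :: "real ^ 5"
  assumes p: "norm p = 1"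
  shows "(LINT x|sphere_measure. zonal_poly p (normalized_gegenbauer m) x * zonal_poly p (normalized_gegenbauer n) x)
     = (if m = n then 1 else 0)"
proof -
  have "(LINT x|sphere_measure. zonal_poly p (normalized_gegenbauer m) x * zonal_poly p (normalized_gegenbauer n) x)
    = (LINT x|sphere_measure. of_real (1 / (sqrt (gegenbauer_norm2 m) * sqrt (gegenbauer_norm2 n))) *
        (zonal_poly p (gegenbauer m) x * zonal_poly p (gegenbauer n) x))"
    by (rule Bochner_Integration.integral_cong[OF refl])
       (simp add: normalized_gegenbauer_def zonal_poly_smult)
  also have "\<dots> = of_real (1 / (sqrt (gegenbauer_norm2 m) * sqrt (gegenbauer_norm2 n))) *
     (LINT x|sphere_measure. zonal_poly p (gegenbauer m) x * zonal_poly p (gegenbauer n) x)" by simp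
  also have "\<dots> = (if m = n then 1 else 0)"
  proof (cases "m = n")
    case True
    have "1 / (sqrt (gegenbauer_norm2 n) * sqrt (gegenbauer_norm2 n)) * gegenbauer_norm2 n = 1"
      using gegenbauer_norm2_pos[of n] by simp
    from arg_cong[OF this, of complex_of_real] show ?thesis
      using True by (simp only: integral_zonal_gegenbauer_square[OF p] of_real_mult if_True of_real_1 simp_thms)
  qed (simp add: integral_zonal_gegenbauer[OF p])
  finally show ?thesis .
qed

text \<open>Such an eigenfunction is orthogonal to every Z_n, hence zero by completeness. In this
  way sums over all real \<mu> reduce to sums over n, without determining the full spectrum of the
  sphere.\<close>

lemma zonal_eigenfunction_eigenvalue:
  fixes p :: "real ^ 5"
  assumes p: "norm p = 1" and w: "w \<in> eigenspace \<mu>"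
    and z: "\<And>x y. norm x = 1 \<Longrightarrow> norm y = 1 \<Longrightarrow> x \<bullet> p = y \<bullet> p \<Longrightarrow> w x = w y"
    and \<mu>: "\<And>n. \<mu> \<noteq> gegenbauer_eigenvalue n" and x: "norm x = 1"
  shows "w x = 0"
  using eigenspace_orthogonal_gegenbauer[OF w p \<mu>] zonal_orthogonal_imp_0[OF p eigenspace_continuous[OF w] z _ x]
  by blast

lemma zonal_eigenfunction:
  fixes p :: "real ^ 5"
  assumes p: "norm p = 1" and w: "w \<in> eigenspace (gegenbauer_eigenvalue n)"
    and z: "\<And>x y. norm x = 1 \<Longrightarrow> norm y = 1 \<Longrightarrow> x \<bullet> p = y \<bullet> p \<Longrightarrow> w x = w y"
  obtains c where "\<And>x. norm x = 1 \<Longrightarrow> w x = c * zonal_poly p (normalized_gegenbauer n) x"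
proof -
  let ?P = "zonal_poly p (gegenbauer n)"
  have cw: "continuous_on (sphere 0 1) w" by (rule eigenspace_continuous[OF w])
  define c where "c = (LINT x|sphere_measure. w x * ?P x) / of_real (gegenbauer_norm2 n)"
  let ?v = "\<lambda>x. w x - c * ?P x"
  have cv: "continuous_on (sphere 0 1) ?v" by (intro continuous_intros cw continuous_zonal_poly)
  have "(LINT x|sphere_measure. ?v x * zonal_poly p (gegenbauer m) x) = 0" for m
  proof -
    have "(LINT x|sphere_measure. ?v x * zonal_poly p (gegenbauer m) x)
       = (LINT x|sphere_measure. w x * zonal_poly p (gegenbauer m) x - c * (?P x * zonal_poly p (gegenbauer m) x))"
      by (rule Bochner_Integration.integral_cong[OF refl]) (simp add: algebra_simps)
    also have "\<dots> = (LINT x|sphere_measure. w x * zonal_poly p (gegenbauer m) x)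
        - c * (LINT x|sphere_measure. ?P x * zonal_poly p (gegenbauer m) x)"
      using integrable_mult_zonal_poly[OF cw, of p "gegenbauer m"]
        integrable_mult_zonal_poly[OF continuous_zonal_poly, of p "gegenbauer n" p "gegenbauer m"] by simp
    also have "\<dots> = 0"
    proof (cases "m = n")
      case True
      then show ?thesis
        using gegenbauer_norm2_pos[of n] integral_zonal_gegenbauer_square[OF p, of n] by (simp add: c_def)
    next
      case False
      then show ?thesis
        using integral_zonal_gegenbauer[OF p, of n m] eigenspace_orthogonal_gegenbauer[OF w p, of m]
          gegenbauer_eigenvalue_inj[of n m] by simp
    qed
    finally show ?thesis .
  qed
  moreover have "?v x = ?v y" if "norm x = 1" "norm y = 1" "x \<bullet> p = y \<bullet> p" for x y
    using z[OF that] that(3) by (simp add: zonal_poly_def)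
  ultimately have v0: "?v x = 0" if "norm x = 1" for x
    using zonal_orthogonal_imp_0[OF p cv _ _ that] by blast
  show thesis
  proof (rule that)
    fix x :: "real ^ 5" assume "norm x = 1"
    from v0[OF this] show "w x = (c * of_real (sqrt (gegenbauer_norm2 n))) * zonal_poly p (normalized_gegenbauer n) x"
      using gegenbauer_norm2_pos[of n]
      by (simp add: normalized_gegenbauer_def zonal_poly_smult)
  qed
qed

section \<open>Expansion of the zonal flow\<close>

abbreviation zonal_harmonic :: "real ^ 5 \<Rightarrow> nat \<Rightarrow> real ^ 5 \<Rightarrow> complex" where
  "zonal_harmonic p n \<equiv> zonal_poly p (normalized_gegenbauer n)"

text \<open>As soon as \<Lambda> contains the eigenvalues of A, the partial sums coincide on the
  sphere with the finite sum \<open>?S\<close>. The norms along the net are then constant, and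
  convergence to 0 means that this constant is 0.\<close>

lemma spectral_multiplier_zonal:
  fixes p :: "real ^ 5"
  assumes p: "norm p = 1" and f: "f \<in> sphere_L2" and z: "zonal p f" and h: "h \<in> sphere_L2"
    and w: "\<And>\<mu>. is_eigenprojection \<mu> f (w \<mu>)"
    and lim: "((\<lambda>\<Lambda>. L2norm (\<lambda>x. h x - (\<Sum>\<mu>\<in>\<Lambda>. g \<mu> * w \<mu> x))) \<longlongrightarrow> 0) (finite_subsets_at_top UNIV)"
    and c: "\<And>n x. norm x = 1 \<Longrightarrow> w (gegenbauer_eigenvalue n) x = c n * zonal_harmonic p n x"
    and A: "finite A" "\<And>n. n \<notin> A \<Longrightarrow> g (gegenbauer_eigenvalue n) * c n = 0"
  shows "AE x in sphere_measure. h x = (\<Sum>n\<in>A. g (gegenbauer_eigenvalue n) * c n * zonal_harmonic p n x)"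
proof -
  let ?S = "\<lambda>x. \<Sum>n\<in>A. g (gegenbauer_eigenvalue n) * c n * zonal_harmonic p n x"
  let ?\<Lambda> = "gegenbauer_eigenvalue ` A"
  have inj: "inj_on gegenbauer_eigenvalue A"
    using gegenbauer_eigenvalue_inj by (auto simp: inj_on_def)
  have sum_eq: "(\<Sum>\<mu>\<in>\<Lambda>. g \<mu> * w \<mu> x) = ?S x" if L: "finite \<Lambda>" "?\<Lambda> \<subseteq> \<Lambda>" and x: "norm x = 1" for \<Lambda> x
  proof -
    have "(\<Sum>\<mu>\<in>\<Lambda>. g \<mu> * w \<mu> x) = (\<Sum>\<mu>\<in>?\<Lambda>. g \<mu> * w \<mu> x)"
    proof (rule sum.mono_neutral_right[OF L])
      show "\<forall>\<mu>\<in>\<Lambda> - ?\<Lambda>. g \<mu> * w \<mu> x = 0"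
      proof
        fix \<mu> assume "\<mu> \<in> \<Lambda> - ?\<Lambda>"
        show "g \<mu> * w \<mu> x = 0"
        proof (cases "\<exists>n. \<mu> = gegenbauer_eigenvalue n")
          case True
          then obtain n where n: "\<mu> = gegenbauer_eigenvalue n" by blast
          then have "n \<notin> A" using \<open>\<mu> \<in> \<Lambda> - ?\<Lambda>\<close> by auto
          from A(2)[OF this] have "g \<mu> * (c n * zonal_harmonic p n x) = 0" unfolding n by auto
          then show ?thesis unfolding n c[OF x] .
        next
          case False
          have we: "w \<mu> \<in> eigenspace \<mu>" using w[of \<mu>] by (simp add: is_eigenprojection_def)
          have nm: "\<mu> \<noteq> gegenbauer_eigenvalue n" for n using False by blast
          have "w \<mu> x = 0"
            by (rule zonal_eigenfunction_eigenvalue[OF p we _ nm x]) (rule eigenprojection_zonal[OF f z w])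
          then show ?thesis by simp
        qed
      qed
    qed
    also have "\<dots> = (\<Sum>n\<in>A. g (gegenbauer_eigenvalue n) * w (gegenbauer_eigenvalue n) x)"
      by (simp add: sum.reindex[OF inj])
    also have "\<dots> = ?S x" by (simp add: c[OF x] mult.assoc)
    finally show ?thesis .
  qed
  have "L2norm (\<lambda>x. h x - (\<Sum>\<mu>\<in>\<Lambda>. g \<mu> * w \<mu> x)) = L2norm (\<lambda>x. h x - ?S x)"
    if "finite \<Lambda>" "?\<Lambda> \<subseteq> \<Lambda>" for \<Lambda>
    unfolding L2norm_def by (intro arg_cong[where f = sqrt] Bochner_Integration.integral_cong refl)
      (simp add: sum_eq[OF that])
  then have "\<forall>\<^sub>F \<Lambda> in finite_subsets_at_top UNIV.
      L2norm (\<lambda>x. h x - (\<Sum>\<mu>\<in>\<Lambda>. g \<mu> * w \<mu> x)) = L2norm (\<lambda>x. h x - ?S x)"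
    unfolding eventually_finite_subsets_at_top
    using A(1) by (intro exI[of _ ?\<Lambda>]) simp
  from iffD1[OF tendsto_cong[OF this] lim] have "L2norm (\<lambda>x. h x - ?S x) = 0"
    by (simp add: tendsto_const_iff)
  then have 0: "(LINT x|sphere_measure. (cmod (h x - ?S x))\<^sup>2) = 0" by (simp add: L2norm_def)
  have cS: "continuous_on (sphere 0 1) ?S" by (intro continuous_intros continuous_zonal_poly)
  \<comment> \<open>The integral of a non-integrable function is 0 by default, so integrability has
    to be secured before \<open>0\<close> says anything about \<open>h\<close>.\<close>
  have "integrable sphere_measure (\<lambda>x. 2 * (cmod (h x))\<^sup>2 + 2 * (cmod (?S x))\<^sup>2)"
    using h continuous_sphere_L2[OF cS] by (auto simp: sphere_L2_def)
  then have int: "integrable sphere_measure (\<lambda>x. (cmod (h x - ?S x))\<^sup>2)"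
  proof (rule Bochner_Integration.integrable_bound)
    show "(\<lambda>x. (cmod (h x - ?S x))\<^sup>2) \<in> borel_measurable sphere_measure"
      using h borel_measurable_sphere[OF cS] by (auto simp: sphere_L2_def)
    show "AE x in sphere_measure. norm ((cmod (h x - ?S x))\<^sup>2) \<le> norm (2 * (cmod (h x))\<^sup>2 + 2 * (cmod (?S x))\<^sup>2)"
    proof (rule AE_I2)
      fix x
      have "(cmod (h x - ?S x))\<^sup>2 \<le> (cmod (h x) + cmod (?S x))\<^sup>2"
        by (intro power_mono norm_triangle_ineq4) auto
      also have "\<dots> \<le> 2 * (cmod (h x))\<^sup>2 + 2 * (cmod (?S x))\<^sup>2"
        using zero_le_power2[of "cmod (h x) - cmod (?S x)"]
        unfolding power2_sum power2_diff by linarith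
      finally show "norm ((cmod (h x - ?S x))\<^sup>2) \<le> norm (2 * (cmod (h x))\<^sup>2 + 2 * (cmod (?S x))\<^sup>2)" by simp
    qed
  qed
  have "AE x in sphere_measure. (cmod (h x - ?S x))\<^sup>2 = 0"
    using integral_nonneg_eq_0_iff_AE[OF int] 0 by simp
  then show ?thesis by eventually_elim simp
qed

definition spectral_window :: "nat \<Rightarrow> nat set" where
  "spectral_window N = {n. sqrt (1 + gegenbauer_eigenvalue n) \<in> {real N..2 * real N}}"

lemma spectral_window_le: "n \<in> spectral_window N \<Longrightarrow> n \<le> 2 * N"
proof -
  assume "n \<in> spectral_window N"
  then have "sqrt (1 + gegenbauer_eigenvalue n) \<le> 2 * real N" by (simp add: spectral_window_def)
  moreover have "real n \<le> sqrt (1 + gegenbauer_eigenvalue n)"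
    by (rule real_le_rsqrt) (simp add: gegenbauer_eigenvalue_def power2_eq_square algebra_simps)
  ultimately show "n \<le> 2 * N" by linarith
qed

lemma finite_spectral_window: "finite (spectral_window N)"
  by (rule finite_subset[of _ "{..2 * N}"]) (auto dest: spectral_window_le)

lemma integral_zonal_sum:
  fixes p :: "real ^ 5"
  assumes p: "norm p = 1" and A: "finite A" "finite B"
  shows "(LINT x|sphere_measure. (\<Sum>n\<in>A. c n * zonal_harmonic p n x) * (\<Sum>n\<in>B. d n * zonal_harmonic p n x)) = (\<Sum>n\<in>A \<inter> B. c n * d n)"
proof -
  have i: "integrable sphere_measure (\<lambda>x. zonal_harmonic p m x * zonal_harmonic p n x)" for m n
    by (rule integrable_mult_zonal_poly[OF continuous_zonal_poly])
  have "(LINT x|sphere_measure. (\<Sum>n\<in>A. c n * zonal_harmonic p n x) * (\<Sum>n\<in>B. d n * zonal_harmonic p n x))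
     = (LINT x|sphere_measure. (\<Sum>m\<in>A. \<Sum>n\<in>B. (c m * d n) * (zonal_harmonic p m x * zonal_harmonic p n x)))"
    by (rule Bochner_Integration.integral_cong[OF refl]) (simp add: sum_product algebra_simps)
  also have "\<dots> = (\<Sum>m\<in>A. \<Sum>n\<in>B. (c m * d n) * (if m = n then 1 else 0))"
  proof -
    have "(LINT x|sphere_measure. (c m * d n) * (zonal_harmonic p m x * zonal_harmonic p n x)) = (c m * d n) * (if m = n then 1 else 0)" for m n
      using integral_zonal_normalized[OF p, of m n] by simp
    moreover have "integrable sphere_measure (\<lambda>x. (c m * d n) * (zonal_harmonic p m x * zonal_harmonic p n x))" for m n
      using i by (rule integrable_mult_right)
    ultimately show ?thesis
      by (simp only: Bochner_Integration.integral_sum Bochner_Integration.integrable_sum)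
  qed
  also have "\<dots> = (\<Sum>m\<in>A. if m \<in> B then c m * d m else 0)"
  proof (rule sum.cong[OF refl])
    fix m
    have "(\<Sum>n\<in>B. c m * d n * (if m = n then 1 else 0)) = (\<Sum>n\<in>B. if m = n then c m * d n else 0)"
      by (rule sum.cong) auto
    then show "(\<Sum>n\<in>B. c m * d n * (if m = n then 1 else 0)) = (if m \<in> B then c m * d m else 0)"
      using A(2) by simp
  qed
  also have "\<dots> = (\<Sum>n\<in>A \<inter> B. c n * d n)"
    using A(1) by (simp add: sum.inter_restrict)
  finally show ?thesis .
qed

text \<open>The projector hypothesis supplies eigenprojections of f, hence the coefficients c. Each
  flow relation comes with its own choice of eigenprojections; uniqueness identifies them on the
  sphere with the first, so that one c serves all times.\<close>

lemma zonal_flow_expansion: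
  fixes p :: "real ^ 5"
  assumes p: "norm p = 1" and z: "zonal p f"
    and proj: "spectral_projector {real N..2 * real N} f f"
    and flow: "\<And>t. schroedinger_flow t f (u t)"
  obtains c where
    "\<And>t. AE x in sphere_measure. u t x =
        (\<Sum>n\<in>spectral_window N. exp (- \<i> * of_real (t * gegenbauer_eigenvalue n)) * c n * zonal_harmonic p n x)"
    "(L2norm f)\<^sup>2 = (\<Sum>n\<in>spectral_window N. (cmod (c n))\<^sup>2)"
proof -
  let ?A = "spectral_window N"
  let ?g = "\<lambda>\<mu>. if sqrt (1 + \<mu>) \<in> {real N..2 * real N} then 1 else (0::complex)"
  have f: "f \<in> sphere_L2" using proj by (simp add: spectral_projector_def spectral_multiplier_def)
  obtain w where w: "\<And>\<mu>. is_eigenprojection \<mu> f (w \<mu>)"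
    and lim: "((\<lambda>\<Lambda>. L2norm (\<lambda>x. f x - (\<Sum>\<mu>\<in>\<Lambda>. ?g \<mu> * w \<mu> x))) \<longlongrightarrow> 0) (finite_subsets_at_top UNIV)"
    using proj unfolding spectral_projector_def spectral_multiplier_def by blast
  have we: "w \<mu> \<in> eigenspace \<mu>" for \<mu> using w[of \<mu>] by (simp add: is_eigenprojection_def)
  have "\<exists>c. \<forall>x. norm x = 1 \<longrightarrow> w (gegenbauer_eigenvalue n) x = c * zonal_harmonic p n x" for n
    by (rule zonal_eigenfunction[OF p we[of "gegenbauer_eigenvalue n"]])
       (rule eigenprojection_zonal[OF f z w], assumption+, rule exI, rule allI, rule impI, assumption)
  then have "\<forall>n. \<exists>c. \<forall>x. norm x = 1 \<longrightarrow> w (gegenbauer_eigenvalue n) x = c * zonal_harmonic p n x" by blast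
  from choice[OF this] obtain c where c: "\<And>n x. norm x = 1 \<Longrightarrow> w (gegenbauer_eigenvalue n) x = c n * zonal_harmonic p n x" by blast
  have fA: "finite ?A" by (rule finite_spectral_window)
  have "AE x in sphere_measure. f x = (\<Sum>n\<in>?A. ?g (gegenbauer_eigenvalue n) * c n * zonal_harmonic p n x)"
    by (rule spectral_multiplier_zonal[OF p f z f w lim c fA]) (auto simp: spectral_window_def)
  moreover have "(\<Sum>n\<in>?A. ?g (gegenbauer_eigenvalue n) * c n * zonal_harmonic p n x) = (\<Sum>n\<in>?A. c n * zonal_harmonic p n x)" for x
    by (rule sum.cong) (simp_all add: spectral_window_def)
  ultimately have fS: "AE x in sphere_measure. f x = (\<Sum>n\<in>?A. c n * zonal_harmonic p n x)" by simp
  let ?S = "\<lambda>x. \<Sum>n\<in>?A. c n * zonal_harmonic p n x"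
  have mf: "f \<in> borel_measurable sphere_measure" using f by (simp add: sphere_L2_def)
  have cS: "continuous_on (sphere 0 1) ?S" by (intro continuous_intros continuous_zonal_poly)
  have mS: "?S \<in> borel_measurable sphere_measure" by (rule borel_measurable_sphere[OF cS])
  \<comment> \<open>The flow multiplier, unlike the projector, does not cut off, so c itself must
    vanish outside the window. Its square modulus is the inner product of f with its own projection,
    and f is almost everywhere a sum over the window, orthogonal to Z_n.\<close>
  have c0: "c n = 0" if n: "n \<notin> ?A" for n
  proof -
    let ?w = "w (gegenbauer_eigenvalue n)"
    have cw: "continuous_on (sphere 0 1) (\<lambda>x. cnj (?w x))"
      by (intro continuous_intros eigenspace_continuous[OF we])
    have "of_real ((cmod (c n))\<^sup>2) = (LINT x|sphere_measure. (\<Sum>k\<in>{n}. c k * zonal_harmonic p k x) * (\<Sum>k\<in>{n}. cnj (c k) * zonal_harmonic p k x))"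
      unfolding integral_zonal_sum[OF p finite.insertI[OF finite.emptyI] finite.insertI[OF finite.emptyI]]
      by (simp add: complex_norm_square del: of_real_power)
    also have "\<dots> = (LINT x|sphere_measure. ?w x * cnj (?w x))"
      by (rule Bochner_Integration.integral_cong[OF refl]) (simp add: c)
    also have "\<dots> = (LINT x|sphere_measure. f x * cnj (?w x))"
      using eigenprojection_inner[OF f w we] by simp
    also have "\<dots> = (LINT x|sphere_measure. ?S x * cnj (?w x))"
      by (rule integral_cong_AE[OF borel_measurable_times[OF mf borel_measurable_sphere[OF cw]]
            borel_measurable_times[OF mS borel_measurable_sphere[OF cw]]])
         (rule eventually_mono[OF fS], simp)
    also have "\<dots> = (LINT x|sphere_measure. ?S x * (\<Sum>k\<in>{n}. cnj (c k) * zonal_harmonic p k x))"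
      by (rule Bochner_Integration.integral_cong[OF refl]) (simp add: c)
    also have "\<dots> = 0" unfolding integral_zonal_sum[OF p fA finite.insertI[OF finite.emptyI]] using n by simp
    finally show ?thesis by simp
  qed
  show thesis
  proof (rule that)
    fix t
    let ?e = "\<lambda>\<mu>. exp (- \<i> * of_real (t * \<mu>))"
    have h: "u t \<in> sphere_L2" using flow[of t] by (simp add: schroedinger_flow_def spectral_multiplier_def)
    obtain v where v: "\<And>\<mu>. is_eigenprojection \<mu> f (v \<mu>)"
      and lim': "((\<lambda>\<Lambda>. L2norm (\<lambda>x. u t x - (\<Sum>\<mu>\<in>\<Lambda>. ?e \<mu> * v \<mu> x))) \<longlongrightarrow> 0) (finite_subsets_at_top UNIV)"
      using flow[of t] unfolding schroedinger_flow_def spectral_multiplier_def by blast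
    have cv: "v (gegenbauer_eigenvalue n) x = c n * zonal_harmonic p n x" if "norm x = 1" for n x
      using eigenprojection_unique[OF f w v that] c[OF that] by simp
    show "AE x in sphere_measure. u t x =
        (\<Sum>n\<in>?A. exp (- \<i> * of_real (t * gegenbauer_eigenvalue n)) * c n * zonal_harmonic p n x)"
      by (rule spectral_multiplier_zonal[OF p f z h v lim' cv fA]) (simp_all add: c0)
  next
    have cc: "continuous_on (sphere 0 1) (\<lambda>x. cnj (?S x))" by (intro continuous_intros cS)
    have i: "(L2norm f)\<^sup>2 = (LINT x|sphere_measure. (cmod (f x))\<^sup>2)"
      unfolding L2norm_def by (rule real_sqrt_pow2) simp
    have "of_real ((L2norm f)\<^sup>2) = (LINT x|sphere_measure. f x * cnj (f x))"
      unfolding i by (simp only: integral_complex_of_real[symmetric] complex_norm_square)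
    also have "\<dots> = (LINT x|sphere_measure. ?S x * (\<Sum>n\<in>?A. cnj (c n) * zonal_harmonic p n x))"
    proof (rule integral_cong_AE)
      have "(\<lambda>x. cnj (f x)) \<in> borel_measurable sphere_measure"
        using mf by (rule measurable_compose) (intro borel_measurable_continuous_onI continuous_intros)
      then show "(\<lambda>x. f x * cnj (f x)) \<in> borel_measurable sphere_measure"
        using mf by (rule borel_measurable_times[rotated])
      show "(\<lambda>x. ?S x * (\<Sum>n\<in>?A. cnj (c n) * zonal_harmonic p n x)) \<in> borel_measurable sphere_measure"
        by (intro borel_measurable_sphere continuous_intros continuous_zonal_poly)
      show "AE x in sphere_measure. f x * cnj (f x) = ?S x * (\<Sum>n\<in>?A. cnj (c n) * zonal_harmonic p n x)"
        by (rule eventually_mono[OF fS]) simp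
    qed
    also have "\<dots> = of_real (\<Sum>n\<in>?A. (cmod (c n))\<^sup>2)"
      unfolding integral_zonal_sum[OF p fA fA] by (simp only: of_real_sum complex_norm_square Int_absorb)
    finally show "(L2norm f)\<^sup>2 = (\<Sum>n\<in>?A. (cmod (c n))\<^sup>2)" by (simp only: of_real_eq_iff)
  qed
qed

section \<open>The Gegenbauer equation\<close>

text \<open>The equation z'' + 3 cot z' + \<kappa> z = 0 multiplied by sin, so that it makes sense
  at the poles and there gives z' = 0. The bound 4 is the first nonzero eigenvalue 1 (1 + 3) and
  feeds the numerical margins below.\<close>

locale gegenbauer_ode =
  fixes z z' z'' :: "real \<Rightarrow> real" and \<kappa> :: real
  assumes z: "\<And>t. (z has_real_derivative z' t) (at t)"
    and z': "\<And>t. (z' has_real_derivative z'' t) (at t)"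
    and ode: "\<And>t. sin t * z'' t + 3 * cos t * z' t + \<kappa> * sin t * z t = 0"
    and lam: "\<kappa> \<ge> 4"
begin

text \<open>For \<kappa> = n(n+3) this is n + 3/2, the frequency with which sin^(3/2) z oscillates
  away from the poles.\<close>

definition \<nu> :: real where "\<nu> = sqrt (\<kappa> + 9 / 4)"

lemma nu2: "\<nu>\<^sup>2 = \<kappa> + 9 / 4" using lam by (simp add: \<nu>_def)

lemma nu_ge: "\<nu> \<ge> 5 / 2"
  unfolding \<nu>_def by (rule real_le_rsqrt) (use lam in \<open>simp add: power2_eq_square\<close>)

text \<open>\<open>v = sin\<^bsup>3/2\<^esup> z\<close> solves \<open>v'' + q v = 0\<close> with \<open>q = \<nu>\<^sup>2 - 3 / (4 sin\<^sup>2)\<close>; \<open>E\<close> is \<open>v'\<^sup>2 + q v\<^sup>2\<close>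
  and \<open>Q\<close> below is \<open>v v'\<close>, so that \<open>Q' = E - 2 q v\<^sup>2\<close> (equipartition) bounds \<open>E\<close> by the mass of \<open>v\<close>.\<close>

definition E :: "real \<Rightarrow> real" where
  "E t = sin t * (sin t * z' t + 3 / 2 * cos t * z t)\<^sup>2 + (\<nu>\<^sup>2 * sin t ^ 2 - 3 / 4) * sin t * (z t)\<^sup>2"

text \<open>For v'' + q v = 0 the derivative of v'^2 + q v^2 is q' v^2. Here q' = 3 cos / (2 sin^3),
  and the singularity is cancelled by v^2 = sin^3 z^2. The sign of cos makes E largest at the
  equator.\<close>

lemma E_deriv: "(E has_real_derivative 3 / 2 * cos t * (z t)\<^sup>2) (at t)"
proof -
  let ?s = "sin t" let ?c = "cos t" let ?z = "z t" let ?y = "z' t"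
  have sz: "?s * z'' t = - 3 * ?c * ?y - \<kappa> * ?s * ?z" using ode[of t] by simp
  have cs: "?c\<^sup>2 = 1 - ?s\<^sup>2" by (simp add: cos_squared_eq)
  let ?a = "?s * ?y + 3 / 2 * ?c * ?z"
  let ?a' = "?s * z'' t + ?c * ?y + 3 / 2 * (?c * ?y - ?s * ?z)"
  have "(E has_real_derivative ?c * ?a\<^sup>2 + ?s * (2 * ?a * ?a')
      + ((\<nu>\<^sup>2 * (2 * ?s * ?c)) * ?s * ?z\<^sup>2 + (\<nu>\<^sup>2 * ?s\<^sup>2 - 3 / 4) * (?c * ?z\<^sup>2 + ?s * (2 * ?z * ?y)))) (at t)"
    unfolding E_def
    by (rule derivative_eq_intros refl z z' | simp)+ (simp add: field_simps power2_eq_square)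
  moreover have "?c * ?a\<^sup>2 + ?s * (2 * ?a * ?a')
      + ((\<nu>\<^sup>2 * (2 * ?s * ?c)) * ?s * ?z\<^sup>2 + (\<nu>\<^sup>2 * ?s\<^sup>2 - 3 / 4) * (?c * ?z\<^sup>2 + ?s * (2 * ?z * ?y)))
     = 3 / 2 * ?c * ?z\<^sup>2"
    unfolding sz nu2 using cs by algebra
  ultimately show ?thesis by (simp only:)
qed

lemma E_mono: assumes "0 \<le> a" "a \<le> b" "b \<le> pi / 2" shows "E a \<le> E b"
proof (rule DERIV_nonneg_imp_nondecreasing[OF assms(2)])
  fix t assume "a \<le> t" "t \<le> b"
  then have "cos t \<ge> 0" using assms by (intro cos_ge_zero) auto
  then show "\<exists>y. (E has_real_derivative y) (at t) \<and> 0 \<le> y" using E_deriv[of t] by auto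
qed

lemma E_antimono: assumes "pi / 2 \<le> a" "a \<le> b" "b \<le> pi" shows "E b \<le> E a"
proof (rule DERIV_nonpos_imp_nonincreasing[OF assms(2)])
  fix t assume t: "a \<le> t" "t \<le> b"
  have "cos (pi - t) \<ge> 0" using assms t by (intro cos_ge_zero) auto
  then have "cos t * (z t)\<^sup>2 \<le> 0" by (simp add: mult_nonpos_nonneg)
  then show "\<exists>y. (E has_real_derivative y) (at t) \<and> y \<le> 0" using E_deriv[of t] by force
qed

section \<open>The energy at the equator against the mass of v\<close>

abbreviation "Emax \<equiv> E (pi / 2)"

lemma E_le: "0 \<le> t \<Longrightarrow> t \<le> pi \<Longrightarrow> E t \<le> Emax"
  using E_mono[of t "pi / 2"] E_antimono[of "pi / 2" t] by (cases "t \<le> pi / 2") auto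

lemma Emax_nonneg: "0 \<le> Emax"
  using E_mono[of 0 "pi / 2"] by (simp add: E_def)

text \<open>The condition on sin says precisely that q >= \<nu>^2 / 2, so that q v^2 <= E controls
  v.\<close>

lemma v_bound:
  assumes t: "0 \<le> t" "t \<le> pi" and s: "sin t ^ 2 \<ge> 3 / (2 * \<nu>\<^sup>2)"
  shows "sin t ^ 3 * (z t)\<^sup>2 \<le> 2 * Emax / \<nu>\<^sup>2"
proof -
  have n: "\<nu>\<^sup>2 > 0" using nu_ge by simp
  have sp: "sin t \<ge> 0" using t by (simp add: sin_ge_zero)
  have "\<nu>\<^sup>2 * sin t ^ 2 / 2 \<le> \<nu>\<^sup>2 * sin t ^ 2 - 3 / 4"
    using s n by (simp add: field_simps)
  then have "\<nu>\<^sup>2 * sin t ^ 2 / 2 * (sin t * (z t)\<^sup>2) \<le> (\<nu>\<^sup>2 * sin t ^ 2 - 3 / 4) * (sin t * (z t)\<^sup>2)"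
    using sp by (intro mult_right_mono) auto
  also have "\<dots> \<le> E t" using sp by (simp add: E_def mult.assoc)
  also have "\<dots> \<le> Emax" by (rule E_le[OF t])
  finally show ?thesis using n by (simp add: field_simps power2_eq_square power3_eq_cube)
qed

lemma sin_middle: assumes "pi / 4 \<le> t" "t \<le> 3 * pi / 4" shows "sin t \<ge> sqrt 2 / 2"
proof (cases "t \<le> pi / 2")
  case True
  then have "sin (pi / 4) \<le> sin t" using assms by (intro sin_monotone_2pi_le) auto
  then show ?thesis by (simp add: sin_45)
next
  case False
  then have "sin (pi / 4) \<le> sin (pi - t)" using assms by (intro sin_monotone_2pi_le) auto
  then show ?thesis by (simp add: sin_45)
qed

lemma sqrt2: "sqrt 2 \<ge> (14142/10000)" "sqrt 2 \<le> (14143/10000)"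
  by (rule real_le_rsqrt, simp add: power2_eq_square) (rule real_le_lsqrt, auto simp: power2_eq_square)

text \<open>Here sin >= sqrt 2 / 2 and \<nu>^2 >= 25/4, so v^2 <= 0.32 Emax; division by (sqrt 2 /
  2)^3, about 0.3535, gives 0.906, rounded up to 23/25.\<close>

lemma z_middle: assumes "pi / 4 \<le> t" "t \<le> 3 * pi / 4" shows "(z t)\<^sup>2 \<le> (23/25) * Emax"
proof -
  have s: "sin t \<ge> (7071/10000)" using sin_middle[OF assms] sqrt2 by simp
  have n: "\<nu>\<^sup>2 \<ge> (25/4)" using power_mono[OF nu_ge, of 2] by (simp add: power2_eq_square)
  have s2: "sin t ^ 2 \<ge> (7071/10000) ^ 2" by (rule power_mono[OF s]) simp
  have s3: "sin t ^ 3 \<ge> (7071/10000) ^ 3" by (rule power_mono[OF s]) simp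
  have "3 / (2 * \<nu>\<^sup>2) \<le> 3 / (2 * (25/4))" using n by (intro divide_left_mono) auto
  then have "sin t ^ 2 \<ge> 3 / (2 * \<nu>\<^sup>2)" using s2 by (simp add: power2_eq_square)
  moreover have "0 \<le> t" "t \<le> pi" using assms pi_gt_zero by auto
  ultimately have "sin t ^ 3 * (z t)\<^sup>2 \<le> 2 * Emax / \<nu>\<^sup>2" by (intro v_bound)
  also have "\<dots> \<le> 2 * Emax / (25/4)" using n Emax_nonneg by (intro divide_left_mono) auto
  finally have "sin t ^ 3 * (z t)\<^sup>2 \<le> 2 * Emax / (25/4)" .
  moreover have "(7071/10000) ^ 3 * (z t)\<^sup>2 \<le> sin t ^ 3 * (z t)\<^sup>2" using s3 by (intro mult_right_mono) auto
  ultimately have "(7071/10000) ^ 3 * (z t)\<^sup>2 \<le> 2 * Emax / (25/4)" by linarith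
  then show ?thesis using Emax_nonneg by (simp add: power3_eq_cube)
qed

text \<open>Compare E' = 3/2 cos z^2 with its bound from \<open>z_middle\<close>: the comparison
  function \<open>?F\<close> is smallest at the equator. Hence E loses at most 69/50 (1 - sin t) of
  Emax, that is about 0.404, on the middle half of the interval.\<close>

lemma E_middle: assumes t: "pi / 4 \<le> t" "t \<le> 3 * pi / 4" shows "E t \<ge> (59/100) * Emax"
proof -
  let ?F = "\<lambda>t. E t - 3 / 2 * ((23/25) * Emax) * sin t"
  have D: "(?F has_real_derivative 3 / 2 * cos t * ((z t)\<^sup>2 - (23/25) * Emax)) (at t)" for t
    by (rule derivative_eq_intros refl E_deriv | simp)+ (simp add: algebra_simps)
  have "?F (pi / 2) \<le> ?F t"
  proof (cases "t \<le> pi / 2")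
    case True
    show ?thesis
    proof (rule DERIV_nonpos_imp_nonincreasing[OF True])
      fix u assume u: "t \<le> u" "u \<le> pi / 2"
      have "cos u \<ge> 0" using u t pi_gt_zero by (intro cos_ge_zero) linarith+
      moreover have "(z u)\<^sup>2 \<le> (23/25) * Emax" by (rule z_middle) (use u t in auto)
      ultimately have "3 / 2 * cos u * ((z u)\<^sup>2 - (23/25) * Emax) \<le> 0" by (intro mult_nonneg_nonpos) auto
      then show "\<exists>y. (?F has_real_derivative y) (at u) \<and> y \<le> 0" using D by blast
    qed
  next
    case False
    then have "pi / 2 \<le> t" by simp
    then show ?thesis
    proof (rule DERIV_nonneg_imp_nondecreasing)
      fix u assume u: "pi / 2 \<le> u" "u \<le> t"
      have "cos (pi - u) \<ge> 0" using u t pi_gt_zero by (intro cos_ge_zero) linarith+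
      then have "cos u \<le> 0" by simp
      moreover have "(z u)\<^sup>2 \<le> (23/25) * Emax" by (rule z_middle) (use u t in auto)
      ultimately have "3 / 2 * cos u * ((z u)\<^sup>2 - (23/25) * Emax) \<ge> 0" by (intro mult_nonpos_nonpos) auto
      then show "\<exists>y. (?F has_real_derivative y) (at u) \<and> 0 \<le> y" using D by blast
    qed
  qed
  then have "E t \<ge> Emax - (69/50) * Emax * (1 - sin t)" by (simp add: field_simps)
  moreover have "(69/50) * Emax * (1 - sin t) \<le> (69/50) * Emax * (2929/10000)"
    using sin_middle[OF t] sqrt2 Emax_nonneg by (intro mult_left_mono) auto
  ultimately show ?thesis using Emax_nonneg by linarith
qed

definition Q :: "real \<Rightarrow> real" where
  "Q t = sin t ^ 2 * z t * (sin t * z' t + 3 / 2 * cos t * z t)"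

lemma Q_deriv: "(Q has_real_derivative E t - 2 * (\<nu>\<^sup>2 * sin t ^ 2 - 3 / 4) * sin t * (z t)\<^sup>2) (at t)"
proof -
  let ?s = "sin t" let ?c = "cos t" let ?z = "z t" let ?y = "z' t"
  have sz: "?s * z'' t = - 3 * ?c * ?y - \<kappa> * ?s * ?z" using ode[of t] by simp
  have cs: "?c\<^sup>2 = 1 - ?s\<^sup>2" by (simp add: cos_squared_eq)
  let ?a = "?s * ?y + 3 / 2 * ?c * ?z"
  let ?a' = "?s * z'' t + ?c * ?y + 3 / 2 * (?c * ?y - ?s * ?z)"
  have "(Q has_real_derivative (2 * ?s * ?c * ?z + ?s\<^sup>2 * ?y) * ?a + ?s\<^sup>2 * ?z * ?a') (at t)"
    unfolding Q_def
    by (rule derivative_eq_intros refl z z' | simp)+ (simp add: field_simps power2_eq_square)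
  moreover have "(2 * ?s * ?c * ?z + ?s\<^sup>2 * ?y) * ?a + ?s\<^sup>2 * ?z * ?a'
     = E t - 2 * (\<nu>\<^sup>2 * ?s ^ 2 - 3 / 4) * ?s * ?z\<^sup>2"
    unfolding sz nu2 E_def using cs by algebra
  ultimately show ?thesis by (simp only:)
qed

lemma Q_bound:
  assumes s: "sin t = sqrt 2 / 2" and t: "0 \<le> t" "t \<le> pi"
  shows "\<bar>Q t\<bar> \<le> (59/250) * Emax"
proof -
  define a where "a = sin t * z' t + 3 / 2 * cos t * z t"
  have n: "\<nu>\<^sup>2 \<ge> (25/4)" using power_mono[OF nu_ge, of 2] by (simp add: power2_eq_square)
  have s2: "sin t ^ 2 = 1 / 2" by (simp add: s power2_eq_square)
  have e: "E t = sin t * (a\<^sup>2 + (\<nu>\<^sup>2 / 2 - 3 / 4) * (z t)\<^sup>2)"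
    unfolding E_def a_def[symmetric] s2 by (simp add: algebra_simps)
  \<comment> \<open>The coefficient 9/4 fits below \<nu>^2 / 2 - 3/4 >= 19/8, so that the right side
    is dominated by the bracket in \<open>e\<close>.\<close>
  have ab: "\<bar>x * y\<bar> \<le> (y\<^sup>2 + 9 / 4 * x\<^sup>2) / 3" for x y :: real
  proof -
    have "0 \<le> (\<bar>y\<bar> - 3 / 2 * \<bar>x\<bar>)\<^sup>2" by simp
    then show ?thesis unfolding power2_diff by (simp add: abs_mult power_mult_distrib power2_eq_square algebra_simps)
  qed
  have "\<bar>z t * a\<bar> \<le> (a\<^sup>2 + 9 / 4 * (z t)\<^sup>2) / 3" by (rule ab)
  also have "\<dots> \<le> (a\<^sup>2 + (\<nu>\<^sup>2 / 2 - 3 / 4) * (z t)\<^sup>2) / 3"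
    using n by (intro divide_right_mono add_left_mono mult_right_mono) auto
  finally have za: "3 * \<bar>z t * a\<bar> \<le> a\<^sup>2 + (\<nu>\<^sup>2 / 2 - 3 / 4) * (z t)\<^sup>2" by simp
  have s7: "(7071/10000) \<le> sin t" using s sqrt2 by simp
  have "(7071/10000) * (3 * \<bar>z t * a\<bar>) \<le> sin t * (3 * \<bar>z t * a\<bar>)" using s7 by (rule mult_right_mono) simp
  also have "\<dots> \<le> E t" unfolding e using za s7 by (intro mult_left_mono) auto
  also have "\<dots> \<le> Emax" by (rule E_le[OF t])
  finally have "(7071/10000) * (3 * \<bar>z t * a\<bar>) \<le> Emax" .
  moreover have "\<bar>Q t\<bar> = \<bar>z t * a\<bar> / 2" unfolding Q_def a_def[symmetric] s2 by (simp add: abs_mult)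
  ultimately show ?thesis using Emax_nonneg by linarith
qed

definition J :: real where "J = integral {0..pi} (\<lambda>t. sin t ^ 3 * (z t)\<^sup>2)"

lemma cont_z: "continuous_on S z"
  using z by (meson DERIV_isCont continuous_at_imp_continuous_on)

text \<open>Adding 2 \<nu>^2 v^2 to Q' gives E plus a nonnegative term, so integration over the
  middle half bounds 0.59 (pi/2) Emax by the boundary values of Q, at most 2 (59/250) Emax, plus 2
  \<nu>^2 J. What remains on the left exceeds 2/5 Emax.\<close>

lemma Emax_le: "Emax \<le> 5 * \<nu>\<^sup>2 * J"
proof -
  let ?I = "{pi / 4..3 * pi / 4}"
  have ab: "pi / 4 \<le> 3 * pi / 4" using pi_gt_zero by simp
  let ?g = "\<lambda>t. E t - 2 * (\<nu>\<^sup>2 * sin t ^ 2 - 3 / 4) * sin t * (z t)\<^sup>2"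
  have hQ: "(?g has_integral Q (3 * pi / 4) - Q (pi / 4)) ?I"
    by (rule fundamental_theorem_of_calculus[OF ab])
       (rule has_vector_derivative_at_within[OF Q_deriv[unfolded has_real_derivative_iff_has_vector_derivative]])
  have i1: "(\<lambda>t. sin t ^ 3 * (z t)\<^sup>2) integrable_on ?I" and i0: "(\<lambda>t. sin t ^ 3 * (z t)\<^sup>2) integrable_on {0..pi}"
    by (intro integrable_continuous_interval continuous_intros cont_z)+
  let ?K = "integral ?I (\<lambda>t. sin t ^ 3 * (z t)\<^sup>2)"
  have h1: "((\<lambda>t. ?g t + 2 * \<nu>\<^sup>2 * (sin t ^ 3 * (z t)\<^sup>2)) has_integral
      (Q (3 * pi / 4) - Q (pi / 4)) + 2 * \<nu>\<^sup>2 * ?K) ?I"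
    by (rule has_integral_add[OF hQ has_integral_mult_right[OF integrable_integral[OF i1]]])
  have le: "(59/100) * Emax \<le> ?g t + 2 * \<nu>\<^sup>2 * (sin t ^ 3 * (z t)\<^sup>2)" if t: "t \<in> ?I" for t
  proof -
    have s0: "sin t * (z t)\<^sup>2 \<ge> 0" using t pi_gt_zero by (intro mult_nonneg_nonneg sin_ge_zero) auto
    have e: "?g t + 2 * \<nu>\<^sup>2 * (sin t ^ 3 * (z t)\<^sup>2) = E t + 3 / 2 * (sin t * (z t)\<^sup>2)"
      by (simp add: algebra_simps power2_eq_square power3_eq_cube)
    show ?thesis
      unfolding e using E_middle[of t] t s0 by simp
  qed
  have "((\<lambda>t. (59/100) * Emax) has_integral (3 * pi / 4 - pi / 4) *\<^sub>R ((59/100) * Emax)) ?I"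
    using has_integral_const_real[of "(59/100) * Emax" "pi / 4" "3 * pi / 4"] ab by simp
  from has_integral_le[OF this h1 le]
  have "(3 * pi / 4 - pi / 4) *\<^sub>R ((59/100) * Emax) \<le> (Q (3 * pi / 4) - Q (pi / 4)) + 2 * \<nu>\<^sup>2 * ?K" .
  moreover have "?K \<le> J"
    unfolding J_def by (rule integral_subset_le[OF _ i1 i0]) (use pi_gt_zero in \<open>auto simp: sin_ge_zero\<close>)
  then have "2 * \<nu>\<^sup>2 * ?K \<le> 2 * \<nu>\<^sup>2 * J" by (rule mult_left_mono) simp
  moreover have "(3 * pi / 4 - pi / 4) *\<^sub>R ((59/100) * Emax) = ((59/100) * Emax) * (pi / 2)"
    by simp
  ultimately have "((59/100) * Emax) * (pi / 2) \<le> (Q (3 * pi / 4) - Q (pi / 4)) + 2 * (\<nu>\<^sup>2 * J)"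
    by linarith
  moreover have "\<bar>Q (pi / 4)\<bar> \<le> (59/250) * Emax" by (rule Q_bound) (auto simp: sin_45)
  moreover have "\<bar>Q (3 * pi / 4)\<bar> \<le> (59/250) * Emax"
  proof (rule Q_bound)
    have "sin (3 * pi / 4) = sin (pi - pi / 4)" by (simp add: field_simps)
    also have "\<dots> = sqrt 2 / 2" by (simp only: sin_pi_minus sin_45)
    finally show "sin (3 * pi / 4) = sqrt 2 / 2" .
  qed auto
  moreover have "((59/100) * Emax) * ((157/50) / 2) \<le> ((59/100) * Emax) * (pi / 2)"
    using Emax_nonneg pi_approx by (intro mult_left_mono) auto
  ultimately have "(2/5) * Emax \<le> 2 * (\<nu>\<^sup>2 * J)" using Emax_nonneg by linarith
  then show ?thesis by (simp add: mult_ac)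
qed

lemma J_nonneg: "J \<ge> 0"
  unfolding J_def
proof (rule integral_nonneg)
  show "(\<lambda>t. sin t ^ 3 * (z t)\<^sup>2) integrable_on {0..pi}"
    by (intro integrable_continuous_interval continuous_intros cont_z)
qed (simp add: sin_ge_zero)

section \<open>Bounds near the pole\<close>

lemma z'0: "z' 0 = 0" using ode[of 0] by simp

text \<open>In the undivided variable the first-order term 3 cot z' is a damping on (0, pi/2]: the
  energy z'^2 + \<kappa> z^2 has derivative -6 cot z'^2. It is thus governed by its value at the
  pole, where z' = 0.\<close>

lemma first_energy:
  assumes t: "0 \<le> t" "t \<le> pi / 2"
  shows "(z' t)\<^sup>2 + \<kappa> * (z t)\<^sup>2 \<le> \<kappa> * (z 0)\<^sup>2"
proof -
  let ?G = "\<lambda>t. (z' t)\<^sup>2 + \<kappa> * (z t)\<^sup>2"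
  have D: "(?G has_real_derivative 2 * z' t * (z'' t + \<kappa> * z t)) (at t)" for t
    by (auto intro!: derivative_eq_intros z z' simp: algebra_simps)
  have "?G t \<le> ?G 0"
  proof (rule DERIV_nonpos_imp_nonincreasing[OF t(1)])
    fix u assume u: "0 \<le> u" "u \<le> t"
    have "2 * z' u * (z'' u + \<kappa> * z u) \<le> 0"
    proof (cases "u = 0")
      case False
      then have s: "sin u > 0" using u t pi_gt_zero by (intro sin_gt_zero) linarith+
      have "cos u \<ge> 0" using u t pi_gt_zero by (intro cos_ge_zero) linarith+
      have "sin u * (2 * z' u * (z'' u + \<kappa> * z u)) = 2 * z' u * (sin u * z'' u + \<kappa> * sin u * z u)"
        by (simp add: algebra_simps)
      also have "sin u * z'' u + \<kappa> * sin u * z u = - (3 * cos u * z' u)" using ode[of u] by simp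
      also have "2 * z' u * \<dots> = - 6 * (cos u * (z' u)\<^sup>2)" by (simp add: power2_eq_square)
      also have "\<dots> \<le> 0" using \<open>cos u \<ge> 0\<close> by simp
      finally have "sin u * (2 * z' u * (z'' u + \<kappa> * z u)) \<le> 0" .
      then show ?thesis using s by (simp add: mult_le_0_iff)
    qed (simp add: z'0)
    then show "\<exists>y. (?G has_real_derivative y) (at u) \<and> y \<le> 0" using D by blast
  qed
  then show ?thesis by (simp add: z'0)
qed

text \<open>Near the pole \<open>z\<close> is comparable to \<open>z 0\<close> on an interval of length \<open>1 / (2 sqrt \<kappa>)\<close>, over which
  \<open>E\<close> grows from \<open>0\<close> by at least a constant times \<open>(z 0)\<^sup>2 / sqrt \<kappa>\<close>.\<close>

lemma pole_bound:
  assumes t: "0 \<le> t" "t \<le> pi / 2"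
  shows "(z t)\<^sup>2 \<le> 28 * \<nu> ^ 3 * J"
proof -
  define r where "r = sqrt \<kappa>"
  have r: "r \<ge> 2" "r\<^sup>2 = \<kappa>" unfolding r_def using lam by (auto intro: real_le_rsqrt)
  define t1 where "t1 = 1 / (2 * r)"
  have t1: "0 < t1" "t1 \<le> 1 / 4" "t1 \<le> pi / 2"
  proof -
    show "0 < t1" "t1 \<le> 1 / 4" using r unfolding t1_def by (auto simp: field_simps)
    then show "t1 \<le> pi / 2" using pi_gt3 by linarith
  qed
  have low: "(z 0)\<^sup>2 / 4 \<le> (z u)\<^sup>2" if u: "0 \<le> u" "u \<le> t1" for u
  proof -
    have "norm (z u - z 0) \<le> (r * \<bar>z 0\<bar>) * norm (u - 0)"
    proof (rule field_differentiable_bound[of "{0..t1}" z z'])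
      fix v assume v: "v \<in> {0..t1}"
      show "(z has_field_derivative z' v) (at v within {0..t1})" using z by (rule has_field_derivative_at_within)
      have "(z' v)\<^sup>2 + \<kappa> * (z v)\<^sup>2 \<le> \<kappa> * (z 0)\<^sup>2" by (rule first_energy) (use v t1 in auto)
      moreover have "\<kappa> * (z v)\<^sup>2 \<ge> 0" using lam by simp
      ultimately have "(z' v)\<^sup>2 \<le> (r * \<bar>z 0\<bar>)\<^sup>2" using r by (simp add: power_mult_distrib)
      then have "\<bar>z' v\<bar> \<le> \<bar>r * \<bar>z 0\<bar>\<bar>" by (simp only: abs_le_square_iff)
      then show "norm (z' v) \<le> r * \<bar>z 0\<bar>" using r by (simp add: abs_mult)
    qed (use u t1 in auto)
    also have "\<dots> \<le> (r * \<bar>z 0\<bar>) * t1" using u r by (intro mult_left_mono) auto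
    also have "\<dots> = \<bar>z 0\<bar> / 2" using r by (simp add: t1_def)
    finally have "\<bar>z 0\<bar> / 2 \<le> \<bar>z u\<bar>" by (simp add: abs_if split: if_splits)
    then have "(\<bar>z 0\<bar> / 2)\<^sup>2 \<le> \<bar>z u\<bar>\<^sup>2" by (rule power_mono) simp
    then show ?thesis by (simp add: power_divide)
  qed
  \<comment> \<open>9/25 = 3/2 * 24/25 * 1/4, from the lower bounds 24/25 for cos (as t1 <= 1/4) and
    (z 0)^2 / 4 for (z u)^2 in E' = 3/2 cos z^2.\<close>
  let ?F = "\<lambda>t. E t - (9/25) * (z 0)\<^sup>2 * t"
  have "?F 0 \<le> ?F t1"
  proof (rule DERIV_nonneg_imp_nondecreasing[of 0 t1 ?F])
    fix u assume u: "0 \<le> u" "u \<le> t1"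
    have "cos u = 1 - 2 * (sin (u / 2))\<^sup>2" using cos_double_sin[of "u / 2"] by simp
    moreover have "(sin (u / 2))\<^sup>2 \<le> (u / 2)\<^sup>2"
      by (rule iffD1[OF abs_le_square_iff abs_sin_x_le_abs_x])
    ultimately have "1 - u\<^sup>2 / 2 \<le> cos u" by (simp add: power_divide)
    moreover have "u\<^sup>2 \<le> (1 / 4)\<^sup>2" using u t1 by (intro power_mono) auto
    ultimately have c: "cos u \<ge> (24/25)" by (simp add: power2_eq_square)
    have "(24/25) * ((z 0)\<^sup>2 / 4) \<le> cos u * (z u)\<^sup>2" using c low[OF u] by (intro mult_mono) auto
    then have "0 \<le> 3 / 2 * cos u * (z u)\<^sup>2 - (9/25) * (z 0)\<^sup>2" by simp
    moreover have "((\<lambda>t. E t - (9/25) * (z 0)\<^sup>2 * t) has_real_derivative 3 / 2 * cos u * (z u)\<^sup>2 - (9/25) * (z 0)\<^sup>2) (at u)"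
      by (auto intro!: derivative_eq_intros E_deriv)
    ultimately show "\<exists>y. ((\<lambda>t. E t - (9/25) * (z 0)\<^sup>2 * t) has_real_derivative y) (at u) \<and> 0 \<le> y" by blast
  qed (use t1 in simp)
  then have "(9/25) * (z 0)\<^sup>2 * t1 \<le> E t1" by (simp add: E_def)
  also have "\<dots> \<le> Emax" by (rule E_le) (use t1 pi_gt3 in auto)
  also have "\<dots> \<le> 5 * \<nu>\<^sup>2 * J" by (rule Emax_le)
  finally have "9 * (z 0)\<^sup>2 \<le> 250 * (r * (\<nu>\<^sup>2 * J))"
    using r unfolding t1_def by (simp add: field_simps)
  moreover have "r * (\<nu>\<^sup>2 * J) \<ge> 0" using r J_nonneg by simp
  \<comment> \<open>250 / 9 is below 28.\<close>
  ultimately have "(z 0)\<^sup>2 \<le> 28 * r * (\<nu>\<^sup>2 * J)" by linarith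
  also have "r \<le> \<nu>" unfolding r_def \<nu>_def by simp
  then have "28 * r * (\<nu>\<^sup>2 * J) \<le> 28 * \<nu> * (\<nu>\<^sup>2 * J)" using J_nonneg by (intro mult_right_mono) auto
  also have "\<dots> = 28 * \<nu> ^ 3 * J" by (simp add: power2_eq_square power3_eq_cube)
  finally have z0: "(z 0)\<^sup>2 \<le> 28 * \<nu> ^ 3 * J" .
  have "\<kappa> * (z t)\<^sup>2 \<le> \<kappa> * (z 0)\<^sup>2" using first_energy[OF t] zero_le_power2[of "z' t"] by linarith
  then have "(z t)\<^sup>2 \<le> (z 0)\<^sup>2" using lam by simp
  then show ?thesis using z0 by linarith
qed

text \<open>Two regimes meet where sin t is comparable to 1/\<nu>. Away from the pole
  \<open>v_bound\<close> and \<open>Emax_le\<close> give 10 J; near it sin^3 \<nu>^3 <= 2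
  compensates the growth in \<open>pole_bound\<close> and gives 56 J.\<close>

lemma half_bound:
  assumes t: "0 \<le> t" "t \<le> pi / 2"
  shows "sin t ^ 3 * (z t)\<^sup>2 \<le> 100 * J"
proof (cases "sin t ^ 2 \<ge> 3 / (2 * \<nu>\<^sup>2)")
  case True
  have n: "\<nu>\<^sup>2 > 0" using nu_ge by simp
  have "sin t ^ 3 * (z t)\<^sup>2 \<le> 2 * Emax / \<nu>\<^sup>2" by (rule v_bound[OF _ _ True]) (use t in auto)
  also have "\<dots> \<le> 2 * (5 * \<nu>\<^sup>2 * J) / \<nu>\<^sup>2" using Emax_le n by (intro divide_right_mono mult_left_mono) simp_all
  also have "\<dots> = 10 * J" using n by simp
  finally show ?thesis using J_nonneg by linarith
next
  case False
  have n: "\<nu> > 0" using nu_ge by simp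
  have sp: "sin t \<ge> 0" using t by (intro sin_ge_zero) auto
  have "sin t ^ 2 * \<nu>\<^sup>2 \<le> 3 / 2" using False n by (simp add: field_simps)
  also have "\<dots> \<le> ((5/4))\<^sup>2" by (simp add: power2_eq_square)
  finally have "(sin t * \<nu>)\<^sup>2 \<le> ((5/4))\<^sup>2" by (simp add: power_mult_distrib)
  then have "sin t * \<nu> \<le> (5/4)" by (rule power2_le_imp_le) simp
  then have "(sin t * \<nu>) ^ 3 \<le> (5/4) ^ 3" using sp n by (intro power_mono) auto
  also have "(5/4 :: real) ^ 3 \<le> 2" by (simp add: power3_eq_cube)
  finally have c: "sin t ^ 3 * \<nu> ^ 3 \<le> 2" by (simp only: power_mult_distrib)
  have "sin t ^ 3 * (z t)\<^sup>2 \<le> sin t ^ 3 * (28 * \<nu> ^ 3 * J)"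
    using pole_bound[OF t] sp by (intro mult_left_mono) auto
  also have "\<dots> = (sin t ^ 3 * \<nu> ^ 3) * (28 * J)" by simp
  also have "\<dots> \<le> 2 * (28 * J)" using c J_nonneg by (intro mult_right_mono) auto
  finally show ?thesis using J_nonneg by linarith
qed

end

section \<open>Bounds on normalized Gegenbauer polynomials\<close>

lemma gegenbauer_ode_reflect:
  assumes "gegenbauer_ode z z' z'' \<kappa>"
  shows "gegenbauer_ode (\<lambda>t. z (pi - t)) (\<lambda>t. - z' (pi - t)) (\<lambda>t. z'' (pi - t)) \<kappa>"
proof -
  interpret gegenbauer_ode z z' z'' \<kappa> by fact
  show ?thesis
  proof
    show "((\<lambda>t. z (pi - t)) has_real_derivative - z' (pi - t)) (at t)" for t
      by (rule DERIV_cong[OF DERIV_chain2[OF z, of "\<lambda>t. pi - t" "-1"]]) (auto intro!: derivative_eq_intros)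
    show "((\<lambda>t. - z' (pi - t)) has_real_derivative z'' (pi - t)) (at t)" for t
      by (rule DERIV_cong[OF DERIV_minus[OF DERIV_chain2[OF z', of "\<lambda>t. pi - t" "-1"]]]) (auto intro!: derivative_eq_intros)
    show "sin t * z'' (pi - t) + 3 * cos t * (- z' (pi - t)) + \<kappa> * sin t * z (pi - t) = 0" for t
      using ode[of "pi - t"] by simp
    show "\<kappa> \<ge> 4" by (rule lam)
  qed
qed

lemma integral_reflect_pi:
  fixes f :: "real \<Rightarrow> real"
  shows "integral {0..pi} (\<lambda>t. f (pi - t)) = integral {0..pi} f"
proof -
  have "integral {0..pi} (\<lambda>t. f (pi - t)) = integral {-pi..-0} (\<lambda>t. f (pi - (- t)))"
    by (rule Henstock_Kurzweil_Integration.integral_reflect_real[symmetric])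
  also have "\<dots> = integral {-pi..0} (f \<circ> ((+) pi))" by (simp add: o_def)
  also have "\<dots> = integral {0..pi} f" unfolding integral_shift_Icc_real by simp
  finally show ?thesis .
qed

text \<open>The reflection t -> pi - t preserves both the equation and the mass, so the bounds on
  the first half of the interval carry over to the second.\<close>

lemma gegenbauer_ode_bounds:
  assumes "gegenbauer_ode z z' z'' \<kappa>" and t: "0 \<le> t" "t \<le> pi"
  defines "I \<equiv> integral {0..pi} (\<lambda>t. sin t ^ 3 * (z t)\<^sup>2)"
  shows "sin t ^ 3 * (z t)\<^sup>2 \<le> 100 * I" "(z t)\<^sup>2 \<le> 28 * sqrt (\<kappa> + 9 / 4) ^ 3 * I"
proof -
  interpret gegenbauer_ode z z' z'' \<kappa> by fact
  interpret r: gegenbauer_ode "\<lambda>t. z (pi - t)" "\<lambda>t. - z' (pi - t)" "\<lambda>t. z'' (pi - t)" \<kappa>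
    by (rule gegenbauer_ode_reflect[OF assms(1)])
  have I: "I = J" by (simp add: I_def J_def)
  have rJ: "r.J = J"
    unfolding r.J_def J_def using integral_reflect_pi[of "\<lambda>t. sin t ^ 3 * (z t)\<^sup>2"] by simp
  have "sin t ^ 3 * (z t)\<^sup>2 \<le> 100 * I \<and> (z t)\<^sup>2 \<le> 28 * sqrt (\<kappa> + 9 / 4) ^ 3 * I"
  proof (cases "t \<le> pi / 2")
    case True
    then show ?thesis unfolding I using half_bound[OF t(1)] pole_bound[OF t(1)] by (simp add: \<nu>_def)
  next
    case False
    then have t': "0 \<le> pi - t" "pi - t \<le> pi / 2" using t by auto
    show ?thesis unfolding I rJ[symmetric]
      using r.half_bound[OF t'] r.pole_bound[OF t'] by (simp add: r.\<nu>_def)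
  qed
  then show "sin t ^ 3 * (z t)\<^sup>2 \<le> 100 * I" "(z t)\<^sup>2 \<le> 28 * sqrt (\<kappa> + 9 / 4) ^ 3 * I" by auto
qed

lemma gegenbauer_op_normalized:
  "gegenbauer_op 4 (normalized_gegenbauer n) = smult (- gegenbauer_eigenvalue n) (normalized_gegenbauer n)"
  unfolding normalized_gegenbauer_def gegenbauer_op_smult gegenbauer_op_gegenbauer by (simp add: mult.commute)

lemma normalized_gegenbauer_ode:
  assumes "n \<ge> 1"
  defines "P \<equiv> normalized_gegenbauer n"
  shows "gegenbauer_ode (\<lambda>t. poly P (cos t)) (\<lambda>t. - sin t * poly (pderiv P) (cos t))
     (\<lambda>t. sin t ^ 2 * poly (pderiv (pderiv P)) (cos t) - cos t * poly (pderiv P) (cos t)) (gegenbauer_eigenvalue n)"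
proof
  show "((\<lambda>t. poly P (cos t)) has_real_derivative - sin t * poly (pderiv P) (cos t)) (at t)" for t
    by (rule DERIV_cong[OF DERIV_chain2[OF poly_DERIV DERIV_cos]]) simp
  show "((\<lambda>t. - sin t * poly (pderiv P) (cos t)) has_real_derivative
     (sin t ^ 2 * poly (pderiv (pderiv P)) (cos t) - cos t * poly (pderiv P) (cos t))) (at t)" for t
    by (rule DERIV_cong[OF DERIV_mult'[OF DERIV_minus[OF DERIV_sin] DERIV_chain2[OF poly_DERIV DERIV_cos]]])
       (simp add: power2_eq_square algebra_simps)
  show "sin t * (sin t ^ 2 * poly (pderiv (pderiv P)) (cos t) - cos t * poly (pderiv P) (cos t))
     + 3 * cos t * (- sin t * poly (pderiv P) (cos t)) + gegenbauer_eigenvalue n * sin t * poly P (cos t) = 0" for t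
  proof -
    have "poly (gegenbauer_op 4 P) (cos t) = - gegenbauer_eigenvalue n * poly P (cos t)"
      unfolding P_def gegenbauer_op_normalized by simp
    then have e: "(1 - cos t ^ 2) * poly (pderiv (pderiv P)) (cos t) - 4 * cos t * poly (pderiv P) (cos t)
        + gegenbauer_eigenvalue n * poly P (cos t) = 0"
      by (simp add: gegenbauer_op_def algebra_simps power2_eq_square)
    have "sin t * (sin t ^ 2 * poly (pderiv (pderiv P)) (cos t) - cos t * poly (pderiv P) (cos t))
     + 3 * cos t * (- sin t * poly (pderiv P) (cos t)) + gegenbauer_eigenvalue n * sin t * poly P (cos t)
     = sin t * ((1 - cos t ^ 2) * poly (pderiv (pderiv P)) (cos t) - 4 * cos t * poly (pderiv P) (cos t)
        + gegenbauer_eigenvalue n * poly P (cos t))"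
      unfolding sin_squared_eq by (simp add: algebra_simps)
    then show ?thesis by (simp only: e mult_zero_right)
  qed
  have "real n * (real n + 3) \<ge> 1 * (1 + 3)" using assms(1) by (intro mult_mono) auto
  then show "gegenbauer_eigenvalue n \<ge> 4" by (simp add: gegenbauer_eigenvalue_def)
qed

lemma zonal_integral_normalized_square:
  "zonal_integral (normalized_gegenbauer n * normalized_gegenbauer n) = 1 / sphere_factor"
proof -
  have "zonal_integral (gegenbauer n * gegenbauer n) > 0" by (rule zonal_integral_square_pos[OF gegenbauer_nz])
  moreover have "normalized_gegenbauer n * normalized_gegenbauer n
     = smult (1 / gegenbauer_norm2 n) (gegenbauer n * gegenbauer n)"
    using gegenbauer_norm2_pos[of n] by (simp add: normalized_gegenbauer_def)
  ultimately show ?thesis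
    using sphere_factor_pos by (simp add: zonal_integral_smult gegenbauer_norm2_def)
qed

lemma normalized_gegenbauer_pointwise:
  obtains C where "C > 0"
    "\<And>n t. 0 \<le> t \<Longrightarrow> t \<le> pi \<Longrightarrow> sin t ^ 3 * (poly (normalized_gegenbauer n) (cos t))\<^sup>2 \<le> C"
    "\<And>n t. 0 \<le> t \<Longrightarrow> t \<le> pi \<Longrightarrow> (poly (normalized_gegenbauer n) (cos t))\<^sup>2 \<le> C * (real n + 1) ^ 3"
proof -
  define J where "J = 1 / sphere_factor"
  have J: "J > 0" using sphere_factor_pos by (simp add: J_def)
  define k where "k = J / zonal_integral [:1:]"
  have k: "k > 0" using J zonal_integral_1 by (simp add: k_def)
  \<comment> \<open>224 = 28 * 2^3, since n + 3/2 <= 2 (n + 1). The term \<open>k\<close> is the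
    square of the constant Z_0, treated apart because its eigenvalue 0 is below 4.\<close>
  define C where "C = 224 * J + k"
  have Jn: "integral {0..pi} (\<lambda>t. sin t ^ 3 * (poly (normalized_gegenbauer n) (cos t))\<^sup>2) = J" for n
    using zonal_integral_normalized_square[of n]
    by (simp add: zonal_integral_def J_def power2_eq_square mult.commute)
  have "sin t ^ 3 * (poly (normalized_gegenbauer n) (cos t))\<^sup>2 \<le> C \<and>
        (poly (normalized_gegenbauer n) (cos t))\<^sup>2 \<le> C * (real n + 1) ^ 3" if t: "0 \<le> t" "t \<le> pi" for n t
  proof (cases "n = 0")
    case True
    define a where "a = 1 / sqrt (gegenbauer_norm2 0)"
    have P: "normalized_gegenbauer 0 = [:a:]" by (simp add: normalized_gegenbauer_def gegenbauer_0 a_def)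
    have "[:a:] * [:a:] = smult (a\<^sup>2) [:1:]" by (simp add: power2_eq_square)
    then have "a\<^sup>2 * zonal_integral [:1:] = J"
      using zonal_integral_normalized_square[of 0] unfolding P by (simp only: zonal_integral_smult J_def)
    then have a: "a\<^sup>2 = k" using zonal_integral_1 by (simp add: k_def field_simps)
    have "sin t ^ 3 \<le> 1" "0 \<le> sin t ^ 3" using t by (auto simp: sin_ge_zero intro: power_le_one)
    then have "sin t ^ 3 * k \<le> 1 * k" using k by (intro mult_right_mono) auto
    then show ?thesis using a J by (simp add: True P C_def)
  next
    case False
    then have n: "n \<ge> 1" by simp
    note b = gegenbauer_ode_bounds[OF normalized_gegenbauer_ode[OF n] t, unfolded Jn]
    have "gegenbauer_eigenvalue n + 9 / 4 = (real n + 3 / 2)\<^sup>2"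
      by (simp add: gegenbauer_eigenvalue_def power2_eq_square algebra_simps)
    then have "sqrt (gegenbauer_eigenvalue n + 9 / 4) = real n + 3 / 2" by simp
    then have "sqrt (gegenbauer_eigenvalue n + 9 / 4) ^ 3 \<le> (2 * (real n + 1)) ^ 3"
      by (simp add: power_mono)
    then have "28 * sqrt (gegenbauer_eigenvalue n + 9 / 4) ^ 3 * J \<le> 28 * (2 * (real n + 1)) ^ 3 * J"
      using J by simp
    also have "\<dots> = 224 * J * (real n + 1) ^ 3" by (simp only: power_mult_distrib) simp
    also have "\<dots> \<le> C * (real n + 1) ^ 3" using k by (intro mult_right_mono) (auto simp: C_def)
    finally show ?thesis using b J k by (auto simp: C_def)
  qed
  then show thesis using that[of C] J k by (auto simp: C_def)
qed

lemma sin_ge_half: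
  assumes "0 \<le> t" "t \<le> pi / 2"
  shows "t / 2 \<le> sin t"
proof (cases "t \<le> pi / 3")
  case True
  have "sin 0 - 0 / 2 \<le> sin t - t / 2"
  proof (rule DERIV_nonneg_imp_nondecreasing[of 0 t "\<lambda>t. sin t - t / 2"])
    fix u assume u: "0 \<le> u" "u \<le> t"
    have "cos (pi / 3) \<le> cos u" using u True pi_gt_zero by (intro cos_monotone_0_pi_le) auto
    then have "0 \<le> cos u - 1 / 2" by (simp add: cos_60)
    moreover have "((\<lambda>t. sin t - t / 2) has_real_derivative cos u - 1 / 2) (at u)"
      by (auto intro!: derivative_eq_intros)
    ultimately show "\<exists>y. ((\<lambda>t. sin t - t / 2) has_real_derivative y) (at u) \<and> 0 \<le> y" by blast
  qed (use assms in auto)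
  then show ?thesis by simp
next
  case False
  have "sin (pi / 3) \<le> sin t" using False assms pi_gt_zero by (intro sin_monotone_2pi_le) auto
  moreover have "sqrt 3 \<ge> 17 / 10" by (rule real_le_rsqrt) (simp add: power2_eq_square)
  ultimately have "sin t \<ge> 17 / 20" by (simp add: sin_60)
  moreover have "pi / 4 \<le> 17 / 20" using pi_approx by simp
  ultimately show ?thesis using assms by linarith
qed

text \<open>A smooth majorant of \<open>min (K\<^bsup>3/2\<^esup>, t\<^bsup>-3/2\<^esup>)\<close> with an elementary primitive.\<close>

lemma concentration_bound:
  fixes K t C y :: real
  assumes K: "K \<ge> 1" and t: "0 \<le> t" "t \<le> pi / 2"
    and y: "sin t ^ 3 * y\<^sup>2 \<le> C" "y\<^sup>2 \<le> C * K ^ 3"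
  shows "\<bar>y\<bar> \<le> 6 * sqrt C * sqrt (K / (1 + K * t)) ^ 3"
proof -
  have p: "1 + K * t > 0" using K t by (simp add: add_pos_nonneg)
  have C: "0 \<le> C"
    using y(1) t by (smt (verit) mult_nonneg_nonneg sin_ge_zero zero_le_power zero_le_power2 pi_gt_zero field_sum_of_halves)
  \<comment> \<open>Convexity of the cube; it merges the two bounds on y^2 into one for (1 + K t)^3
    y^2, with constant 4 (1 + 8) = 36, whose root is 6.\<close>
  have a: "(1 + x) ^ 3 \<le> 4 * (1 + x ^ 3)" if "x \<ge> 0" for x :: real
  proof -
    have "4 * (1 + x ^ 3) - (1 + x) ^ 3 = 3 * ((1 + x) * (x - 1)\<^sup>2)"
      by (simp add: power2_eq_square power3_eq_cube algebra_simps)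
    also have "\<dots> \<ge> 0" using that by simp
    finally show ?thesis by simp
  qed
  have "t / 2 \<le> sin t" by (rule sin_ge_half[OF t])
  then have "(t / 2) ^ 3 \<le> sin t ^ 3" using t by (intro power_mono) auto
  then have "t ^ 3 * y\<^sup>2 \<le> 8 * sin t ^ 3 * y\<^sup>2" by (intro mult_right_mono) (auto simp: power_divide)
  also have "\<dots> \<le> 8 * C" using y(1) by simp
  finally have ty: "t ^ 3 * y\<^sup>2 \<le> 8 * C" .
  have "(1 + K * t) ^ 3 * y\<^sup>2 \<le> 4 * (1 + (K * t) ^ 3) * y\<^sup>2"
    using K t by (intro mult_right_mono a) auto
  also have "\<dots> = 4 * (y\<^sup>2 + K ^ 3 * (t ^ 3 * y\<^sup>2))" by (simp add: power_mult_distrib algebra_simps)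
  also have "\<dots> \<le> 4 * (C * K ^ 3 + K ^ 3 * (8 * C))"
    using y(2) ty K by (intro mult_left_mono add_mono) auto
  also have "\<dots> = 36 * C * K ^ 3" by simp
  finally have "y\<^sup>2 \<le> 36 * C * (K ^ 3 / (1 + K * t) ^ 3)"
    using p by (simp add: field_simps)
  also have "\<dots> = (6 * sqrt C * sqrt (K / (1 + K * t)) ^ 3)\<^sup>2"
  proof -
    have "(sqrt (K / (1 + K * t)) ^ 3)\<^sup>2 = ((sqrt (K / (1 + K * t)))\<^sup>2) ^ 3" by (simp flip: power_mult)
    also have "\<dots> = (K / (1 + K * t)) ^ 3" using p K by (simp only: real_sqrt_pow2 divide_nonneg_pos)
    also have "\<dots> = K ^ 3 / (1 + K * t) ^ 3" by (rule power_divide)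
    finally show ?thesis using C by (simp add: power_mult_distrib)
  qed
  finally have "\<bar>y\<bar> \<le> \<bar>6 * sqrt C * sqrt (K / (1 + K * t)) ^ 3\<bar>" by (simp only: abs_le_square_iff)
  also have "\<dots> = 6 * sqrt C * sqrt (K / (1 + K * t)) ^ 3" using C p K by simp
  finally show ?thesis .
qed

text \<open>With h = K / (1 + K t) one has h' = - h^2, so -2 sqrt h is a primitive of h^(3/2). The
  value 2 sqrt K is the origin of the power 1/2 in the theorem.\<close>

lemma concentration_integral:
  fixes K :: real
  assumes K: "K \<ge> 1"
  obtains I where "((\<lambda>t. sqrt (K / (1 + K * t)) ^ 3) has_integral I) {0..pi}" "I \<le> 2 * sqrt K"
proof -
  have "((\<lambda>t. sqrt (K / (1 + K * t)) ^ 3) has_integral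
      (- 2 * sqrt (K / (1 + K * pi)) - (- 2 * sqrt (K / (1 + K * 0))))) {0..pi}"
  proof (rule fundamental_theorem_of_calculus)
    fix t assume "t \<in> {0..pi}"
    then have p: "1 + K * t > 0" using K by (simp add: add_pos_nonneg)
    define h where "h = K / (1 + K * t)"
    have h: "h > 0" using p K by (simp add: h_def)
    have D: "((\<lambda>t. K / (1 + K * t)) has_real_derivative - h\<^sup>2) (at t)"
      using p by (auto intro!: derivative_eq_intros simp: h_def power2_eq_square field_simps)
    have "((\<lambda>t. - 2 * sqrt (K / (1 + K * t))) has_real_derivative - 2 * (- h\<^sup>2 * (inverse (sqrt h) / 2))) (at t)"
      by (rule DERIV_cmult[OF DERIV_cong[OF DERIV_chain2[OF DERIV_real_sqrt D]]]) (use h in \<open>simp_all add: h_def\<close>)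
    moreover have "- 2 * (- h\<^sup>2 * (inverse (sqrt h) / 2)) = sqrt h ^ 3"
    proof -
      have "h\<^sup>2 = sqrt h ^ 3 * sqrt h" using h by (simp add: power3_eq_cube power2_eq_square)
      then show ?thesis using h by simp
    qed
    ultimately show "((\<lambda>t. - 2 * sqrt (K / (1 + K * t))) has_vector_derivative sqrt (K / (1 + K * t)) ^ 3) (at t within {0..pi})"
      unfolding h_def using has_vector_derivative_at_within by (simp add: has_real_derivative_iff_has_vector_derivative)
  qed simp
  moreover have "(- 2 * sqrt (K / (1 + K * pi)) - (- 2 * sqrt (K / (1 + K * 0)))) \<le> 2 * sqrt K"
    using K by simp
  ultimately show thesis using that by blast
qed

text \<open>One profile is taken in L^1 of the angle by its concentration bound, doubled to cover
  both poles. The weight sin^3 is split as sin^(3/2) sin^(3/2) between the other two, which then are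
  bounded uniformly. The frequency a is arbitrary; symmetry later lets it be the smallest.\<close>

lemma trilinear_zonal_integral_bound:
  obtains C where "C > 0"
    "\<And>a b c. \<bar>zonal_integral (normalized_gegenbauer a * normalized_gegenbauer b * normalized_gegenbauer c)\<bar>
        \<le> C * sqrt (real a + 1)"
proof -
  obtain C where C: "C > 0"
    "\<And>n t. 0 \<le> t \<Longrightarrow> t \<le> pi \<Longrightarrow> sin t ^ 3 * (poly (normalized_gegenbauer n) (cos t))\<^sup>2 \<le> C"
    "\<And>n t. 0 \<le> t \<Longrightarrow> t \<le> pi \<Longrightarrow> (poly (normalized_gegenbauer n) (cos t))\<^sup>2 \<le> C * (real n + 1) ^ 3"
    using normalized_gegenbauer_pointwise by blast
  have "\<bar>zonal_integral (normalized_gegenbauer a * normalized_gegenbauer b * normalized_gegenbauer c)\<bar>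
        \<le> (24 * C * sqrt C) * sqrt (real a + 1)" for a b c
  proof -
    let ?P = "\<lambda>n t. poly (normalized_gegenbauer n) (cos t)"
    define K where "K = real a + 1"
    have K: "K \<ge> 1" by (simp add: K_def)
    let ?g = "\<lambda>t. sqrt (K / (1 + K * t)) ^ 3"
    obtain I where I: "(?g has_integral I) {0..pi}" "I \<le> 2 * sqrt K" using concentration_integral[OF K] .
    have I': "((\<lambda>t. ?g (pi - t)) has_integral I) {0..pi}"
    proof -
      have "((\<lambda>t. ?g (pi - t)) integrable_on {0..pi})"
        using K by (intro integrable_continuous_interval continuous_intros) (auto simp: add_pos_nonneg less_imp_neq[symmetric] add_nonneg_eq_0_iff)
      then show ?thesis using integral_reflect_pi[of ?g] I(1) by (metis integrable_integral integral_unique)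
    qed
    have A: "\<bar>?P a t\<bar> \<le> 6 * sqrt C * (?g t + ?g (pi - t))" if t: "t \<in> {0..pi}" for t
    proof -
      have g: "?g u \<ge> 0" if "u \<ge> 0" for u using K that by simp
      show ?thesis
      proof (cases "t \<le> pi / 2")
        case True
        have "\<bar>?P a t\<bar> \<le> 6 * sqrt C * ?g t"
          by (rule concentration_bound[OF K _ True]) (use t C in \<open>auto simp: K_def\<close>)
        also have "\<dots> \<le> 6 * sqrt C * (?g t + ?g (pi - t))"
          using g[of "pi - t"] t C(1) by (intro mult_left_mono) auto
        finally show ?thesis .
      next
        case False
        have "\<bar>?P a t\<bar> \<le> 6 * sqrt C * ?g (pi - t)"
          by (rule concentration_bound[OF K]) (use t C False in \<open>auto simp: K_def\<close>)
        also have "\<dots> \<le> 6 * sqrt C * (?g t + ?g (pi - t))"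
          using g[of t] t C(1) by (intro mult_left_mono) auto
        finally show ?thesis .
      qed
    qed
    have BC: "\<bar>?P b t * ?P c t * sin t ^ 3\<bar> \<le> C" if t: "t \<in> {0..pi}" for t
    proof -
      have s: "sin t ^ 3 \<ge> 0" using t by (simp add: sin_ge_zero)
      have "(?P b t * ?P c t * sin t ^ 3)\<^sup>2 = (sin t ^ 3 * (?P b t)\<^sup>2) * (sin t ^ 3 * (?P c t)\<^sup>2)"
        by (simp add: power2_eq_square)
      also have "\<dots> \<le> C * C" using C t s by (intro mult_mono) auto
      finally have "(?P b t * ?P c t * sin t ^ 3)\<^sup>2 \<le> C\<^sup>2" by (simp add: power2_eq_square)
      then have "\<bar>?P b t * ?P c t * sin t ^ 3\<bar> \<le> \<bar>C\<bar>" by (simp only: abs_le_square_iff)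
      then show ?thesis using C(1) by simp
    qed
    have h: "((\<lambda>t. 6 * sqrt C * C * (?g t + ?g (pi - t))) has_integral 6 * sqrt C * C * (I + I)) {0..pi}"
      by (intro has_integral_mult_right has_integral_add I I')
    have "norm (zonal_integral (normalized_gegenbauer a * normalized_gegenbauer b * normalized_gegenbauer c))
       \<le> integral {0..pi} (\<lambda>t. 6 * sqrt C * C * (?g t + ?g (pi - t)))"
      unfolding zonal_integral_def
    proof (rule integral_norm_bound_integral[OF zonal_integrand_integrable])
      show "(\<lambda>t. 6 * sqrt C * C * (?g t + ?g (pi - t))) integrable_on {0..pi}" using h by blast
      fix t assume t: "t \<in> {0..pi}"
      have "norm (poly (normalized_gegenbauer a * normalized_gegenbauer b * normalized_gegenbauer c) (cos t) * sin t ^ 3)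
        = \<bar>?P a t\<bar> * \<bar>?P b t * ?P c t * sin t ^ 3\<bar>" by (simp add: abs_mult)
      also have "\<dots> \<le> (6 * sqrt C * (?g t + ?g (pi - t))) * C"
        using A[OF t] BC[OF t] by (intro mult_mono) (auto intro: order_trans[OF abs_ge_zero])
      finally show "norm (poly (normalized_gegenbauer a * normalized_gegenbauer b * normalized_gegenbauer c) (cos t) * sin t ^ 3)
        \<le> 6 * sqrt C * C * (?g t + ?g (pi - t))" by (simp only: mult_ac)
    qed
    also have "\<dots> = 6 * sqrt C * C * (I + I)" using h by (rule integral_unique)
    also have "\<dots> \<le> 6 * sqrt C * C * (2 * sqrt K + 2 * sqrt K)"
      using I(2) C(1) by (intro mult_left_mono add_mono) auto
    finally show ?thesis by (simp add: K_def algebra_simps)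
  qed
  moreover have "24 * C * sqrt C > 0" using C(1) by simp
  ultimately show thesis using that by blast
qed

section \<open>Lattice points on short arcs of circles\<close>

lemma card_divisors_le_prod:
  fixes n :: nat
  assumes "n > 0"
  shows "card {k. k dvd n} \<le> (\<Prod>p\<in>prime_factors n. multiplicity p n + 1)"
proof -
  let ?f = "\<lambda>k. restrict (\<lambda>p. multiplicity p k) (prime_factors n)"
  let ?S = "PiE (prime_factors n) (\<lambda>p. {0..multiplicity p n})"
  have "card {k. k dvd n} \<le> card ?S"
  proof (rule card_inj_on_le[where f = ?f])
    show "inj_on ?f {k. k dvd n}"
    proof (rule inj_onI)
      fix x y assume x: "x \<in> {k. k dvd n}" and y: "y \<in> {k. k dvd n}" and eq: "?f x = ?f y"
      have xy: "x dvd n" "y dvd n" using x y by simp_all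
      have pos: "x > 0" "y > 0" using dvd_pos_nat[OF assms] xy by simp_all
      show "x = y"
      proof (rule multiplicity_eq_nat[OF pos])
        fix p :: nat assume p: "prime p"
        show "multiplicity p x = multiplicity p y"
        proof (cases "p \<in> prime_factors n")
          case True
          then have "?f x p = multiplicity p x" "?f y p = multiplicity p y" by (simp_all only: restrict_apply if_True)
          then show ?thesis using fun_cong[OF eq, of p] by (simp only:)
        next
          case False
          then have "\<not> p dvd n" using p assms by (simp add: prime_factors_dvd)
          then have "\<not> p dvd x" "\<not> p dvd y"
            using dvd_trans[of p x n] dvd_trans[of p y n] xy by auto
          then show ?thesis by (simp add: not_dvd_imp_multiplicity_0)
        qed
      qed
    qed
    show "?f ` {k. k dvd n} \<subseteq> ?S"
    proof (rule image_subsetI)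
      fix k assume "k \<in> {k. k dvd n}"
      then have "multiplicity p k \<le> multiplicity p n" for p
        using assms by (simp add: dvd_imp_multiplicity_le)
      then show "?f k \<in> ?S" by (simp add: PiE_iff)
    qed
    show "finite ?S" by (intro finite_PiE) auto
  qed
  also have "card ?S = (\<Prod>p\<in>prime_factors n. multiplicity p n + 1)"
    by (simp add: card_PiE)
  finally show ?thesis .
qed

text \<open>Compare the product of the (a + 1) with that of the p^(a \<epsilon>), prime by prime.
  For p >= 2^(1/\<epsilon>) the quotient is at most 1 since a + 1 <= 2^a; each of the boundedly many
  smaller primes costs a factor \<open>K\<close>.\<close>

lemma divisor_bound:
  fixes \<epsilon> :: real
  assumes e: "\<epsilon> > 0"
  obtains C where "C > 0" "\<And>n::nat. n > 0 \<Longrightarrow> real (card {k. k dvd n}) \<le> C * real n powr \<epsilon>"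
proof -
  \<comment> \<open>Chosen so that a + 1 <= K (1 + a \<epsilon> ln 2), which is at most K 2^(a
    \<epsilon>) by exp x >= 1 + x.\<close>
  define K where "K = max 1 (1 / (\<epsilon> * ln 2))"
  have K: "K \<ge> 1" "K * (\<epsilon> * ln 2) \<ge> 1"
  proof -
    show "K \<ge> 1" by (simp add: K_def)
    have "K * (\<epsilon> * ln 2) \<ge> 1 / (\<epsilon> * ln 2) * (\<epsilon> * ln 2)"
      using e by (intro mult_right_mono) (auto simp: K_def)
    then show "K * (\<epsilon> * ln 2) \<ge> 1" using e by simp
  qed
  define B where "B = nat \<lceil>2 powr (1 / \<epsilon>)\<rceil>"
  let ?k = "\<lambda>p. if p \<le> B then K else 1"
  have factor: "real a + 1 \<le> ?k p * (real p ^ a) powr \<epsilon>" if p: "prime p" for p a :: nat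
  proof -
    have p2: "real p \<ge> 2" using prime_ge_2_nat[OF p] by simp
    have pw: "(real p ^ a) powr \<epsilon> = real p powr (real a * \<epsilon>)"
    proof -
      have "real p ^ a = real p powr real a" using p2 by (simp add: powr_realpow)
      then show ?thesis by (simp only: powr_powr)
    qed
    show ?thesis
    proof (cases "p \<le> B")
      case True
      have "1 + real a * (\<epsilon> * ln 2) \<le> exp (real a * (\<epsilon> * ln 2))" by (rule exp_ge_add_one_self)
      also have "\<dots> = 2 powr (real a * \<epsilon>)" by (simp add: powr_def mult_ac)
      also have "\<dots> \<le> real p powr (real a * \<epsilon>)" using p2 e by (intro powr_mono2) auto
      finally have "K * (1 + real a * (\<epsilon> * ln 2)) \<le> K * real p powr (real a * \<epsilon>)" using K by (intro mult_left_mono) auto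
      moreover have "1 + real a \<le> K + real a * (K * (\<epsilon> * ln 2))"
        using K mult_left_mono[OF K(2), of "real a"] by simp
      ultimately show ?thesis using True pw by (simp add: algebra_simps)
    next
      case False
      then have "real p \<ge> 2 powr (1 / \<epsilon>)" unfolding B_def by linarith
      then have "real p powr \<epsilon> \<ge> (2 powr (1 / \<epsilon>)) powr \<epsilon>" using e by (intro powr_mono2) auto
      then have "real p powr \<epsilon> \<ge> 2" using e by (simp add: powr_powr)
      then have "(real p powr \<epsilon>) powr (real a) \<ge> 2 powr (real a)" by (intro powr_mono2) auto
      then have "real p powr (real a * \<epsilon>) \<ge> 2 ^ a" by (simp add: powr_powr powr_realpow mult.commute)
      moreover have "Suc a \<le> 2 ^ a" by (rule Suc_leI[OF less_exp])
      then have "real (Suc a) \<le> real (2 ^ a)" by (simp only: of_nat_le_iff)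
      then have "real a + 1 \<le> 2 ^ a" by simp
      ultimately show ?thesis using False pw by simp
    qed
  qed
  have "real (card {k. k dvd n}) \<le> K ^ (B + 1) * real n powr \<epsilon>" if n: "n > 0" for n :: nat
  proof -
    have "real (card {k. k dvd n}) \<le> (\<Prod>p\<in>prime_factors n. real (multiplicity p n) + 1)"
      using of_nat_mono[OF card_divisors_le_prod[OF n], where 'a = real] by (simp add: add.commute)
    also have "\<dots> \<le> (\<Prod>p\<in>prime_factors n. ?k p * (real p ^ multiplicity p n) powr \<epsilon>)"
      by (intro prod_mono conjI factor) auto
    also have "\<dots> = (\<Prod>p\<in>prime_factors n. ?k p) * (\<Prod>p\<in>prime_factors n. (real p ^ multiplicity p n) powr \<epsilon>)"
      by (rule prod.distrib)
    also have "(\<Prod>p\<in>prime_factors n. (real p ^ multiplicity p n) powr \<epsilon>) = (\<Prod>p\<in>prime_factors n. real p ^ multiplicity p n) powr \<epsilon>"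
      by (rule prod_powr_distrib[symmetric])
    also have "(\<Prod>p\<in>prime_factors n. real p ^ multiplicity p n) = real n"
    proof -
      have "(\<Prod>p\<in>prime_factors n. real p ^ multiplicity p n) = real (\<Prod>p\<in>prime_factors n. p ^ multiplicity p n)"
        by simp
      also have "(\<Prod>p\<in>prime_factors n. p ^ multiplicity p n) = n" by (rule prime_factorization_nat[OF n, symmetric])
      finally show ?thesis .
    qed
    also have "(\<Prod>p\<in>prime_factors n. ?k p) = K ^ card (prime_factors n \<inter> {p. p \<le> B})"
      by (subst prod.If_cases) simp_all
    also have "K ^ card (prime_factors n \<inter> {p. p \<le> B}) \<le> K ^ (B + 1)"
    proof (rule power_increasing[OF _ K(1)])
      have "card (prime_factors n \<inter> {p. p \<le> B}) \<le> card {..B}" by (rule card_mono) auto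
      then show "card (prime_factors n \<inter> {p. p \<le> B}) \<le> B + 1" by simp
    qed
    finally show ?thesis by (simp add: mult_right_mono)
  qed
  moreover have "K ^ (B + 1) > 0" using K by simp
  ultimately show thesis using that by blast
qed

text \<open>Parity of the exponent of 3. It excludes two lattice points on a circle seen under an
  angle of 30 or 150 degrees in the classification below.\<close>

lemma int_square_eq_3_square:
  fixes x y :: int
  assumes "x\<^sup>2 = 3 * y\<^sup>2"
  shows "y = 0"
proof (rule ccontr)
  assume y: "y \<noteq> 0"
  then have x: "x \<noteq> 0" using assms by auto
  have p: "prime_elem (3::int)" by simp
  have "multiplicity 3 (x\<^sup>2) = 2 * multiplicity 3 x"
    using p x by (simp add: prime_elem_multiplicity_power_distrib)
  moreover have "multiplicity 3 (3 * y\<^sup>2) = 1 + 2 * multiplicity 3 y"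
    using p y by (simp add: prime_elem_multiplicity_mult_distrib prime_elem_multiplicity_power_distrib)
  ultimately have "2 * multiplicity 3 x = 1 + 2 * multiplicity 3 y" using assms by simp
  then show False by presburger
qed

section \<open>Representations as a sum of two squares\<close>

definition primitive_reps :: "int \<Rightarrow> (int \<times> int) set" where
  "primitive_reps m = {(u, v). u\<^sup>2 + v\<^sup>2 = m \<and> coprime u v}"

lemma finite_two_square_reps: "finite {(u :: int, v :: int). u\<^sup>2 + v\<^sup>2 = m}"
proof (rule finite_subset)
  have b: "\<bar>u\<bar> \<le> m" if "u\<^sup>2 + v\<^sup>2 = m" for u v :: int
  proof -
    have "\<bar>u\<bar> \<le> u\<^sup>2"
    proof (cases "u = 0")
      case False
      then have "\<bar>u\<bar> * 1 \<le> \<bar>u\<bar> * \<bar>u\<bar>" by (intro mult_left_mono) auto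
      then show ?thesis by (simp add: power2_eq_square)
    qed simp
    then show ?thesis using that zero_le_power2[of v] by linarith
  qed
  show "{(u :: int, v :: int). u\<^sup>2 + v\<^sup>2 = m} \<subseteq> {-m..m} \<times> {-m..m}"
  proof
    fix z assume "z \<in> {(u :: int, v :: int). u\<^sup>2 + v\<^sup>2 = m}"
    then obtain u v where z: "z = (u, v)" "u\<^sup>2 + v\<^sup>2 = m" by auto
    have "\<bar>u\<bar> \<le> m" "\<bar>v\<bar> \<le> m" using b[of u v] b[of v u] z(2) by (simp_all add: add.commute)
    then show "z \<in> {-m..m} \<times> {-m..m}" unfolding z(1) by auto
  qed
qed simp

text \<open>Two primitive points \<open>z\<close>, \<open>z'\<close> with the same gcd are related by \<open>m | 2 Im (z' cnj z)\<close>,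
  which leaves only the four associates of \<open>z\<close>.\<close>

lemma primitive_rep_associate:
  fixes a b u v u' v' m :: int
  assumes m: "m > 0" and ab: "a\<^sup>2 + b\<^sup>2 = m" "coprime a b" and uv: "u\<^sup>2 + v\<^sup>2 = m" "coprime u v"
    and uv': "u'\<^sup>2 + v'\<^sup>2 = m" "coprime u' v'"
    and key: "gcd m (u * b - v * a) = gcd m (u' * b - v' * a)"
  shows "(u', v') \<in> {(u, v), (- u, - v), (- v, u), (v, - u)}"
proof -
  have cop: "coprime m y" if xym: "x\<^sup>2 + y\<^sup>2 = m" and "coprime x y" for x y :: int
  proof -
    have "coprime (x\<^sup>2) y" using that(2) by simp
    moreover have "c dvd x\<^sup>2" if "c dvd m" "c dvd y" for c
    proof -
      have "c dvd m - y\<^sup>2" using that by (simp add: power2_eq_square)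
      moreover have "m - y\<^sup>2 = x\<^sup>2" using xym by simp
      ultimately show ?thesis by simp
    qed
    ultimately show ?thesis by (meson coprime_common_divisor coprimeI)
  qed
  \<comment> \<open>Up to the prime 2, \<open>d\<close> is the part of m at which u + i v and a + i
    b contain the same one of two conjugate Gaussian primes, and \<open>e\<close> the part at which
    they contain opposite ones.\<close>
  define d where "d = gcd m (u * b - v * a)"
  define e where "e = m div d"
  \<comment> \<open>S + i D is the product of u' + i v' with the conjugate of u + i v; its modulus
    is m.\<close>
  define D where "D = u * v' - u' * v"
  define S where "S = u * u' + v * v'"
  have d0: "d > 0" using m by (simp add: d_def)
  have de: "d * e = m" by (simp add: e_def d_def)
  have dm: "d dvd m" "e dvd m" using de by (metis dvd_triv_left, metis dvd_triv_right)
  have cb: "coprime m b" "coprime m u" using cop[OF ab] cop[of v u] uv by (auto simp: add.commute coprime_commute)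
  have d1: "d dvd u * b - v * a" by (simp add: d_def)
  have d2: "d dvd u' * b - v' * a" unfolding d_def key by simp
  have "d dvd v' * (u * b - v * a) - v * (u' * b - v' * a)"
    by (rule dvd_diff[OF dvd_mult[OF d1] dvd_mult[OF d2]])
  also have "v' * (u * b - v * a) - v * (u' * b - v' * a) = D * b" by (simp add: D_def algebra_simps)
  finally have dD: "d dvd D"
    using cb(1) dm(1) by (metis coprime_dvd_mult_left_iff coprime_divisors dvd_refl)
  \<comment> \<open>The two conjugate forms have product m (b^2 - y^2). Cancelling d from the first
    leaves a factor coprime to e, so e divides the second form.\<close>
  have e_dvd: "e dvd x * b + y * a" if "x\<^sup>2 + y\<^sup>2 = m" "gcd m (x * b - y * a) = d" for x y
  proof -
    have "(x * b - y * a) * (x * b + y * a) = m * (b\<^sup>2 - y\<^sup>2)"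
    proof -
      have e: "a\<^sup>2 = m - b\<^sup>2" "x\<^sup>2 = m - y\<^sup>2" using ab(1) that(1) by auto
      have "(x * b - y * a) * (x * b + y * a) = x\<^sup>2 * b\<^sup>2 - y\<^sup>2 * a\<^sup>2"
        by (simp add: algebra_simps power2_eq_square)
      then show ?thesis unfolding e by (simp add: algebra_simps)
    qed
    then have "d * e dvd (x * b - y * a) * (x * b + y * a)" unfolding de by simp
    moreover have "x * b - y * a = d * ((x * b - y * a) div d)" using that(2) by (metis dvd_mult_div_cancel gcd_dvd2)
    ultimately have "d * e dvd d * (((x * b - y * a) div d) * (x * b + y * a))" by (metis mult.assoc)
    then have "e dvd ((x * b - y * a) div d) * (x * b + y * a)" using d0 by simp
    moreover have "coprime e ((x * b - y * a) div d)"
      unfolding e_def that(2)[symmetric] using m by (intro div_gcd_coprime) auto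
    ultimately show ?thesis by (metis coprime_dvd_mult_right_iff)
  qed
  have e1: "e dvd u * b + v * a" by (rule e_dvd[OF uv(1)]) (simp add: d_def)
  have e2: "e dvd u' * b + v' * a" by (rule e_dvd[OF uv'(1)]) (simp add: d_def key)
  have "e dvd v' * (u * b + v * a) - v * (u' * b + v' * a)"
    by (rule dvd_diff[OF dvd_mult[OF e1] dvd_mult[OF e2]])
  also have "v' * (u * b + v * a) - v * (u' * b + v' * a) = D * b" by (simp add: D_def algebra_simps)
  finally have eD: "e dvd D"
    using cb(1) dm(2) by (metis coprime_dvd_mult_left_iff coprime_divisors dvd_refl)
  \<comment> \<open>A common divisor of d and e divides the sum 2 u b of both forms, while u and b
    are coprime to m. So only the prime 2 can be shared, at the price of the factor 2 in m | 2
    D.\<close>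
  have g2: "gcd d e dvd 2"
  proof -
    have gm: "gcd d e dvd m" using dm(1) dvd_trans gcd_dvd1 by blast
    have "gcd d e dvd (u * b - v * a) + (u * b + v * a)"
      using dvd_trans[OF gcd_dvd1 d1] dvd_trans[OF gcd_dvd2 e1] by (rule dvd_add)
    also have "(u * b - v * a) + (u * b + v * a) = 2 * (u * b)" by simp
    finally have "gcd d e dvd 2 * (u * b)" .
    moreover have "coprime (gcd d e) (u * b)"
      using cb gm by (metis coprime_divisors coprime_mult_right_iff dvd_refl)
    ultimately show ?thesis by (metis coprime_dvd_mult_left_iff)
  qed
  have "lcm d e dvd D" using dD eD by simp
  then have "gcd d e * lcm d e dvd 2 * D" using g2 by (rule mult_dvd_mono[rotated])
  then have "m dvd 2 * D"
    using de m d0 by (metis abs_of_pos prod_gcd_lcm_int abs_dvd_iff abs_mult)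
  then obtain k where k: "2 * D = m * k" by blast
  have DS: "D\<^sup>2 + S\<^sup>2 = m\<^sup>2"   proof -
    have "D\<^sup>2 + S\<^sup>2 = (u\<^sup>2 + v\<^sup>2) * (u'\<^sup>2 + v'\<^sup>2)"
      unfolding D_def S_def by (simp add: algebra_simps power2_eq_square)
    then show ?thesis unfolding uv(1) uv'(1) by (simp add: power2_eq_square)
  qed
  have kS: "(2 * S)\<^sup>2 = (4 - k\<^sup>2) * m\<^sup>2"   proof -
    have "(2 * S)\<^sup>2 = 4 * m\<^sup>2 - (2 * D)\<^sup>2" using DS by (simp add: power_mult_distrib)
    then show ?thesis unfolding k by (simp add: power_mult_distrib algebra_simps)
  qed
  have "0 \<le> (4 - k\<^sup>2) * m\<^sup>2" using kS by (metis zero_le_power2)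
  then have "k\<^sup>2 \<le> 2\<^sup>2" using m by (simp add: zero_le_mult_iff)
  then have "\<bar>k\<bar> \<le> 2" by (metis abs_le_square_iff abs_numeral)
  then have "k = 0 \<or> k = 2 \<or> k = -2 \<or> k = 1 \<or> k = -1" by linarith
  \<comment> \<open>D = m k / 2 is m times the sine of the angle between the two points; k = 1 or -1
    would give (2 S)^2 = 3 m^2. What is left are multiples of a right angle.\<close>
  moreover have "k \<noteq> 1" "k \<noteq> -1" using int_square_eq_3_square[of "2 * S" m] kS m by auto
  ultimately have k3: "k = 0 \<or> k = 2 \<or> k = -2" by blast
  have canc: "x = y" if "m * x = m * y" for x y using that m by simp
  have mu: "m * u' = u * S - v * D" and mv: "m * v' = v * S + u * D"
    unfolding D_def S_def uv(1)[symmetric] by (simp_all add: algebra_simps power2_eq_square)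
  have "(D = 0 \<and> S\<^sup>2 = m\<^sup>2) \<or> (S = 0 \<and> (D = m \<or> D = - m))"
    using k3 k kS m by (auto simp: power_mult_distrib)
  then consider "D = 0" "S = m" | "D = 0" "S = - m" | "S = 0" "D = m" | "S = 0" "D = - m"
    by (auto simp: power2_eq_iff)
  then show ?thesis
  proof cases
    case 1 then show ?thesis using canc[of u' u] canc[of v' v] mu mv by (simp add: mult.commute)
  next
    case 2 then show ?thesis using canc[of u' "- u"] canc[of v' "- v"] mu mv by (simp add: mult.commute)
  next
    case 3 then show ?thesis using canc[of u' "- v"] canc[of v' u] mu mv by (simp add: mult.commute)
  next
    case 4 then show ?thesis using canc[of u' v] canc[of v' "- u"] mu mv by (simp add: mult.commute)
  qed
qed

lemma finite_int_divisors: "(m::int) > 0 \<Longrightarrow> finite {d. d > 0 \<and> d dvd m}"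
  by (rule finite_subset[of _ "{0..m}"]) (auto dest: zdvd_imp_le)

lemma card_int_divisors:
  assumes "(m::int) > 0"
  shows "card {d. d > 0 \<and> d dvd m} = card {k. k dvd nat m}"
proof -
  have "{d. d > 0 \<and> d dvd m} = int ` {k. k dvd nat m}"
  proof (intro subset_antisym subsetI)
    fix d assume "d \<in> {d. d > 0 \<and> d dvd m}"
    then have "d = int (nat d)" "nat d dvd nat m" using assms by (auto simp: nat_dvd_iff)
    then show "d \<in> int ` {k. k dvd nat m}" by blast
  next
    fix d assume "d \<in> int ` {k. k dvd nat m}"
    then obtain k where k: "d = int k" "k dvd nat m" by blast
    then have "k > 0" using assms by (auto intro!: Nat.gr0I)
    then show "d \<in> {d. d > 0 \<and> d dvd m}" using k assms by (simp add: int_dvd_int_iff[symmetric] del: int_dvd_int_iff)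
  qed
  then show ?thesis by (simp add: card_image)
qed

text \<open>One primitive point (a, b) is fixed as reference. The gcd against it labels all others
  by divisors of m, each label being shared by at most four associates.\<close>

lemma card_primitive_reps:
  assumes m: "m > 0"
  shows "card (primitive_reps m) \<le> 4 * card {k. k dvd nat m}"
proof (cases "primitive_reps m = {}")
  case False
  then obtain a b where ab: "a\<^sup>2 + b\<^sup>2 = m" "coprime a b" by (auto simp: primitive_reps_def)
  let ?key = "\<lambda>(u, v). gcd m (u * b - v * a)"
  let ?F = "\<lambda>d. {z \<in> primitive_reps m. ?key z = d}"
  let ?K = "{d. d > 0 \<and> d dvd m}"
  have "primitive_reps m \<subseteq> (\<Union>d\<in>?K. ?F d)" using m by auto
  moreover have finF: "card (?F d) \<le> 4 \<and> finite (?F d)" for d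
  proof (cases "?F d = {}")
    case True
    show ?thesis unfolding True by simp
  next
    case False
    then obtain u v where uv: "(u, v) \<in> primitive_reps m" "gcd m (u * b - v * a) = d" by auto
    have "?F d \<subseteq> {(u, v), (- u, - v), (- v, u), (v, - u)}"
    proof
      fix z assume "z \<in> ?F d"
      then obtain u' v' where z: "z = (u', v')" "u'\<^sup>2 + v'\<^sup>2 = m" "coprime u' v'" "gcd m (u' * b - v' * a) = d"
        by (auto simp: primitive_reps_def)
      show "z \<in> {(u, v), (- u, - v), (- v, u), (v, - u)}"
        unfolding z(1) by (rule primitive_rep_associate[OF m ab]) (use uv z in \<open>auto simp: primitive_reps_def\<close>)
    qed
    moreover have "card {(u, v), (- u, - v), (- v, u), (v, - u)} \<le> 4"
      by (intro card_insert_le_m1) auto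
    ultimately show ?thesis by (meson card_mono finite.emptyI finite.insertI finite_subset order_trans)
  qed
  ultimately have "card (primitive_reps m) \<le> card (\<Union>d\<in>?K. ?F d)"
    using finite_int_divisors[OF m] by (intro card_mono finite_UN_I) auto
  also have "\<dots> \<le> (\<Sum>d\<in>?K. card (?F d))" by (rule card_UN_le[OF finite_int_divisors[OF m]])
  also have "\<dots> \<le> (\<Sum>d\<in>?K. 4)" by (rule sum_mono) (use finF in blast)
  also have "\<dots> = 4 * card {k. k dvd nat m}" by (simp add: card_int_divisors[OF m])
  finally show ?thesis .
qed simp

text \<open>Dividing out g = gcd u v leaves a primitive representation of m / g^2. Both the possible
  g and, up to a factor 4, the primitive points for each g are counted by divisors of m, whence the
  square.\<close>

lemma card_two_square_reps:
  assumes m: "(m::int) > 0"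
  shows "card {(u :: int, v :: int). u\<^sup>2 + v\<^sup>2 = m} \<le> 4 * (card {k. k dvd nat m})\<^sup>2"
proof -
  let ?d = "card {k. k dvd nat m}"
  let ?G = "{g::int. g > 0 \<and> g\<^sup>2 dvd m}"
  have Gsub: "?G \<subseteq> {d. d > 0 \<and> d dvd m}"
  proof
    fix g :: int assume "g \<in> ?G"
    then have "g > 0" "g\<^sup>2 dvd m" by auto
    moreover have "g dvd g\<^sup>2" by (simp add: power2_eq_square)
    ultimately show "g \<in> {d. d > 0 \<and> d dvd m}" using dvd_trans[of g "g\<^sup>2" m] by simp
  qed
  have fG: "finite ?G" using finite_int_divisors[OF m] finite_subset[OF Gsub] by blast
  let ?I = "\<lambda>g. (\<lambda>(x, y). (g * x, g * y)) ` primitive_reps (m div g\<^sup>2)"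
  have finP: "finite (primitive_reps n)" for n
    by (rule finite_subset[OF _ finite_two_square_reps[of n]]) (auto simp: primitive_reps_def)
  have "{(u :: int, v :: int). u\<^sup>2 + v\<^sup>2 = m} \<subseteq> (\<Union>g\<in>?G. ?I g)"
  proof
    fix z assume "z \<in> {(u :: int, v :: int). u\<^sup>2 + v\<^sup>2 = m}"
    then obtain u v where z: "z = (u, v)" and uv: "m = u\<^sup>2 + v\<^sup>2" by auto
    define g where "g = gcd u v"
    have "u \<noteq> 0 \<or> v \<noteq> 0" using uv m by auto
    then have g: "g > 0" by (simp add: g_def)
    obtain x y where xy: "u = g * x" "v = g * y" "coprime x y"
      using gcd_coprime_exists[of u v] g unfolding g_def by (metis mult.commute less_irrefl)
    have e: "m = g\<^sup>2 * (x\<^sup>2 + y\<^sup>2)" unfolding uv xy by (simp add: algebra_simps power2_eq_square)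
    then have "(x, y) \<in> primitive_reps (m div g\<^sup>2)" using xy(3) g by (simp add: primitive_reps_def)
    then have "(u, v) \<in> ?I g" using xy by (intro image_eqI[of _ _ "(x, y)"]) auto
    moreover have "g \<in> ?G" using e g by simp
    ultimately show "z \<in> (\<Union>g\<in>?G. ?I g)" unfolding z by (rule UN_I[rotated])
  qed
  then have "card {(u :: int, v :: int). u\<^sup>2 + v\<^sup>2 = m} \<le> card (\<Union>g\<in>?G. ?I g)"
    using fG finP by (intro card_mono finite_UN_I) auto
  also have "\<dots> \<le> (\<Sum>g\<in>?G. card (?I g))" by (rule card_UN_le[OF fG])
  also have "\<dots> \<le> (\<Sum>g\<in>?G. 4 * ?d)"
  proof (rule sum_mono)
    fix g assume g: "g \<in> ?G"
    then obtain q where q: "m = g\<^sup>2 * q" by auto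
    have gq: "m div g\<^sup>2 = q" using g q by simp
    have q0: "q > 0" using m q g by (simp add: zero_less_mult_iff)
    have "card (?I g) \<le> card (primitive_reps q)" unfolding gq by (rule card_image_le[OF finP])
    also have "\<dots> \<le> 4 * card {k. k dvd nat q}" by (rule card_primitive_reps[OF q0])
    also have "card {k. k dvd nat q} \<le> ?d"
    proof (rule card_mono)
      show "finite {k. k dvd nat m}" using m by simp
      have "nat q dvd nat m" using q0 m q by (simp add: nat_dvd_iff)
      then show "{k. k dvd nat q} \<subseteq> {k. k dvd nat m}" using dvd_trans by blast
    qed
    finally show "card (?I g) \<le> 4 * ?d" by simp
  qed
  also have "\<dots> = card ?G * (4 * ?d)" by simp
  also have "card ?G \<le> ?d" unfolding card_int_divisors[OF m, symmetric]
    by (rule card_mono[OF finite_int_divisors[OF m] Gsub])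
  finally show ?thesis by (simp add: power2_eq_square)
qed

lemma two_square_bound:
  fixes \<epsilon> :: real
  assumes e: "\<epsilon> > 0"
  obtains C where "C > 0" "\<And>m::int. m > 0 \<Longrightarrow>
    real (card {(u :: int, v :: int). u\<^sup>2 + v\<^sup>2 = m}) \<le> C * real_of_int m powr \<epsilon>"
proof -
  obtain C where C: "C > 0" "\<And>n::nat. n > 0 \<Longrightarrow> real (card {k. k dvd n}) \<le> C * real n powr (\<epsilon> / 2)"
    using divisor_bound[of "\<epsilon> / 2"] e by auto
  have "real (card {(u :: int, v :: int). u\<^sup>2 + v\<^sup>2 = m}) \<le> (4 * C\<^sup>2) * real_of_int m powr \<epsilon>" if m: "m > 0" for m :: int
  proof -
    have "real (card {k. k dvd nat m}) \<le> C * real (nat m) powr (\<epsilon> / 2)" by (rule C(2)) (use m in simp)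
    also have "real (nat m) = real_of_int m" using m by simp
    finally have "(real (card {k. k dvd nat m}))\<^sup>2 \<le> (C * real_of_int m powr (\<epsilon> / 2))\<^sup>2"
      by (rule power_mono) simp
    also have "\<dots> = C\<^sup>2 * real_of_int m powr \<epsilon>"
      by (simp add: power_mult_distrib power2_eq_square powr_add[symmetric])
    finally have "4 * (real (card {k. k dvd nat m}))\<^sup>2 \<le> (4 * C\<^sup>2) * real_of_int m powr \<epsilon>" by simp
    moreover have "real (card {(u :: int, v :: int). u\<^sup>2 + v\<^sup>2 = m}) \<le> real (4 * (card {k. k dvd nat m})\<^sup>2)"
      using card_two_square_reps[OF m] by (simp only: of_nat_le_iff)
    ultimately show ?thesis by simp
  qed
  moreover have "4 * C\<^sup>2 > 0" using C by simp
  ultimately show thesis using that by blast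
qed

section \<open>Concyclic lattice points on a short arc\<close>

text \<open>For three lattice points on a circle of squared radius \<open>R\<close>, the triangle formula
  \<open>area = abc / (4 radius)\<close> reads \<open>4 R D\<^sup>2 = a\<^sup>2 b\<^sup>2 c\<^sup>2\<close>, where the integer \<open>D\<close> is twice the area.\<close>

lemma circle_triangle_identity:
  fixes R :: int
  assumes "u1\<^sup>2 + v1\<^sup>2 = R" "u2\<^sup>2 + v2\<^sup>2 = R" "u3\<^sup>2 + v3\<^sup>2 = R"
  shows "4 * R * ((u2 - u1) * (v3 - v1) - (u3 - u1) * (v2 - v1))\<^sup>2 =
    ((u1 - u2)\<^sup>2 + (v1 - v2)\<^sup>2) * ((u2 - u3)\<^sup>2 + (v2 - v3)\<^sup>2) * ((u3 - u1)\<^sup>2 + (v3 - v1)\<^sup>2)"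
proof -
  have v: "v1 ^ 2 = R - u1 ^ 2" "v2 ^ 2 = R - u2 ^ 2" "v3 ^ 2 = R - u3 ^ 2" using assms by auto
  show ?thesis using v by algebra
qed

text \<open>The squared radius R is compared with L^6. Below 128 L^6 all points of the circle are
  counted, at cost R^(\<epsilon>/6); above it three points on the arc would span too small a
  triangle. The sign condition on v selects one arc and makes u a faithful coordinate on it.\<close>

lemma card_short_arc:
  fixes \<epsilon> :: real
  assumes e: "\<epsilon> > 0"
  obtains C where "C > 0" "\<And>(R::int) (L::nat). L \<ge> 1 \<Longrightarrow>
    finite {u::int. \<bar>u\<bar> \<le> int L \<and> (\<exists>v\<ge>0. u\<^sup>2 + v\<^sup>2 = R)} \<and>
    real (card {u::int. \<bar>u\<bar> \<le> int L \<and> (\<exists>v\<ge>0. u\<^sup>2 + v\<^sup>2 = R)}) \<le> C * real L powr \<epsilon>"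
proof -
  obtain C where C: "C > 0" "\<And>m::int. m > 0 \<Longrightarrow>
    real (card {(u :: int, v :: int). u\<^sup>2 + v\<^sup>2 = m}) \<le> C * real_of_int m powr (\<epsilon> / 6)"
    using two_square_bound[of "\<epsilon> / 6"] e by auto
  \<comment> \<open>The first term serves 0 < R <= 128 L^6, the summand 2 the two remaining
    cases.\<close>
  define B where "B = C * 128 powr (\<epsilon> / 6) + 2"
  have "finite {u::int. \<bar>u\<bar> \<le> int L \<and> (\<exists>v\<ge>0. u\<^sup>2 + v\<^sup>2 = R)} \<and>
    real (card {u::int. \<bar>u\<bar> \<le> int L \<and> (\<exists>v\<ge>0. u\<^sup>2 + v\<^sup>2 = R)}) \<le> B * real L powr \<epsilon>"
    if L: "L \<ge> 1" for R :: int and L :: nat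
  proof -
    let ?A = "{u::int. \<bar>u\<bar> \<le> int L \<and> (\<exists>v\<ge>0. u\<^sup>2 + v\<^sup>2 = R)}"
    have fin: "finite ?A" by (rule finite_subset[of _ "{- int L..int L}"]) auto
    have L1: "real L powr \<epsilon> \<ge> 1" using L e by (intro ge_one_powr_ge_zero) auto
    have B2: "B * real L powr \<epsilon> \<ge> C * 128 powr (\<epsilon> / 6) * real L powr \<epsilon> + 2"
      using L1 by (simp add: B_def distrib_right)
    have CL: "C * 128 powr (\<epsilon> / 6) * real L powr \<epsilon> \<ge> 0" using C(1) by simp
    consider "R \<le> 0" | "0 < R" "R \<le> 128 * int L ^ 6" | "R > 128 * int L ^ 6" by linarith
    then have "real (card ?A) \<le> B * real L powr \<epsilon>"
    proof cases
      case 1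
      have "u = 0" if "u\<^sup>2 + v\<^sup>2 = R" for u v :: int
      proof -
        have "u\<^sup>2 \<le> 0" using that 1 zero_le_power2[of v] by linarith
        then show ?thesis by simp
      qed
      then have "?A \<subseteq> {0}" by auto
      then have "card ?A \<le> card {0::int}" by (intro card_mono) auto
      then have "real (card ?A) \<le> 2" by simp
      also have "\<dots> \<le> B * real L powr \<epsilon>" using B2 CL by linarith
      finally show ?thesis .
    next
      case 2
      have "?A \<subseteq> fst ` {(u :: int, v :: int). u\<^sup>2 + v\<^sup>2 = R}" by force
      then have "card ?A \<le> card (fst ` {(u :: int, v :: int). u\<^sup>2 + v\<^sup>2 = R})"
        by (intro card_mono finite_imageI finite_two_square_reps)
      also have "\<dots> \<le> card {(u :: int, v :: int). u\<^sup>2 + v\<^sup>2 = R}"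
        by (rule card_image_le[OF finite_two_square_reps])
      finally have "real (card ?A) \<le> real (card {(u :: int, v :: int). u\<^sup>2 + v\<^sup>2 = R})" by simp
      also have "\<dots> \<le> C * real_of_int R powr (\<epsilon> / 6)" by (rule C(2)[OF 2(1)])
      also have "\<dots> \<le> C * (128 * real L ^ 6) powr (\<epsilon> / 6)"
      proof -
        have "real_of_int R \<le> real_of_int (128 * int L ^ 6)" using 2(2) by (simp only: of_int_le_iff)
        then show ?thesis using C(1) 2(1) e by (intro mult_left_mono powr_mono2) auto
      qed
      also have "(128 * real L ^ 6) powr (\<epsilon> / 6) = 128 powr (\<epsilon> / 6) * real L powr \<epsilon>"
      proof -
        have "real L ^ 6 = real L powr 6" using L by (simp add: powr_numeral)
        then have "(real L ^ 6) powr (\<epsilon> / 6) = real L powr \<epsilon>" by (simp only: powr_powr) simp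
        then show ?thesis by (simp add: powr_mult)
      qed
      finally show ?thesis using B2 by simp
    next
      case 3
      have "card ?A \<le> 2"
      proof (rule ccontr)
        assume "\<not> card ?A \<le> 2"
        then have "3 \<le> card ?A" by simp
        then obtain T where T: "T \<subseteq> ?A" "card T = 3" by (rule obtain_subset_with_card_n)
        then obtain u1 u2 u3 where u: "T = {u1, u2, u3}" "u1 \<noteq> u2" "u2 \<noteq> u3" "u1 \<noteq> u3"
          by (auto simp: card_3_iff)
        obtain v1 v2 v3 where v: "v1 \<ge> 0" "u1\<^sup>2 + v1\<^sup>2 = R" "v2 \<ge> 0" "u2\<^sup>2 + v2\<^sup>2 = R" "v3 \<ge> 0" "u3\<^sup>2 + v3\<^sup>2 = R"
          using T(1) u(1) by auto
        have ub: "\<bar>u1\<bar> \<le> int L" "\<bar>u2\<bar> \<le> int L" "\<bar>u3\<bar> \<le> int L" using T(1) u(1) by auto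
        have "1 \<le> int L ^ 4" using L by simp
        then have "int L ^ 2 * 1 \<le> int L ^ 2 * int L ^ 4" by (intro mult_left_mono) auto
        then have "int L ^ 2 \<le> int L ^ 6" by (simp flip: power_add)
        then have R2: "R \<ge> 2 * int L ^ 2" using 3 zero_le_power2[of "int L"] by linarith
        have vL: "int L \<le> v" if "v \<ge> 0" "u\<^sup>2 + v\<^sup>2 = R" "\<bar>u\<bar> \<le> int L" for u v
        proof -
          have "u\<^sup>2 \<le> (int L)\<^sup>2" using that(3) by (simp add: abs_le_square_iff[symmetric])
          then have "(int L)\<^sup>2 \<le> v\<^sup>2" using R2 that(2) by linarith
          then show ?thesis using that(1) by (rule power2_le_imp_le)
        qed
        \<comment> \<open>Since v >= L >= |u| the arc has slope at most 1, so |v - v'| <= |u - u'|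
          <= 2 L.\<close>
        have chord: "(u - u')\<^sup>2 + (v - v')\<^sup>2 \<le> 8 * int L ^ 2"
          if h: "v \<ge> 0" "u\<^sup>2 + v\<^sup>2 = R" "\<bar>u\<bar> \<le> int L" "v' \<ge> 0" "u'\<^sup>2 + v'\<^sup>2 = R" "\<bar>u'\<bar> \<le> int L" for u v u' v'
        proof -
          have p: "int L > 0" using L by simp
          have V: "v + v' \<ge> 2 * int L" using vL[OF h(1-3)] vL[OF h(4-6)] by linarith
          have "(v - v') * (v + v') = (u' - u) * (u' + u)"
            using h(2,5) by (simp add: algebra_simps power2_eq_square)
          then have "\<bar>v - v'\<bar> * \<bar>v + v'\<bar> = \<bar>u' - u\<bar> * \<bar>u' + u\<bar>" by (simp flip: abs_mult)
          also have "\<dots> \<le> \<bar>u' - u\<bar> * (2 * int L)" using h(3,6) by (intro mult_left_mono) auto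
          finally have "\<bar>v - v'\<bar> * (v + v') \<le> \<bar>u' - u\<bar> * (2 * int L)" using h by simp
          moreover have "\<bar>v - v'\<bar> * (2 * int L) \<le> \<bar>v - v'\<bar> * (v + v')" using V by (intro mult_left_mono) auto
          ultimately have "\<bar>v - v'\<bar> * (2 * int L) \<le> \<bar>u' - u\<bar> * (2 * int L)" by linarith
          then have "\<bar>v - v'\<bar> \<le> \<bar>u' - u\<bar>" using p by simp
          also have "\<bar>u' - u\<bar> \<le> \<bar>2 * int L\<bar>" using h(3,6) by linarith
          finally have a: "(v - v')\<^sup>2 \<le> (2 * int L)\<^sup>2" by (simp only: abs_le_square_iff)
          have "\<bar>u - u'\<bar> \<le> \<bar>2 * int L\<bar>" using h(3,6) by linarith
          then have b: "(u - u')\<^sup>2 \<le> (2 * int L)\<^sup>2" by (simp only: abs_le_square_iff)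
          from a b show ?thesis by (simp add: power_mult_distrib)
        qed
        let ?c1 = "(u1 - u2)\<^sup>2 + (v1 - v2)\<^sup>2" let ?c2 = "(u2 - u3)\<^sup>2 + (v2 - v3)\<^sup>2" let ?c3 = "(u3 - u1)\<^sup>2 + (v3 - v1)\<^sup>2"
        let ?D = "(u2 - u1) * (v3 - v1) - (u3 - u1) * (v2 - v1)"
        have id: "4 * R * ?D\<^sup>2 = ?c1 * ?c2 * ?c3" by (rule circle_triangle_identity[OF v(2,4,6)])
        have pos: "?c1 > 0" "?c2 > 0" "?c3 > 0" using u(2-4) by (auto simp: sum_power2_gt_zero_iff)
        \<comment> \<open>Distinct points of a circle are not collinear, so the integer D^2 is at
          least 1; but 4 R D^2 <= (8 L^2)^3 = 512 L^6, against R > 128 L^6.\<close>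
        have "?D \<noteq> 0" using id pos by auto
        have R0: "0 \<le> R" using R2 zero_le_power2[of "int L"] by linarith
        from \<open>?D \<noteq> 0\<close> have "1 \<le> ?D\<^sup>2" by (metis int_one_le_iff_zero_less zero_less_power2)
        then have "4 * R * 1 \<le> 4 * R * ?D\<^sup>2" using R0 by (intro mult_left_mono) auto
        also have "\<dots> \<le> (8 * int L ^ 2) * (8 * int L ^ 2) * (8 * int L ^ 2)"
          unfolding id using pos chord[OF v(1,2) ub(1) v(3,4) ub(2)] chord[OF v(3,4) ub(2) v(5,6) ub(3)]
            chord[OF v(5,6) ub(3) v(1,2) ub(1)] by (intro mult_mono) auto
        also have "\<dots> = 512 * int L ^ 6" by (simp flip: power_add)
        finally show False using 3 by simp
      qed
      then have "real (card ?A) \<le> 2" by simp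
      also have "\<dots> \<le> B * real L powr \<epsilon>" using B2 CL by linarith
      finally show ?thesis .
    qed
    then show ?thesis using fin by blast
  qed
  moreover have "B > 0" using C(1) by (simp add: B_def add_pos_pos)
  ultimately show thesis using that by blast
qed

section \<open>Decay of the time cutoff\<close>

text \<open>Two integrations by parts. Quadratic decay is as much as the summation over integer
  levels requires; integrability is recorded for exchanging the time integral with finite
  sums.\<close>

lemma test_function_fourier_decay:
  fixes chi :: "real \<Rightarrow> complex"
  assumes "test_function chi"
  obtains C where "C > 0"
    "\<And>\<xi>. cmod (LINT t|lborel. chi t * exp (\<i> * of_real (t * \<xi>))) \<le> C / (1 + \<xi>\<^sup>2)"
    "\<And>\<xi>. integrable lborel (\<lambda>t. chi t * exp (\<i> * of_real (t * \<xi>)))"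
proof -
  let ?D = "\<lambda>f t. frechet_derivative f (at t) (1::real) :: complex"
  have "Ck_on 2 UNIV chi" and cpt: "compact (closure {x. chi x \<noteq> 0})"
    using assms by (auto simp: test_function_def smooth_on_def)
  then have d: "chi differentiable_on UNIV" "?D chi differentiable_on UNIV" "continuous_on UNIV (?D (?D chi))"
    by (simp_all add: numeral_2_eq_2)
  have vd: "(f has_vector_derivative ?D f t) (at t within S)" if "f differentiable_on UNIV" for f :: "real \<Rightarrow> complex" and t S
  proof -
    have df: "f differentiable at t" using that by (simp add: differentiable_on_def)
    then have "(f has_derivative frechet_derivative f (at t)) (at t)" by (rule iffD1[OF frechet_derivative_works])
    moreover have "frechet_derivative f (at t) = (\<lambda>h. h *\<^sub>R ?D f t)"
    proof
      fix h
      have "frechet_derivative f (at t) (h *\<^sub>R 1) = h *\<^sub>R ?D f t"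
        using linear_cmul[OF linear_frechet_derivative[OF df]] .
      then show "frechet_derivative f (at t) h = h *\<^sub>R ?D f t" by simp
    qed
    ultimately have "(f has_vector_derivative ?D f t) (at t)" by (simp add: has_vector_derivative_def)
    then show ?thesis by (rule has_vector_derivative_at_within)
  qed
  obtain B0 where B0: "\<And>x. x \<in> closure {x. chi x \<noteq> 0} \<Longrightarrow> norm x \<le> B0"
    using compact_imp_bounded[OF cpt] by (auto simp: bounded_iff)
  \<comment> \<open>A margin of 1 beyond the support, so that chi vanishes near \<open>b\<close> and
    \<open>-b\<close> and its derivative vanishes there too.\<close>
  define b where "b = \<bar>B0\<bar> + 1"
  have b0: "b > 0" by (simp add: b_def)
  have supp: "chi t = 0" if "\<bar>t\<bar> \<ge> b - 1/2" for t
  proof (rule ccontr)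
    assume "chi t \<noteq> 0"
    then have "t \<in> closure {x. chi x \<noteq> 0}" using closure_subset[of "{x. chi x \<noteq> 0}"] by blast
    from B0[OF this] that show False by (simp add: b_def)
  qed
  have dz: "?D chi t = 0" if "\<bar>t\<bar> = b" for t
  proof -
    have "chi differentiable at t" using d(1) by (simp add: differentiable_on_def)
    moreover have "chi x = (\<lambda>x. 0) x" if "x \<in> ball t (1/2)" for x
    proof -
      have "\<bar>x - t\<bar> < 1/2" using that by (simp add: dist_real_def abs_minus_commute)
      then have "\<bar>x\<bar> \<ge> b - 1/2" using \<open>\<bar>t\<bar> = b\<close> by linarith
      then show ?thesis by (simp add: supp)
    qed
    ultimately have "frechet_derivative chi (at t) = frechet_derivative (\<lambda>x. 0) (at t)"
      by (intro frechet_derivative_transform_within_open[where X = "ball t (1/2)"]) auto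
    then show ?thesis by (simp add: frechet_derivative_const)
  qed
  let ?e = "\<lambda>\<xi> t. exp (\<i> * of_real (t * \<xi>)) :: complex"
  have ce: "continuous_on S (?e \<xi>)" for S \<xi> by (intro continuous_intros)
  have ne: "norm (?e \<xi> t) = 1" for \<xi> t by (simp flip: cis_conv_exp)
  have c0: "continuous_on S chi" for S
    using differentiable_imp_continuous_on[OF d(1)] continuous_on_subset by blast
  have c2: "continuous_on S (?D (?D chi))" for S using d(3) continuous_on_subset by blast
  have conv: "(LINT t|lborel. chi t * ?e \<xi> t) = integral {-b..b} (\<lambda>t. chi t * ?e \<xi> t)
      \<and> integrable lborel (\<lambda>t. chi t * ?e \<xi> t)" for \<xi>
  proof -
    have i: "set_integrable lborel {-b..b} (\<lambda>t. chi t * ?e \<xi> t)"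
      unfolding set_integrable_def
      by (intro borel_integrable_compact continuous_intros c0) simp
    have eq: "(\<lambda>t. indicator {-b..b} t *\<^sub>R (chi t * ?e \<xi> t)) = (\<lambda>t. chi t * ?e \<xi> t)"
    proof
      fix t
      show "indicator {-b..b} t *\<^sub>R (chi t * ?e \<xi> t) = chi t * ?e \<xi> t"
        using supp[of t] by (cases "t \<in> {-b..b}") auto
    qed
    show ?thesis using set_borel_integral_eq_integral(2)[OF i] i
      unfolding set_lebesgue_integral_def set_integrable_def eq by simp
  qed
  have "bounded (chi ` {-b..b})" "bounded (?D (?D chi) ` {-b..b})"
    by (intro compact_imp_bounded compact_continuous_image c0 c2 compact_Icc)+
  then obtain M0 M2 where M: "\<And>t. t \<in> {-b..b} \<Longrightarrow> norm (chi t) \<le> M0" "\<And>t. t \<in> {-b..b} \<Longrightarrow> norm (?D (?D chi) t) \<le> M2"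
    unfolding bounded_iff by (metis imageI)
  define C where "C = (M0 + M2) * (2 * b) + 1"
  have bb: "0 \<in> {-b..b}" using b0 by simp
  have M0: "M0 \<ge> 0" "M2 \<ge> 0" using M(1)[OF bb] M(2)[OF bb] norm_ge_zero order_trans by blast+
  have bnd: "norm (integral {-b..b} (\<lambda>t. f t * ?e \<xi> t)) \<le> m * (2 * b)"
    if f: "continuous_on {-b..b} f" "\<And>t. t \<in> {-b..b} \<Longrightarrow> norm (f t) \<le> m" for f m \<xi>
  proof -
    have "((\<lambda>t. f t * ?e \<xi> t) has_integral integral {-b..b} (\<lambda>t. f t * ?e \<xi> t)) (cbox (-b) b)"
      unfolding cbox_interval by (intro integrable_integral integrable_continuous_interval continuous_intros f)
    moreover have "0 \<le> m" using f(2)[OF bb] norm_ge_zero order_trans by blast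
    ultimately have "norm (integral {-b..b} (\<lambda>t. f t * ?e \<xi> t)) \<le> m * measure lborel (cbox (-b) b)"
      by (intro has_integral_bound) (use f(2) ne in \<open>auto simp: norm_mult\<close>)
    then show ?thesis using b0 by simp
  qed
  have "cmod (LINT t|lborel. chi t * ?e \<xi> t) \<le> C / (1 + \<xi>\<^sup>2)" for \<xi>
  proof -
    let ?F = "integral {-b..b} (\<lambda>t. chi t * ?e \<xi> t)"
    \<comment> \<open>Both integrations by parts in one primitive: the derivative of
      \<open>?G\<close> is (chi'' + \<xi>^2 chi) times the exponential.\<close>
    let ?G = "\<lambda>t. (?D chi t - \<i> * of_real \<xi> * chi t) * ?e \<xi> t"
    have ve: "(?e \<xi> has_vector_derivative \<i> * of_real \<xi> * ?e \<xi> t) (at t within {-b..b})" for t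
    proof -
      have "((\<lambda>z. exp (\<i> * (z * of_real \<xi>))) has_field_derivative \<i> * of_real \<xi> * ?e \<xi> t) (at (of_real t))"
        by (auto intro!: derivative_eq_intros)
      from has_vector_derivative_real_field[OF this] show ?thesis by simp
    qed
    have "((\<lambda>t. ?D (?D chi) t * ?e \<xi> t + of_real (\<xi>\<^sup>2) * (chi t * ?e \<xi> t)) has_integral ?G b - ?G (-b)) {-b..b}"
    proof (rule fundamental_theorem_of_calculus)
      fix t assume "t \<in> {-b..b}"
      have "(?G has_vector_derivative (?D chi t - \<i> * of_real \<xi> * chi t) * (\<i> * of_real \<xi> * ?e \<xi> t)
          + (?D (?D chi) t - \<i> * of_real \<xi> * ?D chi t) * ?e \<xi> t) (at t within {-b..b})"
        by (intro has_vector_derivative_mult has_vector_derivative_diff has_vector_derivative_mult_right vd d ve)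
      moreover have "(?D chi t - \<i> * of_real \<xi> * chi t) * (\<i> * of_real \<xi> * ?e \<xi> t)
          + (?D (?D chi) t - \<i> * of_real \<xi> * ?D chi t) * ?e \<xi> t
        = ?D (?D chi) t * ?e \<xi> t + of_real (\<xi>\<^sup>2) * (chi t * ?e \<xi> t)"
        by (simp add: algebra_simps power2_eq_square)
      ultimately show "(?G has_vector_derivative ?D (?D chi) t * ?e \<xi> t + of_real (\<xi>\<^sup>2) * (chi t * ?e \<xi> t)) (at t within {-b..b})"
        by simp
    qed (use b0 in simp)
    moreover have "?G b = 0" "?G (-b) = 0" using dz[of b] dz[of "-b"] supp[of b] supp[of "-b"] b0 by auto
    ultimately have z: "((\<lambda>t. ?D (?D chi) t * ?e \<xi> t + of_real (\<xi>\<^sup>2) * (chi t * ?e \<xi> t)) has_integral 0) {-b..b}"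
      by simp
    have "integral {-b..b} (\<lambda>t. ?D (?D chi) t * ?e \<xi> t) + of_real (\<xi>\<^sup>2) * ?F = 0"
    proof (rule has_integral_unique[OF _ z])
      show "((\<lambda>t. ?D (?D chi) t * ?e \<xi> t + of_real (\<xi>\<^sup>2) * (chi t * ?e \<xi> t)) has_integral
         integral {-b..b} (\<lambda>t. ?D (?D chi) t * ?e \<xi> t) + of_real (\<xi>\<^sup>2) * ?F) {-b..b}"
        by (intro has_integral_add has_integral_mult_right integrable_integral integrable_continuous_interval
            continuous_intros c0 c2)
    qed
    then have "of_real (\<xi>\<^sup>2) * ?F = - integral {-b..b} (\<lambda>t. ?D (?D chi) t * ?e \<xi> t)"
      by (simp add: eq_neg_iff_add_eq_0 add.commute)
    then have "norm (of_real (\<xi>\<^sup>2) * ?F) = norm (integral {-b..b} (\<lambda>t. ?D (?D chi) t * ?e \<xi> t))" by (simp only: norm_minus_cancel)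
    then have "\<xi>\<^sup>2 * norm ?F \<le> M2 * (2 * b)"
      using bnd[OF c2 M(2)] by (simp add: norm_mult norm_power)
    moreover have "norm ?F \<le> M0 * (2 * b)" by (rule bnd[OF c0 M(1)])
    ultimately have "(1 + \<xi>\<^sup>2) * norm ?F \<le> C" by (simp add: C_def algebra_simps)
    moreover have "1 + \<xi>\<^sup>2 > 0" by (simp add: add_pos_nonneg)
    ultimately show ?thesis using conv[of \<xi>] by (simp add: pos_le_divide_eq mult.commute)
  qed
  moreover have "C > 0" using M0 b0 by (simp add: C_def add_nonneg_pos)
  ultimately show thesis using that conv by blast
qed

section \<open>Summation of the kernel over integer levels\<close>

lemma summable_inverse_1_square: "summable (\<lambda>k. 1 / (1 + (real k)\<^sup>2))"
proof (rule summable_comparison_test')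
  show "summable (\<lambda>k. inverse (real k ^ 2))" by (rule inverse_power_summable) simp
  fix k :: nat assume "k \<ge> 1"
  then show "norm (1 / (1 + (real k)\<^sup>2)) \<le> inverse (real k ^ 2)"
    using le_imp_inverse_le[of "(real k)\<^sup>2" "1 + (real k)\<^sup>2"] by (simp add: inverse_eq_divide)
qed

text \<open>Uniformity in \<tau> comes from replacing \<tau> by its floor at the cost of a factor 3;
  after an integer shift the sum splits into nonnegative and negative integers, each below the
  convergent series.\<close>

lemma sum_kernel_bound:
  obtains C where "C > 0" "\<And>F (\<tau>::real). finite F \<Longrightarrow> (\<Sum>K\<in>F. 1 / (1 + (\<tau> - real_of_int K)\<^sup>2)) \<le> C"
proof -
  let ?g = "\<lambda>k::nat. 1 / (1 + (real k)\<^sup>2)"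
  define S where "S = suminf ?g"
  have part: "(\<Sum>j\<in>F. 1 / (1 + (real_of_int j)\<^sup>2)) \<le> S" if "finite F" "inj_on (\<lambda>j. nat \<bar>j\<bar>) F" for F :: "int set"
  proof -
    have "(\<Sum>j\<in>F. 1 / (1 + (real_of_int j)\<^sup>2)) = (\<Sum>j\<in>F. ?g (nat \<bar>j\<bar>))"
      by (intro sum.cong refl) simp
    also have "\<dots> = sum ?g ((\<lambda>j. nat \<bar>j\<bar>) ` F)" by (simp add: sum.reindex[OF that(2)])
    also have "\<dots> \<le> S" unfolding S_def
      by (rule sum_le_suminf[OF summable_inverse_1_square]) (use that in \<open>auto simp: add_nonneg_nonneg\<close>)
    finally show ?thesis .
  qed
  have base: "(\<Sum>j\<in>F. 1 / (1 + (real_of_int j)\<^sup>2)) \<le> 2 * S" if F: "finite F" for F :: "int set"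
  proof -
    have "(\<Sum>j\<in>F. 1 / (1 + (real_of_int j)\<^sup>2)) = (\<Sum>j\<in>F \<inter> {0..}. 1 / (1 + (real_of_int j)\<^sup>2)) + (\<Sum>j\<in>F - {0..}. 1 / (1 + (real_of_int j)\<^sup>2))"
      by (rule sum.Int_Diff[OF F])
    moreover have "(\<Sum>j\<in>F \<inter> {0..}. 1 / (1 + (real_of_int j)\<^sup>2)) \<le> S"
      by (rule part) (use F in \<open>auto simp: inj_on_def\<close>)
    moreover have "(\<Sum>j\<in>F - {0..}. 1 / (1 + (real_of_int j)\<^sup>2)) \<le> S"
      by (rule part) (use F in \<open>auto simp: inj_on_def\<close>)
    ultimately show ?thesis by simp
  qed
  have S0: "S \<ge> 0" using base[of "{}"] by simp
  have "(\<Sum>K\<in>F. 1 / (1 + (\<tau> - real_of_int K)\<^sup>2)) \<le> 6 * S + 1" if F: "finite F" for F and \<tau> :: real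
  proof -
    define m where "m = \<lfloor>\<tau>\<rfloor>"
    have "1 / (1 + (\<tau> - real_of_int K)\<^sup>2) \<le> 3 * (1 / (1 + (real_of_int (K - m))\<^sup>2))" for K
    proof -
      have t: "real_of_int m \<le> \<tau>" "\<tau> \<le> real_of_int m + 1" unfolding m_def by linarith+
      define x where "x = \<tau> - real_of_int K"
      define y where "y = \<tau> - real_of_int m"
      have y: "0 \<le> y" "y \<le> 1" using t by (auto simp: y_def)
      have "real_of_int (K - m) = y - x" by (simp add: x_def y_def)
      moreover have "1 + (y - x)\<^sup>2 \<le> 3 * (1 + x\<^sup>2)"
      proof -
        have "(y - x)\<^sup>2 \<le> 2 * y\<^sup>2 + 2 * x\<^sup>2" using zero_le_power2[of "y + x"]
          unfolding power2_sum power2_diff by linarith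
        moreover have "y\<^sup>2 \<le> 1" using y by (simp add: power_le_one)
        moreover have "0 \<le> x\<^sup>2" by simp
        ultimately have "1 + (y - x)\<^sup>2 \<le> 1 + (2 * 1 + 2 * x\<^sup>2)" by linarith
        also have "\<dots> \<le> 3 * (1 + x\<^sup>2)" using \<open>0 \<le> x\<^sup>2\<close> by simp
        finally show ?thesis .
      qed
      ultimately show ?thesis unfolding x_def[symmetric]
        by (simp add: divide_simps add_pos_nonneg mult.commute split: if_splits)
    qed
    then have "(\<Sum>K\<in>F. 1 / (1 + (\<tau> - real_of_int K)\<^sup>2)) \<le> (\<Sum>K\<in>F. 3 * (1 / (1 + (real_of_int (K - m))\<^sup>2)))"
      by (rule sum_mono)
    also have "\<dots> = 3 * (\<Sum>j\<in>(\<lambda>K. K - m) ` F. 1 / (1 + (real_of_int j)\<^sup>2))"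
      by (simp add: sum.reindex inj_on_def sum_distrib_left)
    also have "\<dots> \<le> 3 * (2 * S)" using base[of "(\<lambda>K. K - m) ` F"] F by simp
    finally show ?thesis by simp
  qed
  then show thesis using that[of "6 * S + 1"] S0 by simp
qed

section \<open>The resonant sum\<close>

text \<open>The integer form of \<open>gegenbauer_eigenvalue\<close>; integrality of the levels
  serves both the lattice point count and the kernel sum.\<close>

definition frequency :: "nat \<Rightarrow> int" where
  "frequency n = int n * (int n + 3)"

lemma frequency_inj: "frequency m = frequency n \<longleftrightarrow> m = n"
proof
  assume "frequency m = frequency n"
  then have "real_of_int (frequency m) = real_of_int (frequency n)" by simp
  then show "m = n" using gegenbauer_eigenvalue_inj[of m n]
    by (simp add: frequency_def gegenbauer_eigenvalue_def)
qed simp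

lemma of_int_frequency: "real_of_int (frequency n) = gegenbauer_eigenvalue n"
  by (simp add: frequency_def gegenbauer_eigenvalue_def)

text \<open>The selection rule for the interaction is built in: when n3 has the smallest scale, it
  is what keeps (n1, n2) near the diagonal and the arc short.\<close>

definition resonant :: "int \<Rightarrow> nat set \<Rightarrow> nat set \<Rightarrow> nat set \<Rightarrow> (nat \<times> nat \<times> nat) set" where
  "resonant K A\<^sub>1 A\<^sub>2 A\<^sub>3 = {(n\<^sub>1, n\<^sub>2, n\<^sub>3). n\<^sub>1 \<in> A\<^sub>1 \<and> n\<^sub>2 \<in> A\<^sub>2 \<and> n\<^sub>3 \<in> A\<^sub>3 \<and>
     \<bar>int n\<^sub>1 - int n\<^sub>2\<bar> \<le> int n\<^sub>3 \<and> frequency n\<^sub>1 + frequency n\<^sub>2 - frequency n\<^sub>3 = K}"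

lemma finite_resonant:
  "finite A\<^sub>1 \<Longrightarrow> finite A\<^sub>2 \<Longrightarrow> finite A\<^sub>3 \<Longrightarrow> finite (resonant K A\<^sub>1 A\<^sub>2 A\<^sub>3)"
  by (rule finite_subset[of _ "A\<^sub>1 \<times> A\<^sub>2 \<times> A\<^sub>3"]) (auto simp: resonant_def)

text \<open>For fixed \<open>n\<^sub>3\<close> the resonance relation puts \<open>(2 n\<^sub>1 + 3, 2 n\<^sub>2 + 3)\<close> on a circle; the smallest of
  the three frequencies confines it to a short arc, near an axis if this is \<open>n\<^sub>1\<close> or \<open>n\<^sub>2\<close>, and near
  the diagonal if it is \<open>n\<^sub>3\<close>.\<close>

lemma card_resonant_fibre:
  fixes \<epsilon> :: real
  assumes e: "\<epsilon> > 0"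
  obtains C where "C > 0" "\<And>N\<^sub>1 N\<^sub>2 N\<^sub>3 A\<^sub>1 A\<^sub>2 A\<^sub>3 K n. N\<^sub>1 \<ge> 1 \<Longrightarrow> N\<^sub>2 \<ge> 1 \<Longrightarrow> N\<^sub>3 \<ge> 1 \<Longrightarrow>
     A\<^sub>1 \<subseteq> {..2 * N\<^sub>1} \<Longrightarrow> A\<^sub>2 \<subseteq> {..2 * N\<^sub>2} \<Longrightarrow> A\<^sub>3 \<subseteq> {..2 * N\<^sub>3} \<Longrightarrow>
     real (card {x \<in> resonant K A\<^sub>1 A\<^sub>2 A\<^sub>3. snd (snd x) = n}) \<le> C * real (min N\<^sub>1 (min N\<^sub>2 N\<^sub>3)) powr \<epsilon>"
proof -
  obtain C where C: "C > 0" "\<And>(R::int) (L::nat). L \<ge> 1 \<Longrightarrow>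
    finite {u::int. \<bar>u\<bar> \<le> int L \<and> (\<exists>v\<ge>0. u\<^sup>2 + v\<^sup>2 = R)} \<and>
    real (card {u::int. \<bar>u\<bar> \<le> int L \<and> (\<exists>v\<ge>0. u\<^sup>2 + v\<^sup>2 = R)}) \<le> C * real L powr \<epsilon>"
    using card_short_arc[OF e] by blast
  have "real (card {x \<in> resonant K A\<^sub>1 A\<^sub>2 A\<^sub>3. snd (snd x) = n}) \<le> (C * 7 powr \<epsilon>) * real (min N\<^sub>1 (min N\<^sub>2 N\<^sub>3)) powr \<epsilon>"
    if N: "N\<^sub>1 \<ge> 1" "N\<^sub>2 \<ge> 1" "N\<^sub>3 \<ge> 1" and A: "A\<^sub>1 \<subseteq> {..2 * N\<^sub>1}" "A\<^sub>2 \<subseteq> {..2 * N\<^sub>2}" "A\<^sub>3 \<subseteq> {..2 * N\<^sub>3}"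
    for N\<^sub>1 N\<^sub>2 N\<^sub>3 A\<^sub>1 A\<^sub>2 A\<^sub>3 K n
  proof -
    let ?X = "{x \<in> resonant K A\<^sub>1 A\<^sub>2 A\<^sub>3. snd (snd x) = n}"
    \<comment> \<open>The three cases differ only in the coordinates (f, g) on the circle, f being
      the one confined to the arc. The factor 7 comes from 2 n + 3 <= 4 N + 3 <= 7 N.\<close>
    have gen: "real (card ?X) \<le> C * 7 powr \<epsilon> * real N powr \<epsilon>"
      if N: "N \<ge> 1" and h: "\<And>n1 n2. (n1, n2, n) \<in> ?X \<Longrightarrow> \<bar>f n1 n2\<bar> \<le> int (7 * N) \<and> g n1 n2 \<ge> 0 \<and> (f n1 n2)\<^sup>2 + (g n1 n2)\<^sup>2 = R"
        and inj: "\<And>n1 n2 m1 m2. f n1 n2 = f m1 m2 \<Longrightarrow> g n1 n2 = g m1 m2 \<Longrightarrow> n1 = m1 \<and> n2 = m2"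
      for N R and f g :: "nat \<Rightarrow> nat \<Rightarrow> int"
    proof -
      let ?U = "{u::int. \<bar>u\<bar> \<le> int (7 * N) \<and> (\<exists>v\<ge>0. u\<^sup>2 + v\<^sup>2 = R)}"
      have U: "finite ?U" "real (card ?U) \<le> C * real (7 * N) powr \<epsilon>" using C(2)[of "7 * N" R] N by auto
      have "card ?X \<le> card ?U"
      proof (rule card_inj_on_le[where f = "\<lambda>x. f (fst x) (fst (snd x))"])
        show "inj_on (\<lambda>x. f (fst x) (fst (snd x))) ?X"
        proof (rule inj_onI)
          fix x y assume x: "x \<in> ?X" and y: "y \<in> ?X" and eq: "f (fst x) (fst (snd x)) = f (fst y) (fst (snd y))"
          obtain n1 n2 where x': "x = (n1, n2, n)" using x by (cases x) auto
          obtain m1 m2 where y': "y = (m1, m2, n)" using y by (cases y) auto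
          have hx: "g n1 n2 \<ge> 0" "(f n1 n2)\<^sup>2 + (g n1 n2)\<^sup>2 = R" using h[of n1 n2] x unfolding x' by auto
          have hy: "g m1 m2 \<ge> 0" "(f m1 m2)\<^sup>2 + (g m1 m2)\<^sup>2 = R" using h[of m1 m2] y unfolding y' by auto
          have f: "f n1 n2 = f m1 m2" using eq by (simp add: x' y')
          then have "(g n1 n2)\<^sup>2 = (g m1 m2)\<^sup>2" using hx(2) hy(2) by simp
          then have "g n1 n2 = g m1 m2" using hx(1) hy(1) by simp
          from inj[OF f this] show "x = y" by (simp add: x' y')
        qed
        show "(\<lambda>x. f (fst x) (fst (snd x))) ` ?X \<subseteq> ?U"
        proof (rule image_subsetI)
          fix x assume x: "x \<in> ?X"
          obtain n1 n2 where x': "x = (n1, n2, n)" using x by (cases x) auto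
          show "f (fst x) (fst (snd x)) \<in> ?U" using h[of n1 n2] x unfolding x' by auto
        qed
        show "finite ?U" by (rule U(1))
      qed
      then have "real (card ?X) \<le> real (card ?U)" by simp
      also have "\<dots> \<le> C * real (7 * N) powr \<epsilon>" by (rule U(2))
      finally show ?thesis by (simp add: powr_mult)
    qed
    have mem: "n1 \<le> 2 * N\<^sub>1 \<and> n2 \<le> 2 * N\<^sub>2 \<and> n \<le> 2 * N\<^sub>3 \<and> \<bar>int n1 - int n2\<bar> \<le> int n \<and>
        int n1 * (int n1 + 3) + int n2 * (int n2 + 3) = K + frequency n" if "(n1, n2, n) \<in> ?X" for n1 n2
    proof -
      have "n1 \<in> A\<^sub>1" "n2 \<in> A\<^sub>2" "n \<in> A\<^sub>3" "\<bar>int n1 - int n2\<bar> \<le> int n"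
         "frequency n1 + frequency n2 - frequency n = K" using that by (auto simp: resonant_def)
      then show ?thesis using A unfolding frequency_def[of n1] frequency_def[of n2] by auto
    qed
    have "min N\<^sub>1 (min N\<^sub>2 N\<^sub>3) = N\<^sub>1 \<or> min N\<^sub>1 (min N\<^sub>2 N\<^sub>3) = N\<^sub>2 \<or> min N\<^sub>1 (min N\<^sub>2 N\<^sub>3) = N\<^sub>3"
      by (simp add: min_def)
    then consider "min N\<^sub>1 (min N\<^sub>2 N\<^sub>3) = N\<^sub>1" | "min N\<^sub>1 (min N\<^sub>2 N\<^sub>3) = N\<^sub>2" | "min N\<^sub>1 (min N\<^sub>2 N\<^sub>3) = N\<^sub>3"
      by blast
    then show ?thesis
    proof cases
      case 1
      show ?thesis unfolding 1
      \<comment> \<open>Completing squares: 4 n (n + 3) = (2 n + 3)^2 - 9, once for each of n1 and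
        n2.\<close>
      proof (rule gen[OF N(1), where f = "\<lambda>n1 n2. 2 * int n1 + 3" and g = "\<lambda>n1 n2. 2 * int n2 + 3" and R = "4 * (K + frequency n) + 18"])
        fix n1 n2 assume "(n1, n2, n) \<in> ?X"
        note m = mem[OF this]
        have "(2 * int n1 + 3)\<^sup>2 + (2 * int n2 + 3)\<^sup>2 = 4 * (int n1 * (int n1 + 3) + int n2 * (int n2 + 3)) + 18"
          by (simp add: power2_eq_square algebra_simps)
        then show "\<bar>2 * int n1 + 3\<bar> \<le> int (7 * N\<^sub>1) \<and> 2 * int n2 + 3 \<ge> 0 \<and>
           (2 * int n1 + 3)\<^sup>2 + (2 * int n2 + 3)\<^sup>2 = 4 * (K + frequency n) + 18" using m N(1) by simp
      qed simp
    next
      case 2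
      show ?thesis unfolding 2
      proof (rule gen[OF N(2), where g = "\<lambda>n1 n2. 2 * int n1 + 3" and f = "\<lambda>n1 n2. 2 * int n2 + 3" and R = "4 * (K + frequency n) + 18"])
        fix n1 n2 assume "(n1, n2, n) \<in> ?X"
        note m = mem[OF this]
        have "(2 * int n2 + 3)\<^sup>2 + (2 * int n1 + 3)\<^sup>2 = 4 * (int n1 * (int n1 + 3) + int n2 * (int n2 + 3)) + 18"
          by (simp add: power2_eq_square algebra_simps)
        then show "\<bar>2 * int n2 + 3\<bar> \<le> int (7 * N\<^sub>2) \<and> 2 * int n1 + 3 \<ge> 0 \<and>
           (2 * int n2 + 3)\<^sup>2 + (2 * int n1 + 3)\<^sup>2 = 4 * (K + frequency n) + 18" using m N(2) by simp
      qed simp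
    next
      case 3
      show ?thesis unfolding 3
      \<comment> \<open>Coordinates turned by 45 degrees: difference and sum. The difference is at
        most n3 <= 2 N3 by the selection rule.\<close>
      proof (rule gen[OF N(3), where f = "\<lambda>n1 n2. int n1 - int n2" and g = "\<lambda>n1 n2. int n1 + int n2 + 3" and R = "2 * (K + frequency n) + 9"])
        fix n1 n2 assume "(n1, n2, n) \<in> ?X"
        note m = mem[OF this]
        have "(int n1 - int n2)\<^sup>2 + (int n1 + int n2 + 3)\<^sup>2 = 2 * (int n1 * (int n1 + 3) + int n2 * (int n2 + 3)) + 9"
          by (simp add: power2_eq_square algebra_simps)
        then show "\<bar>int n1 - int n2\<bar> \<le> int (7 * N\<^sub>3) \<and> int n1 + int n2 + 3 \<ge> 0 \<and>
           (int n1 - int n2)\<^sup>2 + (int n1 + int n2 + 3)\<^sup>2 = 2 * (K + frequency n) + 9" using m by simp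
      qed simp
    qed
  qed
  moreover have "C * 7 powr \<epsilon> > 0" using C(1) by simp
  ultimately show thesis using that by blast
qed

text \<open>Cauchy-Schwarz with n3 alone on one side. On a fixed level (n1, n2) determines n3, so
  the first factor is at most the full product of norms; in the second each n3 occurs at most B
  times.\<close>

lemma resonant_sum_bound:
  fixes a\<^sub>1 a\<^sub>2 a\<^sub>3 :: "nat \<Rightarrow> real"
  assumes fin: "finite A\<^sub>1" "finite A\<^sub>2" "finite A\<^sub>3"
    and nn: "\<And>n. a\<^sub>1 n \<ge> 0" "\<And>n. a\<^sub>2 n \<ge> 0" "\<And>n. a\<^sub>3 n \<ge> 0"
    and B: "\<And>n. real (card {x \<in> resonant K A\<^sub>1 A\<^sub>2 A\<^sub>3. snd (snd x) = n}) \<le> B"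
  shows "(\<Sum>(n\<^sub>1, n\<^sub>2, n\<^sub>3)\<in>resonant K A\<^sub>1 A\<^sub>2 A\<^sub>3. a\<^sub>1 n\<^sub>1 * a\<^sub>2 n\<^sub>2 * a\<^sub>3 n\<^sub>3)
     \<le> sqrt B * L2_set a\<^sub>1 A\<^sub>1 * L2_set a\<^sub>2 A\<^sub>2 * L2_set a\<^sub>3 A\<^sub>3"
proof -
  let ?X = "resonant K A\<^sub>1 A\<^sub>2 A\<^sub>3"
  have fX: "finite ?X" by (rule finite_resonant[OF fin])
  have B0: "B \<ge> 0" using B[of 0] by (rule order_trans[rotated]) simp
  let ?p = "\<lambda>x. (fst x, fst (snd x))"
  have inj: "inj_on ?p ?X"
  proof (rule inj_onI)
    fix x y assume "x \<in> ?X" "y \<in> ?X" "?p x = ?p y"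
    then have "frequency (snd (snd x)) = frequency (snd (snd y))" by (auto simp: resonant_def)
    then have "snd (snd x) = snd (snd y)" by (simp add: frequency_inj)
    then show "x = y" using \<open>?p x = ?p y\<close> by (simp add: prod_eq_iff)
  qed
  have s12: "(\<Sum>x\<in>?X. (a\<^sub>1 (fst x) * a\<^sub>2 (fst (snd x)))\<^sup>2) \<le> (\<Sum>n\<in>A\<^sub>1. (a\<^sub>1 n)\<^sup>2) * (\<Sum>n\<in>A\<^sub>2. (a\<^sub>2 n)\<^sup>2)"
  proof -
    have "(\<Sum>x\<in>?X. (a\<^sub>1 (fst x) * a\<^sub>2 (fst (snd x)))\<^sup>2) = (\<Sum>y\<in>?p ` ?X. (a\<^sub>1 (fst y) * a\<^sub>2 (snd y))\<^sup>2)"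
      by (simp add: sum.reindex[OF inj])
    also have "\<dots> \<le> (\<Sum>y\<in>A\<^sub>1 \<times> A\<^sub>2. (a\<^sub>1 (fst y) * a\<^sub>2 (snd y))\<^sup>2)"
      using fin by (intro sum_mono2) (auto simp: resonant_def)
    also have "\<dots> = (\<Sum>n\<in>A\<^sub>1. (a\<^sub>1 n)\<^sup>2) * (\<Sum>n\<in>A\<^sub>2. (a\<^sub>2 n)\<^sup>2)"
      by (simp add: sum_product sum.cartesian_product power_mult_distrib case_prod_beta)
    finally show ?thesis .
  qed
  have s3: "(\<Sum>x\<in>?X. (a\<^sub>3 (snd (snd x)))\<^sup>2) \<le> B * (\<Sum>n\<in>A\<^sub>3. (a\<^sub>3 n)\<^sup>2)"
  proof -
    have "(\<Sum>x\<in>?X. (a\<^sub>3 (snd (snd x)))\<^sup>2) = (\<Sum>n\<in>A\<^sub>3. \<Sum>x\<in>{x \<in> ?X. snd (snd x) = n}. (a\<^sub>3 (snd (snd x)))\<^sup>2)"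
      by (rule sum.group[OF fX fin(3), symmetric]) (auto simp: resonant_def)
    also have "\<dots> = (\<Sum>n\<in>A\<^sub>3. real (card {x \<in> ?X. snd (snd x) = n}) * (a\<^sub>3 n)\<^sup>2)"
      by (rule sum.cong[OF refl]) simp
    also have "\<dots> \<le> (\<Sum>n\<in>A\<^sub>3. B * (a\<^sub>3 n)\<^sup>2)"
      by (intro sum_mono mult_right_mono B) simp
    finally show ?thesis by (simp add: sum_distrib_left)
  qed
  have "(\<Sum>(n\<^sub>1, n\<^sub>2, n\<^sub>3)\<in>?X. a\<^sub>1 n\<^sub>1 * a\<^sub>2 n\<^sub>2 * a\<^sub>3 n\<^sub>3)
     = (\<Sum>x\<in>?X. \<bar>a\<^sub>1 (fst x) * a\<^sub>2 (fst (snd x))\<bar> * \<bar>a\<^sub>3 (snd (snd x))\<bar>)"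
    using nn by (intro sum.cong refl) (auto simp: abs_mult)
  also have "\<dots> \<le> L2_set (\<lambda>x. a\<^sub>1 (fst x) * a\<^sub>2 (fst (snd x))) ?X * L2_set (\<lambda>x. a\<^sub>3 (snd (snd x))) ?X"
    by (rule L2_set_mult_ineq)
  also have "\<dots> \<le> sqrt ((\<Sum>n\<in>A\<^sub>1. (a\<^sub>1 n)\<^sup>2) * (\<Sum>n\<in>A\<^sub>2. (a\<^sub>2 n)\<^sup>2)) * sqrt (B * (\<Sum>n\<in>A\<^sub>3. (a\<^sub>3 n)\<^sup>2))"
    unfolding L2_set_def using s12 s3
    by (intro mult_mono real_sqrt_le_mono) (auto intro!: sum_nonneg mult_nonneg_nonneg B0)
  also have "\<dots> = sqrt B * L2_set a\<^sub>1 A\<^sub>1 * L2_set a\<^sub>2 A\<^sub>2 * L2_set a\<^sub>3 A\<^sub>3"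
    by (simp add: L2_set_def real_sqrt_mult)
  finally show ?thesis .
qed

lemma interaction_sum_bound:
  fixes \<epsilon> :: real
  assumes e: "\<epsilon> > 0"
  obtains C where "C > 0" "\<And>N\<^sub>1 N\<^sub>2 N\<^sub>3 A\<^sub>1 A\<^sub>2 A\<^sub>3 \<tau> (a\<^sub>1 :: nat \<Rightarrow> real) a\<^sub>2 a\<^sub>3. N\<^sub>1 \<ge> 1 \<Longrightarrow> N\<^sub>2 \<ge> 1 \<Longrightarrow> N\<^sub>3 \<ge> 1 \<Longrightarrow>
     A\<^sub>1 \<subseteq> {..2 * N\<^sub>1} \<Longrightarrow> A\<^sub>2 \<subseteq> {..2 * N\<^sub>2} \<Longrightarrow> A\<^sub>3 \<subseteq> {..2 * N\<^sub>3} \<Longrightarrow>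
     (\<And>n. a\<^sub>1 n \<ge> 0) \<Longrightarrow> (\<And>n. a\<^sub>2 n \<ge> 0) \<Longrightarrow> (\<And>n. a\<^sub>3 n \<ge> 0) \<Longrightarrow>
     (\<Sum>(n\<^sub>1, n\<^sub>2, n\<^sub>3)\<in>{(n\<^sub>1, n\<^sub>2, n\<^sub>3) \<in> A\<^sub>1 \<times> A\<^sub>2 \<times> A\<^sub>3. \<bar>int n\<^sub>1 - int n\<^sub>2\<bar> \<le> int n\<^sub>3}.
        a\<^sub>1 n\<^sub>1 * a\<^sub>2 n\<^sub>2 * a\<^sub>3 n\<^sub>3 / (1 + (\<tau> - (gegenbauer_eigenvalue n\<^sub>1 + gegenbauer_eigenvalue n\<^sub>2 - gegenbauer_eigenvalue n\<^sub>3))\<^sup>2))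
     \<le> C * real (min N\<^sub>1 (min N\<^sub>2 N\<^sub>3)) powr \<epsilon> * L2_set a\<^sub>1 A\<^sub>1 * L2_set a\<^sub>2 A\<^sub>2 * L2_set a\<^sub>3 A\<^sub>3"
proof -
  \<comment> \<open>Cauchy-Schwarz takes the square root of the fibre count, hence the doubled
    exponent here.\<close>
  have e2: "2 * \<epsilon> > 0" using e by simp
  obtain C1 where C1: "C1 > 0" "\<And>N\<^sub>1 N\<^sub>2 N\<^sub>3 A\<^sub>1 A\<^sub>2 A\<^sub>3 K n. N\<^sub>1 \<ge> 1 \<Longrightarrow> N\<^sub>2 \<ge> 1 \<Longrightarrow> N\<^sub>3 \<ge> 1 \<Longrightarrow>
     A\<^sub>1 \<subseteq> {..2 * N\<^sub>1} \<Longrightarrow> A\<^sub>2 \<subseteq> {..2 * N\<^sub>2} \<Longrightarrow> A\<^sub>3 \<subseteq> {..2 * N\<^sub>3} \<Longrightarrow>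
     real (card {x \<in> resonant K A\<^sub>1 A\<^sub>2 A\<^sub>3. snd (snd x) = n}) \<le> C1 * real (min N\<^sub>1 (min N\<^sub>2 N\<^sub>3)) powr (2 * \<epsilon>)"
    using card_resonant_fibre[OF e2] by blast
  obtain C2 where C2: "C2 > 0" "\<And>F (\<tau>::real). finite F \<Longrightarrow> (\<Sum>K\<in>F. 1 / (1 + (\<tau> - real_of_int K)\<^sup>2)) \<le> C2"
    using sum_kernel_bound by blast
  show thesis
  proof (rule that)
    show "C2 * sqrt C1 > 0" using C1(1) C2(1) by simp
    fix N\<^sub>1 N\<^sub>2 N\<^sub>3 :: nat and A\<^sub>1 A\<^sub>2 A\<^sub>3 \<tau> and a\<^sub>1 a\<^sub>2 a\<^sub>3 :: "nat \<Rightarrow> real"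
    assume N: "N\<^sub>1 \<ge> 1" "N\<^sub>2 \<ge> 1" "N\<^sub>3 \<ge> 1" and A: "A\<^sub>1 \<subseteq> {..2 * N\<^sub>1}" "A\<^sub>2 \<subseteq> {..2 * N\<^sub>2}" "A\<^sub>3 \<subseteq> {..2 * N\<^sub>3}"
      and nn: "\<And>n. a\<^sub>1 n \<ge> 0" "\<And>n. a\<^sub>2 n \<ge> 0" "\<And>n. a\<^sub>3 n \<ge> 0"
    let ?M = "real (min N\<^sub>1 (min N\<^sub>2 N\<^sub>3))"
    let ?X = "{(n\<^sub>1, n\<^sub>2, n\<^sub>3) \<in> A\<^sub>1 \<times> A\<^sub>2 \<times> A\<^sub>3. \<bar>int n\<^sub>1 - int n\<^sub>2\<bar> \<le> int n\<^sub>3}"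
    let ?w = "\<lambda>(n\<^sub>1, n\<^sub>2, n\<^sub>3). a\<^sub>1 n\<^sub>1 * a\<^sub>2 n\<^sub>2 * a\<^sub>3 n\<^sub>3"
    let ?f = "\<lambda>(n\<^sub>1, n\<^sub>2, n\<^sub>3). frequency n\<^sub>1 + frequency n\<^sub>2 - frequency n\<^sub>3"
    let ?k = "\<lambda>K::int. 1 / (1 + (\<tau> - real_of_int K)\<^sup>2)"
    let ?P = "sqrt C1 * ?M powr \<epsilon> * L2_set a\<^sub>1 A\<^sub>1 * L2_set a\<^sub>2 A\<^sub>2 * L2_set a\<^sub>3 A\<^sub>3"
    have fin: "finite A\<^sub>1" "finite A\<^sub>2" "finite A\<^sub>3" using A finite_subset by blast+
    then have fX: "finite ?X" by (auto intro: finite_subset[of _ "A\<^sub>1 \<times> A\<^sub>2 \<times> A\<^sub>3"])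
    have P0: "?P \<ge> 0" using C1(1) by (simp add: L2_set_nonneg)
    have level: "(\<Sum>x\<in>{x \<in> ?X. ?f x = K}. ?w x) \<le> ?P" for K
    proof -
      have eq: "{x \<in> ?X. ?f x = K} = resonant K A\<^sub>1 A\<^sub>2 A\<^sub>3" by (auto simp: resonant_def)
      have "(\<Sum>x\<in>resonant K A\<^sub>1 A\<^sub>2 A\<^sub>3. ?w x) \<le> sqrt (C1 * ?M powr (2 * \<epsilon>)) * L2_set a\<^sub>1 A\<^sub>1 * L2_set a\<^sub>2 A\<^sub>2 * L2_set a\<^sub>3 A\<^sub>3"
        by (rule resonant_sum_bound[OF fin nn C1(2)[OF N A]])
      moreover have "sqrt (C1 * ?M powr (2 * \<epsilon>)) = sqrt C1 * ?M powr \<epsilon>"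
      proof -
        have "?M powr (2 * \<epsilon>) = (?M powr \<epsilon>)\<^sup>2" by (simp add: power2_eq_square powr_add[symmetric])
        then show ?thesis by (simp add: real_sqrt_mult)
      qed
      ultimately show ?thesis unfolding eq by simp
    qed
    have "(\<Sum>(n\<^sub>1, n\<^sub>2, n\<^sub>3)\<in>?X. a\<^sub>1 n\<^sub>1 * a\<^sub>2 n\<^sub>2 * a\<^sub>3 n\<^sub>3 /
         (1 + (\<tau> - (gegenbauer_eigenvalue n\<^sub>1 + gegenbauer_eigenvalue n\<^sub>2 - gegenbauer_eigenvalue n\<^sub>3))\<^sup>2))
      = (\<Sum>x\<in>?X. ?w x * ?k (?f x))"
      by (intro sum.cong refl) (auto simp: of_int_frequency)
    also have "\<dots> = (\<Sum>K\<in>?f ` ?X. \<Sum>x\<in>{x \<in> ?X. ?f x = K}. ?w x * ?k (?f x))"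
      by (rule sum.group[OF fX finite_imageI[OF fX] subset_refl, symmetric])
    also have "\<dots> = (\<Sum>K\<in>?f ` ?X. ?k K * (\<Sum>x\<in>{x \<in> ?X. ?f x = K}. ?w x))"
      by (intro sum.cong refl) (simp add: sum_distrib_left sum_divide_distrib)
    also have "\<dots> \<le> (\<Sum>K\<in>?f ` ?X. ?k K * ?P)"
      by (intro sum_mono mult_left_mono level) simp
    also have "\<dots> = (\<Sum>K\<in>?f ` ?X. ?k K) * ?P" by (simp only: sum_distrib_right)
    also have "\<dots> \<le> C2 * ?P" using C2(2)[OF finite_imageI[OF fX]] P0 by (rule mult_right_mono)
    finally show "(\<Sum>(n\<^sub>1, n\<^sub>2, n\<^sub>3)\<in>?X. a\<^sub>1 n\<^sub>1 * a\<^sub>2 n\<^sub>2 * a\<^sub>3 n\<^sub>3 /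
         (1 + (\<tau> - (gegenbauer_eigenvalue n\<^sub>1 + gegenbauer_eigenvalue n\<^sub>2 - gegenbauer_eigenvalue n\<^sub>3))\<^sup>2))
      \<le> C2 * sqrt C1 * ?M powr \<epsilon> * L2_set a\<^sub>1 A\<^sub>1 * L2_set a\<^sub>2 A\<^sub>2 * L2_set a\<^sub>3 A\<^sub>3"
      by (simp add: mult.assoc)
  qed
qed

section \<open>The trilinear estimate\<close>

lemma zonal_integral_normalized:
  "zonal_integral (normalized_gegenbauer m * normalized_gegenbauer n) = (if m = n then 1 / sphere_factor else 0)"
proof -
  define p :: "real ^ 5" where "p = axis 1 1"
  have p: "norm p = 1" by (simp add: p_def)
  have "complex_of_real (sphere_factor * zonal_integral (normalized_gegenbauer m * normalized_gegenbauer n))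
      = (if m = n then 1 else 0)"
    using integral_zonal_normalized[OF p, of m n]
      integral_zonal_poly[OF p, of "normalized_gegenbauer m * normalized_gegenbauer n"]
    by (simp only: zonal_poly_mult)
  then have "sphere_factor * zonal_integral (normalized_gegenbauer m * normalized_gegenbauer n) = (if m = n then 1 else 0)"
    by (simp split: if_splits flip: of_real_mult)
  then show ?thesis using sphere_factor_pos by (auto simp: field_simps split: if_splits)
qed

lemma degree_normalized_gegenbauer: "degree (normalized_gegenbauer n) \<le> n"
  unfolding normalized_gegenbauer_def using degree_smult_le degree_gegenbauer by metis

lemma zonal_integral_low_degree:
  assumes "degree q < n"
  shows "zonal_integral (normalized_gegenbauer n * q) = 0"
proof (rule gegenbauer_span[of "\<lambda>q. zonal_integral (normalized_gegenbauer n * q)" n])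
  show "zonal_integral (normalized_gegenbauer n * (q + r)) =
      zonal_integral (normalized_gegenbauer n * q) + zonal_integral (normalized_gegenbauer n * r)" for q r
    by (simp add: distrib_left zonal_integral_add)
  show "zonal_integral (normalized_gegenbauer n * smult c q) = c *\<^sub>R zonal_integral (normalized_gegenbauer n * q)" for c q
    by (simp add: zonal_integral_smult)
  show "zonal_integral (normalized_gegenbauer n * gegenbauer m) = 0" if "m < n" for m
  proof -
    have "gegenbauer m = smult (sqrt (gegenbauer_norm2 m)) (normalized_gegenbauer m)"
      using gegenbauer_norm2_pos[of m] by (simp add: normalized_gegenbauer_def)
    then show ?thesis using that zonal_integral_normalized[of n m] by (simp add: zonal_integral_smult)
  qed
  show "coeff q i = 0" if "n \<le> i" for i using that assms by (intro coeff_eq_0) simp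
qed

definition interaction :: "nat \<Rightarrow> nat \<Rightarrow> nat \<Rightarrow> real" where
  "interaction a b c = sphere_factor *
     zonal_integral (normalized_gegenbauer a * normalized_gegenbauer b * normalized_gegenbauer c)"

lemma integral_triple_zonal:
  fixes p :: "real ^ 5"
  assumes "norm p = 1"
  shows "(LINT x|sphere_measure. zonal_harmonic p a x * zonal_harmonic p b x * zonal_harmonic p c x) = of_real (interaction a b c)"
  using integral_zonal_poly[OF assms, of "normalized_gegenbauer a * normalized_gegenbauer b * normalized_gegenbauer c"]
  by (simp only: zonal_poly_mult interaction_def)

text \<open>If one of a, b exceeds the other by more than c, the product of the two lower profiles
  has smaller degree than the highest one and is orthogonal to it.\<close>

lemma interaction_selection:
  assumes "\<not> \<bar>int a - int b\<bar> \<le> int c"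
  shows "interaction a b c = 0"
proof -
  have d: "degree (normalized_gegenbauer k * normalized_gegenbauer c) \<le> k + c" for k
    by (rule order_trans[OF degree_mult_le add_mono[OF degree_normalized_gegenbauer degree_normalized_gegenbauer]])
  consider "b + c < a" | "a + c < b" using assms by linarith
  then show ?thesis
  proof cases
    case 1
    then have "degree (normalized_gegenbauer b * normalized_gegenbauer c) < a" using d[of b] by linarith
    from zonal_integral_low_degree[OF this] show ?thesis by (simp add: interaction_def mult.assoc)
  next
    case 2
    then have "degree (normalized_gegenbauer a * normalized_gegenbauer c) < b" using d[of a] by linarith
    from zonal_integral_low_degree[OF this] show ?thesis by (simp add: interaction_def mult.assoc mult.left_commute)
  qed
qed

lemma interaction_bound:
  obtains C where "C > 0" "\<And>M\<^sub>1 M\<^sub>2 M\<^sub>3 a b c. M\<^sub>1 \<ge> 1 \<Longrightarrow> M\<^sub>2 \<ge> 1 \<Longrightarrow> M\<^sub>3 \<ge> 1 \<Longrightarrow>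
     a \<le> 2 * M\<^sub>1 \<Longrightarrow> b \<le> 2 * M\<^sub>2 \<Longrightarrow> c \<le> 2 * M\<^sub>3 \<Longrightarrow>
     \<bar>interaction a b c\<bar> \<le> C * real (min M\<^sub>1 (min M\<^sub>2 M\<^sub>3)) powr (1 / 2)"
proof -
  obtain C where C: "C > 0"
    "\<And>a b c. \<bar>zonal_integral (normalized_gegenbauer a * normalized_gegenbauer b * normalized_gegenbauer c)\<bar>
        \<le> C * sqrt (real a + 1)"
    using trilinear_zonal_integral_bound by blast
  show thesis
  proof (rule that)
    show "sphere_factor * C * sqrt 3 > 0" using sphere_factor_pos C(1) by simp
    fix M\<^sub>1 M\<^sub>2 M\<^sub>3 a b c :: nat
    assume M: "M\<^sub>1 \<ge> 1" "M\<^sub>2 \<ge> 1" "M\<^sub>3 \<ge> 1" and n: "a \<le> 2 * M\<^sub>1" "b \<le> 2 * M\<^sub>2" "c \<le> 2 * M\<^sub>3"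
    have gen: "\<bar>interaction a b c\<bar> \<le> sphere_factor * C * sqrt 3 * real M powr (1 / 2)"
      if h: "\<bar>interaction a b c\<bar> \<le> sphere_factor * (C * sqrt (real k + 1))" "k \<le> 2 * M" "M \<ge> 1" for k M
    proof -
      \<comment> \<open>k + 1 <= 2 M + 1 <= 3 M; the frequency k is whichever belongs to the
        smallest scale, by symmetry of the triple integral.\<close>
      have "sqrt (real k + 1) \<le> sqrt (3 * real M)" using h(2,3) by simp
      also have "\<dots> = sqrt 3 * real M powr (1 / 2)" by (simp add: real_sqrt_mult powr_half_sqrt)
      finally have "sphere_factor * C * sqrt (real k + 1) \<le> sphere_factor * C * (sqrt 3 * real M powr (1 / 2))"
        using sphere_factor_pos C(1) by (intro mult_left_mono) auto
      then show ?thesis using h(1) by (simp add: mult.assoc)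
    qed
    have 1: "\<bar>interaction a b c\<bar> \<le> sphere_factor * (C * sqrt (real a + 1))"
      using C(2)[of a b c] sphere_factor_pos by (simp add: interaction_def abs_mult)
    have 2: "\<bar>interaction a b c\<bar> \<le> sphere_factor * (C * sqrt (real b + 1))"
      using C(2)[of b a c] sphere_factor_pos by (simp add: interaction_def abs_mult mult.commute)
    have rot: "normalized_gegenbauer c * normalized_gegenbauer a * normalized_gegenbauer b
      = normalized_gegenbauer a * normalized_gegenbauer b * normalized_gegenbauer c" by (simp add: mult_ac)
    have 3: "\<bar>interaction a b c\<bar> \<le> sphere_factor * (C * sqrt (real c + 1))"
      using C(2)[of c a b, unfolded rot] sphere_factor_pos by (simp add: interaction_def abs_mult)
    have "min M\<^sub>1 (min M\<^sub>2 M\<^sub>3) = M\<^sub>1 \<or> min M\<^sub>1 (min M\<^sub>2 M\<^sub>3) = M\<^sub>2 \<or> min M\<^sub>1 (min M\<^sub>2 M\<^sub>3) = M\<^sub>3"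
      by (simp add: min_def)
    then show "\<bar>interaction a b c\<bar> \<le> sphere_factor * C * sqrt 3 * real (min M\<^sub>1 (min M\<^sub>2 M\<^sub>3)) powr (1 / 2)"
      using gen[OF 1 n(1) M(1)] gen[OF 2 n(2) M(2)] gen[OF 3 n(3) M(3)] by (elim disjE) simp_all
  qed
qed

text \<open>The expansions hold almost everywhere in x for each t separately. This suffices because
  the integral is iterated with x inside, where the product may be replaced for every single
  t.\<close>

lemma spacetime_integral_expansion:
  fixes p :: "real ^ 5" and chi :: "real \<Rightarrow> complex"
  assumes p: "norm p = 1" and fin: "finite A\<^sub>1" "finite A\<^sub>2" "finite A\<^sub>3"
    and u: "\<And>t. u\<^sub>1 t \<in> sphere_L2" "\<And>t. u\<^sub>2 t \<in> sphere_L2" "\<And>t. u\<^sub>3 t \<in> sphere_L2"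
    and e: "\<And>t. AE x in sphere_measure. u\<^sub>1 t x = (\<Sum>n\<in>A\<^sub>1. exp (- \<i> * of_real (t * gegenbauer_eigenvalue n)) * c\<^sub>1 n * zonal_harmonic p n x)"
      "\<And>t. AE x in sphere_measure. u\<^sub>2 t x = (\<Sum>n\<in>A\<^sub>2. exp (- \<i> * of_real (t * gegenbauer_eigenvalue n)) * c\<^sub>2 n * zonal_harmonic p n x)"
      "\<And>t. AE x in sphere_measure. u\<^sub>3 t x = (\<Sum>n\<in>A\<^sub>3. exp (- \<i> * of_real (t * gegenbauer_eigenvalue n)) * c\<^sub>3 n * zonal_harmonic p n x)"
    and int: "\<And>\<xi>. integrable lborel (\<lambda>t. chi t * exp (\<i> * of_real (t * \<xi>)))"
  shows "(LINT t|lborel. LINT x|sphere_measure. chi t * exp (\<i> * of_real (t * \<tau>)) * u\<^sub>1 t x * u\<^sub>2 t x * cnj (u\<^sub>3 t x))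
    = (\<Sum>(n\<^sub>1, n\<^sub>2, n\<^sub>3)\<in>A\<^sub>1 \<times> A\<^sub>2 \<times> A\<^sub>3. c\<^sub>1 n\<^sub>1 * c\<^sub>2 n\<^sub>2 * cnj (c\<^sub>3 n\<^sub>3) * of_real (interaction n\<^sub>1 n\<^sub>2 n\<^sub>3) *
        (LINT t|lborel. chi t * exp (\<i> * of_real (t * (\<tau> - (gegenbauer_eigenvalue n\<^sub>1 + gegenbauer_eigenvalue n\<^sub>2 - gegenbauer_eigenvalue n\<^sub>3))))))"
proof -
  let ?E = "\<lambda>t n. exp (- \<i> * of_real (t * gegenbauer_eigenvalue n))"
  let ?k = "\<lambda>t \<xi>. chi t * exp (\<i> * of_real (t * \<xi>))"
  let ?\<xi> = "\<lambda>n\<^sub>1 n\<^sub>2 n\<^sub>3. \<tau> - (gegenbauer_eigenvalue n\<^sub>1 + gegenbauer_eigenvalue n\<^sub>2 - gegenbauer_eigenvalue n\<^sub>3)"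
  let ?c = "\<lambda>n\<^sub>1 n\<^sub>2 n\<^sub>3. c\<^sub>1 n\<^sub>1 * c\<^sub>2 n\<^sub>2 * cnj (c\<^sub>3 n\<^sub>3)"
  let ?X = "A\<^sub>1 \<times> A\<^sub>2 \<times> A\<^sub>3"
  have inner: "(LINT x|sphere_measure. chi t * exp (\<i> * of_real (t * \<tau>)) * u\<^sub>1 t x * u\<^sub>2 t x * cnj (u\<^sub>3 t x))
     = (\<Sum>(n\<^sub>1, n\<^sub>2, n\<^sub>3)\<in>?X. ?c n\<^sub>1 n\<^sub>2 n\<^sub>3 * of_real (interaction n\<^sub>1 n\<^sub>2 n\<^sub>3) * ?k t (?\<xi> n\<^sub>1 n\<^sub>2 n\<^sub>3))" for t
  proof -
    let ?S = "\<lambda>A c x. \<Sum>n\<in>A. ?E t n * c n * zonal_harmonic p n x"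
    have m: "u\<^sub>1 t \<in> borel_measurable sphere_measure" "u\<^sub>2 t \<in> borel_measurable sphere_measure" "u\<^sub>3 t \<in> borel_measurable sphere_measure"
      using u by (auto simp: sphere_L2_def)
    have m3: "(\<lambda>x. cnj (u\<^sub>3 t x)) \<in> borel_measurable sphere_measure"
      using m(3) by (rule measurable_compose) (intro borel_measurable_continuous_onI continuous_intros)
    have iZ: "integrable sphere_measure (\<lambda>x. zonal_harmonic p n\<^sub>1 x * zonal_harmonic p n\<^sub>2 x * zonal_harmonic p n\<^sub>3 x)" for n\<^sub>1 n\<^sub>2 n\<^sub>3
      by (intro integrable_sphere continuous_intros continuous_zonal_poly)
    have "(LINT x|sphere_measure. chi t * exp (\<i> * of_real (t * \<tau>)) * u\<^sub>1 t x * u\<^sub>2 t x * cnj (u\<^sub>3 t x))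
      = (LINT x|sphere_measure. chi t * exp (\<i> * of_real (t * \<tau>)) * ?S A\<^sub>1 c\<^sub>1 x * ?S A\<^sub>2 c\<^sub>2 x * cnj (?S A\<^sub>3 c\<^sub>3 x))"
    proof (rule integral_cong_AE)
      show "(\<lambda>x. chi t * exp (\<i> * of_real (t * \<tau>)) * u\<^sub>1 t x * u\<^sub>2 t x * cnj (u\<^sub>3 t x)) \<in> borel_measurable sphere_measure"
        by (intro borel_measurable_times borel_measurable_const m m3)
      show "(\<lambda>x. chi t * exp (\<i> * of_real (t * \<tau>)) * ?S A\<^sub>1 c\<^sub>1 x * ?S A\<^sub>2 c\<^sub>2 x * cnj (?S A\<^sub>3 c\<^sub>3 x)) \<in> borel_measurable sphere_measure"
        by (intro borel_measurable_sphere continuous_intros continuous_zonal_poly)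
      show "AE x in sphere_measure. chi t * exp (\<i> * of_real (t * \<tau>)) * u\<^sub>1 t x * u\<^sub>2 t x * cnj (u\<^sub>3 t x)
          = chi t * exp (\<i> * of_real (t * \<tau>)) * ?S A\<^sub>1 c\<^sub>1 x * ?S A\<^sub>2 c\<^sub>2 x * cnj (?S A\<^sub>3 c\<^sub>3 x)"
        using e(1)[of t] e(2)[of t] e(3)[of t] by eventually_elim (simp only:)
    qed
    also have "\<dots> = (LINT x|sphere_measure. (\<Sum>(n\<^sub>1, n\<^sub>2, n\<^sub>3)\<in>?X. (?c n\<^sub>1 n\<^sub>2 n\<^sub>3 * ?k t (?\<xi> n\<^sub>1 n\<^sub>2 n\<^sub>3)) * (zonal_harmonic p n\<^sub>1 x * zonal_harmonic p n\<^sub>2 x * zonal_harmonic p n\<^sub>3 x)))"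
    proof (rule Bochner_Integration.integral_cong[OF refl])
      fix x
      have cS: "cnj (?S A\<^sub>3 c\<^sub>3 x) = (\<Sum>n\<in>A\<^sub>3. cnj (?E t n) * cnj (c\<^sub>3 n) * zonal_harmonic p n x)" by simp
      have "chi t * exp (\<i> * of_real (t * \<tau>)) * ?S A\<^sub>1 c\<^sub>1 x * ?S A\<^sub>2 c\<^sub>2 x * cnj (?S A\<^sub>3 c\<^sub>3 x)
         = (chi t * exp (\<i> * of_real (t * \<tau>))) * (?S A\<^sub>1 c\<^sub>1 x * (?S A\<^sub>2 c\<^sub>2 x * (\<Sum>n\<in>A\<^sub>3. cnj (?E t n) * cnj (c\<^sub>3 n) * zonal_harmonic p n x)))"
        unfolding cS by (simp only: mult.assoc)
      also have "\<dots> = (chi t * exp (\<i> * of_real (t * \<tau>))) * (\<Sum>(n\<^sub>1, n\<^sub>2, n\<^sub>3)\<in>?X.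
          (?E t n\<^sub>1 * c\<^sub>1 n\<^sub>1 * zonal_harmonic p n\<^sub>1 x) * ((?E t n\<^sub>2 * c\<^sub>2 n\<^sub>2 * zonal_harmonic p n\<^sub>2 x) * (cnj (?E t n\<^sub>3) * cnj (c\<^sub>3 n\<^sub>3) * zonal_harmonic p n\<^sub>3 x)))"
        by (simp only: sum_product sum.cartesian_product case_prod_unfold fst_conv snd_conv)
      also have "\<dots> = (\<Sum>(n\<^sub>1, n\<^sub>2, n\<^sub>3)\<in>?X. (?c n\<^sub>1 n\<^sub>2 n\<^sub>3 * ?k t (?\<xi> n\<^sub>1 n\<^sub>2 n\<^sub>3)) * (zonal_harmonic p n\<^sub>1 x * zonal_harmonic p n\<^sub>2 x * zonal_harmonic p n\<^sub>3 x))"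
        unfolding sum_distrib_left
      proof (rule sum.cong[OF refl], clarify)
        fix n\<^sub>1 n\<^sub>2 n\<^sub>3
        \<comment> \<open>The conjugated third factor contributes its eigenvalue with the opposite
          sign, which produces the frequency \<open>?\<xi>\<close>.\<close>
        have x: "exp (\<i> * of_real (t * \<tau>)) * ?E t n\<^sub>1 * ?E t n\<^sub>2 * cnj (?E t n\<^sub>3) = exp (\<i> * of_real (t * ?\<xi> n\<^sub>1 n\<^sub>2 n\<^sub>3))"
          by (simp add: exp_cnj exp_add[symmetric] algebra_simps)
        have "chi t * exp (\<i> * of_real (t * \<tau>)) * (?E t n\<^sub>1 * c\<^sub>1 n\<^sub>1 * zonal_harmonic p n\<^sub>1 x * (?E t n\<^sub>2 * c\<^sub>2 n\<^sub>2 * zonal_harmonic p n\<^sub>2 x * (cnj (?E t n\<^sub>3) * cnj (c\<^sub>3 n\<^sub>3) * zonal_harmonic p n\<^sub>3 x)))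
          = ?c n\<^sub>1 n\<^sub>2 n\<^sub>3 * (chi t * (exp (\<i> * of_real (t * \<tau>)) * ?E t n\<^sub>1 * ?E t n\<^sub>2 * cnj (?E t n\<^sub>3))) * (zonal_harmonic p n\<^sub>1 x * zonal_harmonic p n\<^sub>2 x * zonal_harmonic p n\<^sub>3 x)"
          by (simp only: mult_ac)
        then show "chi t * exp (\<i> * of_real (t * \<tau>)) * (?E t n\<^sub>1 * c\<^sub>1 n\<^sub>1 * zonal_harmonic p n\<^sub>1 x * (?E t n\<^sub>2 * c\<^sub>2 n\<^sub>2 * zonal_harmonic p n\<^sub>2 x * (cnj (?E t n\<^sub>3) * cnj (c\<^sub>3 n\<^sub>3) * zonal_harmonic p n\<^sub>3 x)))
          = ?c n\<^sub>1 n\<^sub>2 n\<^sub>3 * ?k t (?\<xi> n\<^sub>1 n\<^sub>2 n\<^sub>3) * (zonal_harmonic p n\<^sub>1 x * zonal_harmonic p n\<^sub>2 x * zonal_harmonic p n\<^sub>3 x)" unfolding x .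
      qed
      finally show "chi t * exp (\<i> * of_real (t * \<tau>)) * ?S A\<^sub>1 c\<^sub>1 x * ?S A\<^sub>2 c\<^sub>2 x * cnj (?S A\<^sub>3 c\<^sub>3 x)
         = (\<Sum>(n\<^sub>1, n\<^sub>2, n\<^sub>3)\<in>?X. (?c n\<^sub>1 n\<^sub>2 n\<^sub>3 * ?k t (?\<xi> n\<^sub>1 n\<^sub>2 n\<^sub>3)) * (zonal_harmonic p n\<^sub>1 x * zonal_harmonic p n\<^sub>2 x * zonal_harmonic p n\<^sub>3 x))" .
    qed
    also have "\<dots> = (\<Sum>(n\<^sub>1, n\<^sub>2, n\<^sub>3)\<in>?X. (?c n\<^sub>1 n\<^sub>2 n\<^sub>3 * ?k t (?\<xi> n\<^sub>1 n\<^sub>2 n\<^sub>3)) * (LINT x|sphere_measure. zonal_harmonic p n\<^sub>1 x * zonal_harmonic p n\<^sub>2 x * zonal_harmonic p n\<^sub>3 x))"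
      unfolding case_prod_unfold
      by (subst Bochner_Integration.integral_sum) (intro integrable_mult_right iZ, simp only: integral_mult_right_zero)
    also have "\<dots> = (\<Sum>(n\<^sub>1, n\<^sub>2, n\<^sub>3)\<in>?X. ?c n\<^sub>1 n\<^sub>2 n\<^sub>3 * of_real (interaction n\<^sub>1 n\<^sub>2 n\<^sub>3) * ?k t (?\<xi> n\<^sub>1 n\<^sub>2 n\<^sub>3))"
      unfolding integral_triple_zonal[OF p] by (intro sum.cong refl) (simp add: case_prod_unfold mult_ac)
    finally show ?thesis .
  qed
  show ?thesis unfolding inner case_prod_unfold
    by (subst Bochner_Integration.integral_sum) (intro integrable_mult_right int, simp only: integral_mult_right_zero)
qed

theorem proposition4:
  fixes pole :: "real ^ 5" and s\<^sub>0 :: real and chi :: "real \<Rightarrow> complex"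
  assumes "pole \<in> sphere 0 1" and "s\<^sub>0 > 1 / 2" and "test_function chi"
  shows "\<exists>C>0. \<forall>N\<^sub>1 N\<^sub>2 N\<^sub>3 :: nat. \<forall>f\<^sub>1 f\<^sub>2 f\<^sub>3 :: real ^ 5 \<Rightarrow> complex.
    \<forall>u\<^sub>1 u\<^sub>2 u\<^sub>3 :: real \<Rightarrow> real ^ 5 \<Rightarrow> complex.
      dyadic N\<^sub>1 \<and> dyadic N\<^sub>2 \<and> dyadic N\<^sub>3 \<and>
      f\<^sub>1 \<in> sphere_L2 \<and> f\<^sub>2 \<in> sphere_L2 \<and> f\<^sub>3 \<in> sphere_L2 \<and>
      zonal pole f\<^sub>1 \<and> zonal pole f\<^sub>2 \<and> zonal pole f\<^sub>3 \<and>
      spectral_projector {real N\<^sub>1..2 * real N\<^sub>1} f\<^sub>1 f\<^sub>1 \<and>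
      spectral_projector {real N\<^sub>2..2 * real N\<^sub>2} f\<^sub>2 f\<^sub>2 \<and>
      spectral_projector {real N\<^sub>3..2 * real N\<^sub>3} f\<^sub>3 f\<^sub>3 \<and>
      (\<forall>t. schroedinger_flow t f\<^sub>1 (u\<^sub>1 t)) \<and>
      (\<forall>t. schroedinger_flow t f\<^sub>2 (u\<^sub>2 t)) \<and>
      (\<forall>t. schroedinger_flow t f\<^sub>3 (u\<^sub>3 t)) \<longrightarrow>
      (SUP \<tau>::real. ereal (cmod (LINT t|lborel. LINT x|sphere_measure.
          chi t * exp (\<i> * of_real (t * \<tau>)) * u\<^sub>1 t x * u\<^sub>2 t x * cnj (u\<^sub>3 t x))))
      \<le> ereal (C * real (min N\<^sub>1 (min N\<^sub>2 N\<^sub>3)) powr s\<^sub>0 * L2norm f\<^sub>1 * L2norm f\<^sub>2 * L2norm f\<^sub>3)"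
proof -
  have p: "norm pole = 1" using assms(1) by simp
  \<comment> \<open>The surplus over 1/2 is the \<epsilon> granted to the lattice point
    count.\<close>
  have e: "s\<^sub>0 - 1 / 2 > 0" using assms(2) by simp
  obtain C\<^sub>\<chi> where chi: "C\<^sub>\<chi> > 0" "\<And>\<xi>. cmod (LINT t|lborel. chi t * exp (\<i> * of_real (t * \<xi>))) \<le> C\<^sub>\<chi> / (1 + \<xi>\<^sup>2)"
    "\<And>\<xi>. integrable lborel (\<lambda>t. chi t * exp (\<i> * of_real (t * \<xi>)))"
    using test_function_fourier_decay[OF assms(3)] by blast
  obtain D where D: "D > 0" "\<And>M\<^sub>1 M\<^sub>2 M\<^sub>3 a b c. M\<^sub>1 \<ge> 1 \<Longrightarrow> M\<^sub>2 \<ge> 1 \<Longrightarrow> M\<^sub>3 \<ge> 1 \<Longrightarrow>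
     a \<le> 2 * M\<^sub>1 \<Longrightarrow> b \<le> 2 * M\<^sub>2 \<Longrightarrow> c \<le> 2 * M\<^sub>3 \<Longrightarrow>
     \<bar>interaction a b c\<bar> \<le> D * real (min M\<^sub>1 (min M\<^sub>2 M\<^sub>3)) powr (1 / 2)"
    using interaction_bound by blast
  obtain B where B: "B > 0" "\<And>N\<^sub>1 N\<^sub>2 N\<^sub>3 A\<^sub>1 A\<^sub>2 A\<^sub>3 \<tau> (a\<^sub>1 :: nat \<Rightarrow> real) a\<^sub>2 a\<^sub>3. N\<^sub>1 \<ge> 1 \<Longrightarrow> N\<^sub>2 \<ge> 1 \<Longrightarrow> N\<^sub>3 \<ge> 1 \<Longrightarrow>
     A\<^sub>1 \<subseteq> {..2 * N\<^sub>1} \<Longrightarrow> A\<^sub>2 \<subseteq> {..2 * N\<^sub>2} \<Longrightarrow> A\<^sub>3 \<subseteq> {..2 * N\<^sub>3} \<Longrightarrow>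
     (\<And>n. a\<^sub>1 n \<ge> 0) \<Longrightarrow> (\<And>n. a\<^sub>2 n \<ge> 0) \<Longrightarrow> (\<And>n. a\<^sub>3 n \<ge> 0) \<Longrightarrow>
     (\<Sum>(n\<^sub>1, n\<^sub>2, n\<^sub>3)\<in>{(n\<^sub>1, n\<^sub>2, n\<^sub>3) \<in> A\<^sub>1 \<times> A\<^sub>2 \<times> A\<^sub>3. \<bar>int n\<^sub>1 - int n\<^sub>2\<bar> \<le> int n\<^sub>3}.
        a\<^sub>1 n\<^sub>1 * a\<^sub>2 n\<^sub>2 * a\<^sub>3 n\<^sub>3 / (1 + (\<tau> - (gegenbauer_eigenvalue n\<^sub>1 + gegenbauer_eigenvalue n\<^sub>2 - gegenbauer_eigenvalue n\<^sub>3))\<^sup>2))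
     \<le> B * real (min N\<^sub>1 (min N\<^sub>2 N\<^sub>3)) powr (s\<^sub>0 - 1 / 2) * L2_set a\<^sub>1 A\<^sub>1 * L2_set a\<^sub>2 A\<^sub>2 * L2_set a\<^sub>3 A\<^sub>3"
    using interaction_sum_bound[OF e] by blast
  show ?thesis
  proof (intro exI[of _ "D * C\<^sub>\<chi> * B"] conjI allI impI)
    show "D * C\<^sub>\<chi> * B > 0" using chi(1) D(1) B(1) by simp
    fix N\<^sub>1 N\<^sub>2 N\<^sub>3 :: nat and f\<^sub>1 f\<^sub>2 f\<^sub>3 :: "real ^ 5 \<Rightarrow> complex" and u\<^sub>1 u\<^sub>2 u\<^sub>3 :: "real \<Rightarrow> real ^ 5 \<Rightarrow> complex"
    assume h: "dyadic N\<^sub>1 \<and> dyadic N\<^sub>2 \<and> dyadic N\<^sub>3 \<and>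
      f\<^sub>1 \<in> sphere_L2 \<and> f\<^sub>2 \<in> sphere_L2 \<and> f\<^sub>3 \<in> sphere_L2 \<and>
      zonal pole f\<^sub>1 \<and> zonal pole f\<^sub>2 \<and> zonal pole f\<^sub>3 \<and>
      spectral_projector {real N\<^sub>1..2 * real N\<^sub>1} f\<^sub>1 f\<^sub>1 \<and>
      spectral_projector {real N\<^sub>2..2 * real N\<^sub>2} f\<^sub>2 f\<^sub>2 \<and>
      spectral_projector {real N\<^sub>3..2 * real N\<^sub>3} f\<^sub>3 f\<^sub>3 \<and>
      (\<forall>t. schroedinger_flow t f\<^sub>1 (u\<^sub>1 t)) \<and>
      (\<forall>t. schroedinger_flow t f\<^sub>2 (u\<^sub>2 t)) \<and>
      (\<forall>t. schroedinger_flow t f\<^sub>3 (u\<^sub>3 t))"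
    have N: "N\<^sub>1 \<ge> 1" "N\<^sub>2 \<ge> 1" "N\<^sub>3 \<ge> 1" using h by (auto simp: dyadic_def)
    let ?M = "real (min N\<^sub>1 (min N\<^sub>2 N\<^sub>3))"
    let ?A\<^sub>1 = "spectral_window N\<^sub>1" let ?A\<^sub>2 = "spectral_window N\<^sub>2" let ?A\<^sub>3 = "spectral_window N\<^sub>3"
    let ?ev = gegenbauer_eigenvalue
    have flow: "schroedinger_flow t f\<^sub>1 (u\<^sub>1 t)" "schroedinger_flow t f\<^sub>2 (u\<^sub>2 t)" "schroedinger_flow t f\<^sub>3 (u\<^sub>3 t)" for t
      using h by blast+
    have z: "zonal pole f\<^sub>1" "zonal pole f\<^sub>2" "zonal pole f\<^sub>3" using h by blast+
    have proj: "spectral_projector {real N\<^sub>1..2 * real N\<^sub>1} f\<^sub>1 f\<^sub>1"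
      "spectral_projector {real N\<^sub>2..2 * real N\<^sub>2} f\<^sub>2 f\<^sub>2"
      "spectral_projector {real N\<^sub>3..2 * real N\<^sub>3} f\<^sub>3 f\<^sub>3" using h by blast+
    obtain c\<^sub>1 where c1: "\<And>t. AE x in sphere_measure. u\<^sub>1 t x = (\<Sum>n\<in>?A\<^sub>1. exp (- \<i> * of_real (t * ?ev n)) * c\<^sub>1 n * zonal_harmonic pole n x)"
      "(L2norm f\<^sub>1)\<^sup>2 = (\<Sum>n\<in>?A\<^sub>1. (cmod (c\<^sub>1 n))\<^sup>2)"
      by (rule zonal_flow_expansion[OF p z(1) proj(1) flow(1)]) (rule that, assumption, assumption)
    obtain c\<^sub>2 where c2: "\<And>t. AE x in sphere_measure. u\<^sub>2 t x = (\<Sum>n\<in>?A\<^sub>2. exp (- \<i> * of_real (t * ?ev n)) * c\<^sub>2 n * zonal_harmonic pole n x)"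
      "(L2norm f\<^sub>2)\<^sup>2 = (\<Sum>n\<in>?A\<^sub>2. (cmod (c\<^sub>2 n))\<^sup>2)"
      by (rule zonal_flow_expansion[OF p z(2) proj(2) flow(2)]) (rule that, assumption, assumption)
    obtain c\<^sub>3 where c3: "\<And>t. AE x in sphere_measure. u\<^sub>3 t x = (\<Sum>n\<in>?A\<^sub>3. exp (- \<i> * of_real (t * ?ev n)) * c\<^sub>3 n * zonal_harmonic pole n x)"
      "(L2norm f\<^sub>3)\<^sup>2 = (\<Sum>n\<in>?A\<^sub>3. (cmod (c\<^sub>3 n))\<^sup>2)"
      by (rule zonal_flow_expansion[OF p z(3) proj(3) flow(3)]) (rule that, assumption, assumption)
    have L2: "L2_set (\<lambda>n. cmod (c n)) A = L2norm f" if "(L2norm f)\<^sup>2 = (\<Sum>n\<in>A. (cmod (c n))\<^sup>2)"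
      for A c and f :: "real ^ 5 \<Rightarrow> complex"
    proof -
      have "L2norm f \<ge> 0" by (simp add: L2norm_def)
      then show ?thesis unfolding L2_set_def that[symmetric] by simp
    qed
    have u: "u\<^sub>1 t \<in> sphere_L2" "u\<^sub>2 t \<in> sphere_L2" "u\<^sub>3 t \<in> sphere_L2" for t
      using flow by (auto simp: schroedinger_flow_def spectral_multiplier_def)
    have sub: "spectral_window N \<subseteq> {..2 * N}" for N using spectral_window_le by auto
    show "(SUP \<tau>::real. ereal (cmod (LINT t|lborel. LINT x|sphere_measure.
          chi t * exp (\<i> * of_real (t * \<tau>)) * u\<^sub>1 t x * u\<^sub>2 t x * cnj (u\<^sub>3 t x))))
      \<le> ereal (D * C\<^sub>\<chi> * B * ?M powr s\<^sub>0 * L2norm f\<^sub>1 * L2norm f\<^sub>2 * L2norm f\<^sub>3)"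
    proof (rule SUP_least)
      fix \<tau> :: real
      let ?\<xi> = "\<lambda>n\<^sub>1 n\<^sub>2 n\<^sub>3. \<tau> - (?ev n\<^sub>1 + ?ev n\<^sub>2 - ?ev n\<^sub>3)"
      let ?h = "\<lambda>\<xi>. LINT t|lborel. chi t * exp (\<i> * of_real (t * \<xi>))"
      let ?X = "{(n\<^sub>1, n\<^sub>2, n\<^sub>3) \<in> ?A\<^sub>1 \<times> ?A\<^sub>2 \<times> ?A\<^sub>3. \<bar>int n\<^sub>1 - int n\<^sub>2\<bar> \<le> int n\<^sub>3}"
      let ?T = "\<lambda>(n\<^sub>1, n\<^sub>2, n\<^sub>3). c\<^sub>1 n\<^sub>1 * c\<^sub>2 n\<^sub>2 * cnj (c\<^sub>3 n\<^sub>3) * of_real (interaction n\<^sub>1 n\<^sub>2 n\<^sub>3) * ?h (?\<xi> n\<^sub>1 n\<^sub>2 n\<^sub>3)"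
      have fin: "finite (?A\<^sub>1 \<times> ?A\<^sub>2 \<times> ?A\<^sub>3)" by (intro finite_cartesian_product finite_spectral_window)
      have sel: "\<bar>int a - int b\<bar> \<le> int c" if "interaction a b c \<noteq> 0" for a b c
        using that interaction_selection[of a b c] by blast
      have "cmod (LINT t|lborel. LINT x|sphere_measure.
          chi t * exp (\<i> * of_real (t * \<tau>)) * u\<^sub>1 t x * u\<^sub>2 t x * cnj (u\<^sub>3 t x)) = cmod (\<Sum>x\<in>?A\<^sub>1 \<times> ?A\<^sub>2 \<times> ?A\<^sub>3. ?T x)"
        by (subst spacetime_integral_expansion[OF p finite_spectral_window finite_spectral_window finite_spectral_window u c1(1) c2(1) c3(1) chi(3)]) (rule refl)
      also have "(\<Sum>x\<in>?A\<^sub>1 \<times> ?A\<^sub>2 \<times> ?A\<^sub>3. ?T x) = (\<Sum>x\<in>?X. ?T x)"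
        by (rule sum.mono_neutral_right[OF fin]) (auto intro: sel)
      also have "cmod (\<Sum>x\<in>?X. ?T x) \<le> (\<Sum>x\<in>?X. cmod (?T x))" by (rule norm_sum)
      also have "\<dots> \<le> (\<Sum>(n\<^sub>1, n\<^sub>2, n\<^sub>3)\<in>?X. (D * ?M powr (1 / 2) * C\<^sub>\<chi>) *
          (cmod (c\<^sub>1 n\<^sub>1) * cmod (c\<^sub>2 n\<^sub>2) * cmod (c\<^sub>3 n\<^sub>3) / (1 + (?\<xi> n\<^sub>1 n\<^sub>2 n\<^sub>3)\<^sup>2)))"
      proof (rule sum_mono)
        fix x assume x: "x \<in> ?X"
        obtain n\<^sub>1 n\<^sub>2 n\<^sub>3 where n: "x = (n\<^sub>1, n\<^sub>2, n\<^sub>3)" by (cases x)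
        have le: "n\<^sub>1 \<le> 2 * N\<^sub>1" "n\<^sub>2 \<le> 2 * N\<^sub>2" "n\<^sub>3 \<le> 2 * N\<^sub>3" using x sub unfolding n by auto
        have "cmod (?T (n\<^sub>1, n\<^sub>2, n\<^sub>3)) = (cmod (c\<^sub>1 n\<^sub>1) * cmod (c\<^sub>2 n\<^sub>2) * cmod (c\<^sub>3 n\<^sub>3)) * (\<bar>interaction n\<^sub>1 n\<^sub>2 n\<^sub>3\<bar> * cmod (?h (?\<xi> n\<^sub>1 n\<^sub>2 n\<^sub>3)))"
          by (simp add: norm_mult)
        also have "\<dots> \<le> (cmod (c\<^sub>1 n\<^sub>1) * cmod (c\<^sub>2 n\<^sub>2) * cmod (c\<^sub>3 n\<^sub>3)) * ((D * ?M powr (1 / 2)) * (C\<^sub>\<chi> / (1 + (?\<xi> n\<^sub>1 n\<^sub>2 n\<^sub>3)\<^sup>2)))"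
          using D(1) by (intro mult_left_mono mult_mono D(2)[OF N le] chi(2)) auto
        also have "\<dots> = (D * ?M powr (1 / 2) * C\<^sub>\<chi>) *
          (cmod (c\<^sub>1 n\<^sub>1) * cmod (c\<^sub>2 n\<^sub>2) * cmod (c\<^sub>3 n\<^sub>3) / (1 + (?\<xi> n\<^sub>1 n\<^sub>2 n\<^sub>3)\<^sup>2))" by (simp add: mult_ac)
        finally show "cmod (?T x) \<le> (case x of (n\<^sub>1, n\<^sub>2, n\<^sub>3) \<Rightarrow> (D * ?M powr (1 / 2) * C\<^sub>\<chi>) *
          (cmod (c\<^sub>1 n\<^sub>1) * cmod (c\<^sub>2 n\<^sub>2) * cmod (c\<^sub>3 n\<^sub>3) / (1 + (?\<xi> n\<^sub>1 n\<^sub>2 n\<^sub>3)\<^sup>2)))" unfolding n by simp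
      qed
      also have "\<dots> = (D * ?M powr (1 / 2) * C\<^sub>\<chi>) * (\<Sum>(n\<^sub>1, n\<^sub>2, n\<^sub>3)\<in>?X.
          cmod (c\<^sub>1 n\<^sub>1) * cmod (c\<^sub>2 n\<^sub>2) * cmod (c\<^sub>3 n\<^sub>3) / (1 + (?\<xi> n\<^sub>1 n\<^sub>2 n\<^sub>3)\<^sup>2))"
        by (simp only: sum_distrib_left case_prod_unfold)
      also have "\<dots> \<le> (D * ?M powr (1 / 2) * C\<^sub>\<chi>) * (B * ?M powr (s\<^sub>0 - 1 / 2) * L2_set (\<lambda>n. cmod (c\<^sub>1 n)) ?A\<^sub>1
          * L2_set (\<lambda>n. cmod (c\<^sub>2 n)) ?A\<^sub>2 * L2_set (\<lambda>n. cmod (c\<^sub>3 n)) ?A\<^sub>3)"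
        using D(1) chi(1) by (intro mult_left_mono B(2)[OF N sub sub sub]) auto
      also have "\<dots> = (D * C\<^sub>\<chi> * B) * (?M powr (1 / 2) * ?M powr (s\<^sub>0 - 1 / 2)) * L2norm f\<^sub>1 * L2norm f\<^sub>2 * L2norm f\<^sub>3"
        unfolding L2[OF c1(2)] L2[OF c2(2)] L2[OF c3(2)] by (simp only: mult_ac)
      also have "?M powr (1 / 2) * ?M powr (s\<^sub>0 - 1 / 2) = ?M powr s\<^sub>0" by (simp add: powr_add[symmetric])
      finally show "ereal (cmod (LINT t|lborel. LINT x|sphere_measure.
          chi t * exp (\<i> * of_real (t * \<tau>)) * u\<^sub>1 t x * u\<^sub>2 t x * cnj (u\<^sub>3 t x)))
        \<le> ereal (D * C\<^sub>\<chi> * B * ?M powr s\<^sub>0 * L2norm f\<^sub>1 * L2norm f\<^sub>2 * L2norm f\<^sub>3)"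
        by (simp only: ereal_less_eq)
    qed
  qed
qed

end
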